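(* Let $\widetilde{H}$ be the affine Hecke algebra of type $G_2$ and assume $q^2\neq\pm1$. Let $t=t_{1,q^2}$ and $w_0=s_1s_2s_1s_2s_1s_2$. Let $\mathbb{C}v_t$ and $\mathbb{C}v_{w_0t}$ be the $1$-dimensional $\widetilde{H}_{\{2\}}$-modules given by $T_2v_t=qv_t$, $X^\lambda v_t=t(X^\lambda)v_t$, and $T_2v_{w_0t}=-q^{-1}v_{w_0t}$, $X^\lambda v_{w_0t}=(w_0t)(X^\lambda)v_{w_0t}$, and let $M=\widetilde{H}\otimes_{\widetilde{H}_{\{2\}}}\mathbb{C}v_t$ and $N=\widetilde{H}\otimes_{\widetilde{H}_{\{2\}}}\mathbb{C}v_{w_0t}$. Then the composition factors of $M$ and $N$ are the only irreducible $\widetilde{H}$-modules with central character $t_{1,q^2}$.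
   Context: The type $G_2$ root system has simple roots $\alpha_1,\alpha_2$ with $\langle\alpha_1,\alpha_2^\vee\rangle=-1$, $\langle\alpha_2,\alpha_1^\vee\rangle=-3$; $s_i\lambda=\lambda-\langle\lambda,\alpha_i^\vee\rangle\alpha_i$, and $W_0=\langle s_1,s_2\rangle$. $P=\mathbb{Z}\alpha_1+\mathbb{Z}\alpha_2$ is the weight lattice; $X=\{X^\lambda\mid\lambda\in P\}$, $X^\lambda X^\mu=X^{\lambda+\mu}$. For $q\in\mathbb{C}^\times$, $\widetilde{H}$ is the $\mathbb{C}$-algebra generated by $T_1,T_2$ and $X^\lambda$ ($\lambda\in P$), with the group algebra $\mathbb{C}[X]$ a subalgebra, subject to $T_i^2=(q-q^{-1})T_i+1$, $T_1T_2T_1T_2T_1T_2=T_2T_1T_2T_1T_2T_1$, and $X^\lambda T_i=T_iX^{s_i\lambda}+(q-q^{-1})\frac{X^\lambda-X^{s_i\lambda}}{1-X^{-\alpha_i}}$. $\widetilde{H}_{\{i\}}$ is the subalgebra generated by $T_i$ and $\mathbb{C}[X]$. Weights are elements of $T=\mathrm{Hom}(X,\mathbb{C}^\times)$, with $W_0$-action $(wt)(X^\lambda)=t(X^{w^{-1}\lambda})$; $t_{z,w}\in T$ is given by $t_{z,w}(X^{\alpha_1})=z$, $t_{z,w}(X^{\alpha_2})=w$. For a finite-dimensional $\widetilde{H}$-module $M$, $M_t^{\mathrm{gen}}=\{m\mid\forall\lambda\ \exists k>0:(X^\lambda-t(X^\lambda))^km=0\}$, and $t$ is a weight of $M$ if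 $M_t^{\mathrm{gen}}\neq0$. The weights of an irreducible $\widetilde{H}$-module lie in a single $W_0$-orbit; this orbit (or any element of it) is called its central character. (Irreducible $\widetilde{H}$-modules are finite-dimensional.) *)

theory Defs
  imports
    "HOL-Algebra.Algebra"
    "HOL-Algebra.Algebraic_Closure_Type"
    "HOL-Library.Poly_Mapping"
    "HOL-Library.Product_Plus"
    "HOL.Complex"
begin

section \<open>Left modules over a not necessarily commutative ring\<close>

text \<open>
  As everywhere in HOL-Algebra, the record \<^typ>\<open>('a, 'b) module\<close> carries fields \<^const>\<open>monoid.mult\<close>
  and \<^const>\<open>monoid.one\<close> that play no role for modules; they are never looked at below.
\<close>

locale left_module = R?: ring R + M?: abelian_group M
  for R :: "('r, 'n) ring_scheme" (structure) and M :: "('r, 'a, 'm) module_scheme" (structure) +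
  assumes smult_closed:
      "\<lbrakk>a \<in> carrier R; x \<in> carrier M\<rbrakk> \<Longrightarrow> a \<odot>\<^bsub>M\<^esub> x \<in> carrier M"
    and smult_l_distr:
      "\<lbrakk>a \<in> carrier R; b \<in> carrier R; x \<in> carrier M\<rbrakk>
        \<Longrightarrow> (a \<oplus> b) \<odot>\<^bsub>M\<^esub> x = a \<odot>\<^bsub>M\<^esub> x \<oplus>\<^bsub>M\<^esub> b \<odot>\<^bsub>M\<^esub> x"
    and smult_r_distr:
      "\<lbrakk>a \<in> carrier R; x \<in> carrier M; y \<in> carrier M\<rbrakk>
        \<Longrightarrow> a \<odot>\<^bsub>M\<^esub> (x \<oplus>\<^bsub>M\<^esub> y) = a \<odot>\<^bsub>M\<^esub> x \<oplus>\<^bsub>M\<^esub> a \<odot>\<^bsub>M\<^esub> y"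
    and smult_assoc:
      "\<lbrakk>a \<in> carrier R; b \<in> carrier R; x \<in> carrier M\<rbrakk>
        \<Longrightarrow> (a \<otimes> b) \<odot>\<^bsub>M\<^esub> x = a \<odot>\<^bsub>M\<^esub> (b \<odot>\<^bsub>M\<^esub> x)"
    and smult_one:
      "x \<in> carrier M \<Longrightarrow> \<one> \<odot>\<^bsub>M\<^esub> x = x"

definition quot_module :: "('a, 'b) module \<Rightarrow> 'b set \<Rightarrow> ('a, 'b set) module" where
  "quot_module M K =
    \<lparr>carrier = a_rcosets\<^bsub>M\<^esub> K, monoid.mult = undefined, one = undefined, ring.zero = K, ring.add = set_add M,
     module.smult = (\<lambda>r C. \<Union>m\<in>C. K +>\<^bsub>M\<^esub> (r \<odot>\<^bsub>M\<^esub> m))\<rparr>"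

definition module_isomorphic :: "('r, 'n) ring_scheme \<Rightarrow> ('r, 'a) module \<Rightarrow> ('r, 'b) module \<Rightarrow> bool"
where
  "module_isomorphic R M N \<longleftrightarrow>
    (\<exists>f. bij_betw f (carrier M) (carrier N) \<and>
         (\<forall>x\<in>carrier M. \<forall>y\<in>carrier M. f (x \<oplus>\<^bsub>M\<^esub> y) = f x \<oplus>\<^bsub>N\<^esub> f y) \<and>
         (\<forall>r\<in>carrier R. \<forall>x\<in>carrier M. f (r \<odot>\<^bsub>M\<^esub> x) = r \<odot>\<^bsub>N\<^esub> f x))"

definition irreducible_module :: "('r, 'n) ring_scheme \<Rightarrow> ('r, 'a) module \<Rightarrow> bool" where
  "irreducible_module R M \<longleftrightarrow> left_module R M \<and> carrier M \<noteq> {\<zero>\<^bsub>M\<^esub>} \<and>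
    (\<forall>K. submodule K R M \<longrightarrow> K = {\<zero>\<^bsub>M\<^esub>} \<or> K = carrier M)"

definition composition_series :: "('r, 'n) ring_scheme \<Rightarrow> ('r, 'a) module \<Rightarrow> 'a set list \<Rightarrow> bool"
where
  "composition_series R M Ks \<longleftrightarrow>
    Ks \<noteq> [] \<and> hd Ks = {\<zero>\<^bsub>M\<^esub>} \<and> last Ks = carrier M \<and> (\<forall>K\<in>set Ks. submodule K R M) \<and>
    (\<forall>i. Suc i < length Ks \<longrightarrow> Ks ! i \<subseteq> Ks ! Suc i \<and>
       irreducible_module R (quot_module (M\<lparr>carrier := Ks ! Suc i\<rparr>) (Ks ! i)))"

definition is_composition_factor ::
  "('r, 'n) ring_scheme \<Rightarrow> ('r, 'a) module \<Rightarrow> ('r, 'b) module \<Rightarrow> bool" where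
  "is_composition_factor R M L \<longleftrightarrow>
    (\<exists>Ks i. composition_series R M Ks \<and> Suc i < length Ks \<and>
       module_isomorphic R (quot_module (M\<lparr>carrier := Ks ! Suc i\<rparr>) (Ks ! i)) L)"


section \<open>Extension of scalars\<close>

text \<open>
  For a subring \<open>B\<close> of \<open>R\<close> and a left \<open>B\<close>-module \<open>V\<close>, the tensor product of \<open>R\<close> and \<open>V\<close> over \<open>B\<close>
  is the free abelian group on the symbols \<open>(r, v)\<close> modulo biadditivity and \<open>(r b, v) = (r, b v)\<close>.
  The operation of \<open>R\<close> by left multiplication is already defined on the free abelian group, but
  becomes additive in the ring element only in the quotient.
\<close>

definition tensor_symbols ::
  "('r, 'n) ring_scheme \<Rightarrow> ('r, 'a) module \<Rightarrow> ('r, ('r \<times> 'a) \<Rightarrow>\<^sub>0 int) module" where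
  "tensor_symbols R V =
    \<lparr>carrier = carrier (free_Abelian_group (carrier R \<times> carrier V)),
     monoid.mult = undefined, one = undefined, ring.zero = 0, ring.add = (+),
     module.smult = (\<lambda>r. frag_extend (\<lambda>(a, v). frag_of (r \<otimes>\<^bsub>R\<^esub> a, v)))\<rparr>"

definition tensor_relations ::
  "('r, 'n) ring_scheme \<Rightarrow> 'r set \<Rightarrow> ('r, 'a) module \<Rightarrow> (('r \<times> 'a) \<Rightarrow>\<^sub>0 int) set" where
  "tensor_relations R B V =
    {frag_of (a \<oplus>\<^bsub>R\<^esub> b, v) - frag_of (a, v) - frag_of (b, v) | a b v.
       a \<in> carrier R \<and> b \<in> carrier R \<and> v \<in> carrier V} \<union>
    {frag_of (a, v \<oplus>\<^bsub>V\<^esub> w) - frag_of (a, v) - frag_of (a, w) | a v w.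
       a \<in> carrier R \<and> v \<in> carrier V \<and> w \<in> carrier V} \<union>
    {frag_of (a \<otimes>\<^bsub>R\<^esub> b, v) - frag_of (a, b \<odot>\<^bsub>V\<^esub> v) | a b v.
       a \<in> carrier R \<and> b \<in> B \<and> v \<in> carrier V}"

definition induced_module ::
  "('r, 'n) ring_scheme \<Rightarrow> 'r set \<Rightarrow> ('r, 'a) module \<Rightarrow> ('r, (('r \<times> 'a) \<Rightarrow>\<^sub>0 int) set) module" where
  "induced_module R B V =
    quot_module (tensor_symbols R V)
      (generate (free_Abelian_group (carrier R \<times> carrier V)) (tensor_relations R B V))"


section \<open>The root system of type $G_2$\<close>

datatype node = N1 | N2

text \<open>\<open>cartan j i\<close> is the pairing of the root \<open>\<alpha>\<^sub>j\<close> with the coroot of \<open>\<alpha>\<^sub>i\<close>.\<close>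

fun cartan :: "node \<Rightarrow> node \<Rightarrow> int" where
  "cartan N1 N1 = 2"
| "cartan N1 N2 = -1"
| "cartan N2 N1 = -3"
| "cartan N2 N2 = 2"

text \<open>The pair \<open>(a, b)\<close> stands for the weight \<open>a \<alpha>\<^sub>1 + b \<alpha>\<^sub>2\<close>.\<close>

type_synonym wt = "int \<times> int"

fun alpha :: "node \<Rightarrow> wt" where
  "alpha N1 = (1, 0)"
| "alpha N2 = (0, 1)"

definition pairing :: "wt \<Rightarrow> node \<Rightarrow> int" where
  "pairing \<nu> i = fst \<nu> * cartan N1 i + snd \<nu> * cartan N2 i"

definition srefl :: "node \<Rightarrow> wt \<Rightarrow> wt" where
  "srefl i \<nu> = \<nu> - (pairing \<nu> i * fst (alpha i), pairing \<nu> i * snd (alpha i))"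

definition weyl_group :: "(wt \<Rightarrow> wt) set" where
  "weyl_group = generate (BijGroup UNIV) {srefl N1, srefl N2}"

definition w0 :: "wt \<Rightarrow> wt" where
  "w0 = srefl N1 \<circ> srefl N2 \<circ> srefl N1 \<circ> srefl N2 \<circ> srefl N1 \<circ> srefl N2"


section \<open>The affine Hecke algebra of type $G_2$\<close>

text \<open>
  The free monoid on a type, written additively so that the finitely supported functions
  \<open>'a free_mon \<Rightarrow>\<^sub>0 complex\<close> with their convolution product form the free associative algebra.
\<close>

datatype 'a free_mon = Word (letters: "'a list")

instantiation free_mon :: (type) monoid_add
begin

definition zero_free_mon :: "'a free_mon" where
  "zero_free_mon = Word []"

definition plus_free_mon :: "'a free_mon \<Rightarrow> 'a free_mon \<Rightarrow> 'a free_mon" where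
  "plus_free_mon u v = Word (letters u @ letters v)"

instance
  by standard (simp_all add: zero_free_mon_def plus_free_mon_def)

end

datatype gen = GT node | GX wt

type_synonym free_alg = "gen free_mon \<Rightarrow>\<^sub>0 complex"

definition fscal :: "complex \<Rightarrow> free_alg" where
  "fscal c = Poly_Mapping.single 0 c"

definition fgen :: "gen \<Rightarrow> free_alg" where
  "fgen g = Poly_Mapping.single (Word [g]) 1"

abbreviation fT :: "node \<Rightarrow> free_alg" where
  "fT i \<equiv> fgen (GT i)"

abbreviation fX :: "wt \<Rightarrow> free_alg" where
  "fX \<nu> \<equiv> fgen (GX \<nu>)"

text \<open>The group algebra of the weight lattice, again with convolution as its product.\<close>

type_synonym grp_alg = "wt \<Rightarrow>\<^sub>0 complex"

abbreviation gX :: "wt \<Rightarrow> grp_alg" where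
  "gX \<nu> \<equiv> Poly_Mapping.single \<nu> 1"

definition flift :: "grp_alg \<Rightarrow> free_alg" where
  "flift d = (\<Sum>\<mu>\<in>Poly_Mapping.keys d. fscal (Poly_Mapping.lookup d \<mu>) * fX \<mu>)"

text \<open>
  In the last family, writing \<open>\<alpha>\<close> for \<open>\<alpha>\<^sub>i\<close> and \<open>s\<close> for \<open>s\<^sub>i\<close>, the element \<open>d\<close> is the fraction
  \<open>(X\<^sup>\<nu> - X\<^sup>s\<^sup>\<nu>) / (1 - X\<^sup>-\<^sup>\<alpha>)\<close> of the group algebra. It exists, since \<open>s \<nu>\<close> differs from \<open>\<nu>\<close> by a
  multiple of \<open>\<alpha>\<close>, and it is unique, since \<open>1 - X\<^sup>-\<^sup>\<alpha>\<close> is not a zero divisor.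
\<close>

definition hecke_relations :: "complex \<Rightarrow> free_alg set" where
  "hecke_relations q =
    {fX 0 - 1} \<union>
    {fX \<nu> * fX \<mu> - fX (\<nu> + \<mu>) | \<nu> \<mu>. True} \<union>
    {fT i * fT i - (fscal (q - inverse q) * fT i + 1) | i. True} \<union>
    {fT N1 * fT N2 * fT N1 * fT N2 * fT N1 * fT N2 - fT N2 * fT N1 * fT N2 * fT N1 * fT N2 * fT N1} \<union>
    {fX \<nu> * fT i - (fT i * fX (srefl i \<nu>) + fscal (q - inverse q) * flift d) | \<nu> i d.
       d * (1 - gX (- alpha i)) = gX \<nu> - gX (srefl i \<nu>)}"

abbreviation free_alg_ring :: "free_alg ring" where
  "free_alg_ring \<equiv> ring_of_type_algebra"

definition hecke_ideal :: "complex \<Rightarrow> free_alg set" where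
  "hecke_ideal q = Idl\<^bsub>free_alg_ring\<^esub> (hecke_relations q)"

definition hecke :: "complex \<Rightarrow> free_alg set ring" where
  "hecke q = free_alg_ring Quot (hecke_ideal q)"

definition hclass :: "complex \<Rightarrow> free_alg \<Rightarrow> free_alg set" where
  "hclass q f = hecke_ideal q +>\<^bsub>free_alg_ring\<^esub> f"

definition hscal :: "complex \<Rightarrow> complex \<Rightarrow> free_alg set" where
  "hscal q c = hclass q (fscal c)"

definition hT :: "complex \<Rightarrow> node \<Rightarrow> free_alg set" where
  "hT q i = hclass q (fT i)"

definition hX :: "complex \<Rightarrow> wt \<Rightarrow> free_alg set" where
  "hX q \<nu> = hclass q (fX \<nu>)"

text \<open>The scalars are among the generators, so this is the generated complex subalgebra.\<close>

definition parabolic :: "complex \<Rightarrow> node \<Rightarrow> free_alg set set" where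
  "parabolic q i = generate_ring (hecke q) (range (hscal q) \<union> range (hX q) \<union> {hT q i})"


section \<open>Weights\<close>

text \<open>A homomorphism on the group of all \<open>X\<^sup>\<nu>\<close> is viewed as a function of the exponent \<open>\<nu>\<close>.\<close>

definition torus :: "(wt \<Rightarrow> complex) set" where
  "torus = {t. (\<forall>\<nu>. t \<nu> \<noteq> 0) \<and> (\<forall>\<nu> \<mu>. t (\<nu> + \<mu>) = t \<nu> * t \<mu>)}"

definition torus_pt :: "complex \<Rightarrow> complex \<Rightarrow> wt \<Rightarrow> complex" where
  "torus_pt z w \<nu> = z powi fst \<nu> * w powi snd \<nu>"

definition weyl_act :: "(wt \<Rightarrow> wt) \<Rightarrow> (wt \<Rightarrow> complex) \<Rightarrow> wt \<Rightarrow> complex" where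
  "weyl_act w t \<nu> = t (inv_into UNIV w \<nu>)"

definition gen_weight_space ::
  "complex \<Rightarrow> (free_alg set, 'a) module \<Rightarrow> (wt \<Rightarrow> complex) \<Rightarrow> 'a set" where
  "gen_weight_space q M t =
    {m \<in> carrier M. \<forall>\<nu>. \<exists>k>0.
       ((hX q \<nu> \<ominus>\<^bsub>hecke q\<^esub> hscal q (t \<nu>)) [^]\<^bsub>hecke q\<^esub> (k::nat)) \<odot>\<^bsub>M\<^esub> m = \<zero>\<^bsub>M\<^esub>}"

definition weights :: "complex \<Rightarrow> (free_alg set, 'a) module \<Rightarrow> (wt \<Rightarrow> complex) set" where
  "weights q M = {t \<in> torus. gen_weight_space q M t \<noteq> {\<zero>\<^bsub>M\<^esub>}}"

text \<open>
  Weights exist automatically in nonzero finite-dimensional modules. Requiring one makes the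
  definition meaningful without a finiteness assumption: a module without weights has no central
  character.
\<close>

definition has_central_character ::
  "complex \<Rightarrow> (free_alg set, 'a) module \<Rightarrow> (wt \<Rightarrow> complex) \<Rightarrow> bool" where
  "has_central_character q M t \<longleftrightarrow>
    weights q M \<noteq> {} \<and> weights q M \<subseteq> (\<lambda>w. weyl_act w t) ` weyl_group"

definition one_dim_module ::
  "complex \<Rightarrow> node \<Rightarrow> (free_alg set, 'a) module \<Rightarrow> 'a \<Rightarrow> complex \<Rightarrow> (wt \<Rightarrow> complex) \<Rightarrow> bool" where
  "one_dim_module q i V v c t \<longleftrightarrow>
    left_module ((hecke q)\<lparr>carrier := parabolic q i\<rparr>) V \<and>
    v \<in> carrier V \<and> v \<noteq> \<zero>\<^bsub>V\<^esub> \<and> carrier V = {hscal q a \<odot>\<^bsub>V\<^esub> v | a. True} \<and>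
    hT q i \<odot>\<^bsub>V\<^esub> v = hscal q c \<odot>\<^bsub>V\<^esub> v \<and>
    (\<forall>\<nu>. hX q \<nu> \<odot>\<^bsub>V\<^esub> v = hscal q (t \<nu>) \<odot>\<^bsub>V\<^esub> v)"

end

theory Submission
  imports Defs
begin

text \<open>
  Let \<open>t\<^sub>0 = t\<^bsub>1,q\<^sup>2\<^esub>\<close>. Its orbit consists of six weights \<open>t\<^sub>0, \<dots>, t\<^sub>5\<close>, where \<open>s\<^sub>2, s\<^sub>1, s\<^sub>2, s\<^sub>1, s\<^sub>2\<close> lead
  from each weight to the next. The module \<open>M\<close> is induced from \<open>t\<^sub>0\<close> and \<open>N\<close> from \<open>t\<^sub>5 = w\<^sub>0 t\<^sub>0\<close>. The
  defining relations of the algebra contain \<open>q\<close> only through \<open>q - q\<^sup>-\<^sup>1\<close>, so replacing \<open>q\<close> by \<open>- q\<^sup>-\<^sup>1\<close>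
  leaves the algebra unchanged, reverses the orbit and exchanges \<open>M\<close> and \<open>N\<close> (\<open>hecke_parameter\<close>). It
  is therefore enough to treat \<open>M\<close>.

  That the composition factors of \<open>M\<close> have weights in the orbit is a matter of triangularity: \<open>M\<close> is
  spanned by six vectors on which the \<open>X\<^sup>\<nu>\<close> act triangularly with weights \<open>t\<^sub>0, t\<^sub>0, t\<^sub>1, t\<^sub>2, t\<^sub>3, t\<^sub>4\<close>
  (\<open>induced_flag\<close>). The same holds for every quotient of \<open>M\<close>, which settles one direction
  (\<open>factor_weights\<close>), and it bounds the length of chains of submodules, so that composition series
  exist.

  Conversely, let \<open>L\<close> be irreducible with weights in the orbit, and follow an eigenvector with the
  intertwiners \<open>\<tau>\<^sub>i\<close>, which map weight \<open>t\<close> to \<open>s\<^sub>i t\<close>. Up to the symmetry in \<open>q\<close>, three cases remain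
  (\<open>orbit_classification\<close>): \<open>L\<close> has the weight \<open>t\<^sub>0\<close>; or \<open>L\<close> contains, and hence is, a line of
  weight \<open>t\<^sub>4\<close>; or \<open>L\<close> is spanned by a vector \<open>m\<close> of weight \<open>t\<^sub>2\<close> and by \<open>\<tau>\<^sub>2 m\<close>, of weight \<open>t\<^sub>3\<close>, which
  is zero for certain \<open>q\<close>. In the first case a vector of weight \<open>t\<^sub>0\<close> satisfies the relations of the
  generator of \<open>M\<close> (\<open>wt0_eig_T2\<close>), and \<open>L\<close> is a quotient of \<open>M\<close>.

  In the other cases \<open>L\<close> is in general no quotient of \<open>M\<close>, and it must be shown that \<open>M\<close> is large
  enough to contain it as a subquotient. For this an explicit module of dimension six is written
  down (\<open>hecke_operators_model\<close>), onto which \<open>M\<close> is mapped. It has vectors of weights \<open>t\<^sub>4\<close> and \<open>t\<^sub>2\<close>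
  that generate submodules of which \<open>L\<close> is a quotient.

  Modules are compared through annihilators instead of homomorphisms. If every ring element that
  kills \<open>x \<in> M\<close> also kills a nonzero \<open>m \<in> L\<close>, then \<open>L\<close> is a composition factor of \<open>M\<close>
  (\<open>composition_factorI\<close>), and such inclusions of annihilators follow from the universal property of
  the tensor product or from a relation between two modules that the generators preserve
  (\<open>hecke_rel_induct\<close>). The argument is uniform in \<open>q\<close>: roots of unity
  need no separate treatment.
\<close>

section \<open>Left modules\<close>

lemma (in abelian_group) minus_eq_zero_iff:
  assumes "x \<in> carrier G" "y \<in> carrier G"
  shows "x \<ominus> y = \<zero> \<longleftrightarrow> x = y"
  using assms by (metis a_inv_closed a_minus_def minus_equality minus_minus r_neg)

lemma (in abelian_group) minus_zero_right: "x \<in> carrier G \<Longrightarrow> x \<ominus> \<zero> = x"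
  using r_zero r_neg[of \<zero>] by (metis a_inv_closed a_minus_def l_zero zero_closed)

context left_module
begin

lemma smult_r_null: "a \<in> carrier R \<Longrightarrow> a \<odot>\<^bsub>M\<^esub> \<zero>\<^bsub>M\<^esub> = \<zero>\<^bsub>M\<^esub>"
  using smult_r_distr[of a "\<zero>\<^bsub>M\<^esub>" "\<zero>\<^bsub>M\<^esub>"] smult_closed[of a "\<zero>\<^bsub>M\<^esub>"]
  by (metis M.add.r_cancel_one' M.l_zero M.zero_closed)

lemma smult_l_null: "x \<in> carrier M \<Longrightarrow> \<zero> \<odot>\<^bsub>M\<^esub> x = \<zero>\<^bsub>M\<^esub>"
  using smult_l_distr[of \<zero> \<zero> x] smult_closed[of \<zero> x]
  by (metis M.add.r_cancel_one' R.l_zero R.zero_closed)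

lemma smult_l_minus:
  assumes "a \<in> carrier R" "x \<in> carrier M"
  shows "(\<ominus> a) \<odot>\<^bsub>M\<^esub> x = \<ominus>\<^bsub>M\<^esub> (a \<odot>\<^bsub>M\<^esub> x)"
  using smult_l_distr[of "\<ominus> a" a x] smult_l_null[of x] assms
  by (metis M.minus_equality R.a_inv_closed R.l_neg smult_closed)

lemma submoduleI:
  assumes "H \<subseteq> carrier M" and "\<zero>\<^bsub>M\<^esub> \<in> H"
    and "\<And>a b. a \<in> H \<Longrightarrow> b \<in> H \<Longrightarrow> a \<oplus>\<^bsub>M\<^esub> b \<in> H"
    and "\<And>a x. a \<in> carrier R \<Longrightarrow> x \<in> H \<Longrightarrow> a \<odot>\<^bsub>M\<^esub> x \<in> H"
  shows "submodule H R M"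
proof -
  have "\<ominus>\<^bsub>M\<^esub> x \<in> H" if "x \<in> H" for x
    using assms(4)[of "\<ominus> \<one>" x] that assms(1) smult_l_minus[of \<one> x] smult_one[of x] by auto
  with assms show ?thesis
    unfolding submodule_def submodule_axioms_def subgroup_def by (auto simp: a_inv_def)
qed

lemma submoduleD:
  assumes "submodule H R M"
  shows "H \<subseteq> carrier M" and "\<zero>\<^bsub>M\<^esub> \<in> H"
    and "\<And>a b. a \<in> H \<Longrightarrow> b \<in> H \<Longrightarrow> a \<oplus>\<^bsub>M\<^esub> b \<in> H"
    and "\<And>a b. a \<in> H \<Longrightarrow> b \<in> H \<Longrightarrow> a \<ominus>\<^bsub>M\<^esub> b \<in> H"
    and "\<And>a x. a \<in> carrier R \<Longrightarrow> x \<in> H \<Longrightarrow> a \<odot>\<^bsub>M\<^esub> x \<in> H"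
  using assms unfolding submodule_def submodule_axioms_def subgroup_def
  by (auto simp: a_inv_def a_minus_def)

lemma cyclic_submodule:
  assumes "x \<in> carrier M"
  shows "submodule {r \<odot>\<^bsub>M\<^esub> x | r. r \<in> carrier R} R M"
proof (rule submoduleI)
  show "\<zero>\<^bsub>M\<^esub> \<in> {r \<odot>\<^bsub>M\<^esub> x | r. r \<in> carrier R}"
    using smult_l_null[OF assms] by force
next
  fix a b
  assume "a \<in> {r \<odot>\<^bsub>M\<^esub> x | r. r \<in> carrier R}" "b \<in> {r \<odot>\<^bsub>M\<^esub> x | r. r \<in> carrier R}"
  then obtain r s where rs: "r \<in> carrier R" "s \<in> carrier R" "a = r \<odot>\<^bsub>M\<^esub> x" "b = s \<odot>\<^bsub>M\<^esub> x"
    by blast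
  then have "a \<oplus>\<^bsub>M\<^esub> b = (r \<oplus> s) \<odot>\<^bsub>M\<^esub> x"
    using assms by (simp add: smult_l_distr)
  with rs show "a \<oplus>\<^bsub>M\<^esub> b \<in> {r \<odot>\<^bsub>M\<^esub> x | r. r \<in> carrier R}"
    by blast
next
  fix a y
  assume a: "a \<in> carrier R" and "y \<in> {r \<odot>\<^bsub>M\<^esub> x | r. r \<in> carrier R}"
  then obtain r where r: "r \<in> carrier R" "y = r \<odot>\<^bsub>M\<^esub> x"
    by blast
  then have "a \<odot>\<^bsub>M\<^esub> y = (a \<otimes> r) \<odot>\<^bsub>M\<^esub> x"
    using assms a by (simp add: smult_assoc)
  with a r show "a \<odot>\<^bsub>M\<^esub> y \<in> {r \<odot>\<^bsub>M\<^esub> x | r. r \<in> carrier R}"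
    by blast
qed (use assms smult_closed in auto)

lemma submodule_left_module:
  assumes "submodule K R M"
  shows "left_module R (M\<lparr>carrier := K\<rparr>)"
proof -
  note K = submoduleD[OF assms]
  have "\<ominus>\<^bsub>M\<^esub> x \<in> K" if "x \<in> K" for x
    using K(4)[OF K(2) that] that K(1) by (auto simp: a_minus_def)
  then have "abelian_group (M\<lparr>carrier := K\<rparr>)"
    using K by (intro abelian_groupI)
      (auto simp: M.add.m_assoc M.add.m_comm M.add.m_lcomm subset_iff intro!: bexI[of _ "\<ominus>\<^bsub>M\<^esub> _"] M.r_neg)
  then show ?thesis
    using K by (intro left_module.intro left_module_axioms.intro R.ring_axioms)
      (auto simp: subset_iff smult_l_distr smult_r_distr smult_assoc smult_one)
qed

end

lemma irreducible_moduleD: "irreducible_module R M \<Longrightarrow> left_module R M"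
  by (simp add: irreducible_module_def)

lemma irreducible_cyclic:
  fixes M :: "('r, 'a) module" (structure)
  assumes M: "irreducible_module R M" and x: "x \<in> carrier M" "x \<noteq> \<zero>" and y: "y \<in> carrier M"
  shows "\<exists>r\<in>carrier R. y = r \<odot> x"
proof -
  interpret left_module R M by (rule irreducible_moduleD[OF M])
  have "x \<in> {r \<odot> x | r. r \<in> carrier R}"
    using smult_one[OF x(1)] R.one_closed by force
  then have "{r \<odot> x | r. r \<in> carrier R} = carrier M"
    using M x cyclic_submodule[OF x(1)] unfolding irreducible_module_def by blast
  with y show ?thesis by blast
qed

text \<open>
  Schur's lemma, stated through annihilators. Irreducible modules are cyclic on every nonzero
  vector, so the hypothesis makes \<open>r x \<mapsto> r y\<close> a well-defined surjection, and its kernel is a proper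
  submodule. In this form no homomorphism has to be constructed beforehand: it suffices to compare
  how ring elements act on one vector of each module.
\<close>

lemma irreducible_isomorphicI:
  fixes M :: "('r, 'a) module" (structure)
  assumes M: "irreducible_module R M" and L: "irreducible_module R L"
    and x: "x \<in> carrier M" and y: "y \<in> carrier L" "y \<noteq> \<zero>\<^bsub>L\<^esub>"
    and ann: "\<And>r. r \<in> carrier R \<Longrightarrow> r \<odot> x = \<zero> \<Longrightarrow> r \<odot>\<^bsub>L\<^esub> y = \<zero>\<^bsub>L\<^esub>"
  shows "module_isomorphic R M L"
proof -
  interpret M: left_module R M by (rule irreducible_moduleD[OF M])
  interpret L: left_module R L by (rule irreducible_moduleD[OF L])
  have x0: "x \<noteq> \<zero>"
    using ann[of "\<one>\<^bsub>R\<^esub>"] y x by (auto simp: M.smult_one L.smult_one)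
  have gen: "\<exists>r\<in>carrier R. z = r \<odot> x" if "z \<in> carrier M" for z
    using irreducible_cyclic[OF M x x0 that] .
  define f where "f z = (SOME r. r \<in> carrier R \<and> z = r \<odot> x) \<odot>\<^bsub>L\<^esub> y" for z
  have ann2: "r \<odot>\<^bsub>L\<^esub> y = s \<odot>\<^bsub>L\<^esub> y"
    if "r \<in> carrier R" "s \<in> carrier R" "r \<odot> x = s \<odot> x" for r s
  proof -
    have "(r \<ominus>\<^bsub>R\<^esub> s) \<odot> x = \<zero>"
      using that x by (simp add: a_minus_def M.smult_l_distr M.smult_l_minus M.smult_closed M.M.r_neg)
    then have "(r \<ominus>\<^bsub>R\<^esub> s) \<odot>\<^bsub>L\<^esub> y = \<zero>\<^bsub>L\<^esub>"
      using ann that by simp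
    then have "r \<odot>\<^bsub>L\<^esub> y \<ominus>\<^bsub>L\<^esub> s \<odot>\<^bsub>L\<^esub> y = \<zero>\<^bsub>L\<^esub>"
      using that y(1) by (simp add: a_minus_def L.smult_l_distr L.smult_l_minus)
    then show ?thesis
      using that y by (simp add: L.M.minus_eq_zero_iff L.smult_closed)
  qed
  have f: "f (r \<odot> x) = r \<odot>\<^bsub>L\<^esub> y" if "r \<in> carrier R" for r
  proof -
    have "(SOME s. s \<in> carrier R \<and> r \<odot> x = s \<odot> x) \<in> carrier R \<and>
      r \<odot> x = (SOME s. s \<in> carrier R \<and> r \<odot> x = s \<odot> x) \<odot> x"
      by (rule someI[of _ r]) (use that in simp)
    then show ?thesis
      unfolding f_def using ann2 that by metis
  qed
  have add: "f (u \<oplus> w) = f u \<oplus>\<^bsub>L\<^esub> f w" if uw: "u \<in> carrier M" "w \<in> carrier M" for u w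
  proof -
    obtain r s where "r \<in> carrier R" "s \<in> carrier R" "u = r \<odot> x" "w = s \<odot> x"
      using gen uw by metis
    then show ?thesis
      using f[of "r \<oplus>\<^bsub>R\<^esub> s"] x y by (simp add: f M.smult_l_distr L.smult_l_distr)
  qed
  have smult: "f (a \<odot> u) = a \<odot>\<^bsub>L\<^esub> f u" if au: "a \<in> carrier R" "u \<in> carrier M" for a u
  proof -
    obtain r where "r \<in> carrier R" "u = r \<odot> x"
      using gen au by metis
    then show ?thesis
      using f[of "a \<otimes>\<^bsub>R\<^esub> r"] x y au by (simp add: f M.smult_assoc L.smult_assoc)
  qed
  have ker: "submodule {u \<in> carrier M. f u = \<zero>\<^bsub>L\<^esub>} R M"
  proof (rule M.submoduleI)
    show "\<zero> \<in> {u \<in> carrier M. f u = \<zero>\<^bsub>L\<^esub>}"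
      using f[of "\<zero>\<^bsub>R\<^esub>"] x y by (simp add: M.smult_l_null L.smult_l_null)
  qed (auto simp: add smult M.smult_closed L.smult_r_null)
  have "f x \<noteq> \<zero>\<^bsub>L\<^esub>"
    using f[of "\<one>\<^bsub>R\<^esub>"] x y by (simp add: M.smult_one L.smult_one)
  then have ker0: "{u \<in> carrier M. f u = \<zero>\<^bsub>L\<^esub>} = {\<zero>}"
    using M ker x unfolding irreducible_module_def by blast
  have "inj_on f (carrier M)"
  proof (rule inj_onI)
    fix u w
    assume uw: "u \<in> carrier M" "w \<in> carrier M" "f u = f w"
    have fm: "f (\<ominus> w) = \<ominus>\<^bsub>L\<^esub> f w"
    proof -
      obtain r where "r \<in> carrier R" "w = r \<odot> x" using gen uw by metis
      then show ?thesis
        using f[of "\<ominus>\<^bsub>R\<^esub> r"] f[of r] x y by (simp add: M.smult_l_minus L.smult_l_minus)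
    qed
    have fw: "f w \<in> carrier L"
      using gen[OF uw(2)] f y by (auto simp: L.smult_closed)
    have "f (u \<ominus> w) = \<zero>\<^bsub>L\<^esub>"
      using uw fm fw by (simp add: a_minus_def add L.M.r_neg)
    then have "u \<ominus> w = \<zero>"
      using ker0 uw by blast
    then show "u = w"
      using uw by (simp add: M.M.minus_eq_zero_iff)
  qed
  moreover have "f ` carrier M = carrier L"
  proof
    show "f ` carrier M \<subseteq> carrier L"
    proof
      fix u assume "u \<in> f ` carrier M"
      then obtain z where z: "z \<in> carrier M" "u = f z" by blast
      with gen obtain r where "r \<in> carrier R" "z = r \<odot> x" by blast
      then show "u \<in> carrier L" using z f y by (simp add: L.smult_closed)
    qed
    show "carrier L \<subseteq> f ` carrier M"
    proof
      fix z assume "z \<in> carrier L"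
      then obtain r where "r \<in> carrier R" "z = r \<odot>\<^bsub>L\<^esub> y"
        using irreducible_cyclic[OF L y] by blast
      then show "z \<in> f ` carrier M"
        using f x by (intro image_eqI[of _ _ "r \<odot> x"]) (auto simp: M.smult_closed)
    qed
  qed
  ultimately show ?thesis
    unfolding module_isomorphic_def bij_betw_def using add smult by blast
qed

lemma module_isomorphicE:
  assumes iso: "module_isomorphic R M L" and M: "left_module R M" and L: "left_module R L"
  obtains f where "bij_betw f (carrier M) (carrier L)"
    and "\<And>x y. x \<in> carrier M \<Longrightarrow> y \<in> carrier M \<Longrightarrow> f (x \<oplus>\<^bsub>M\<^esub> y) = f x \<oplus>\<^bsub>L\<^esub> f y"
    and "\<And>r x. r \<in> carrier R \<Longrightarrow> x \<in> carrier M \<Longrightarrow> f (r \<odot>\<^bsub>M\<^esub> x) = r \<odot>\<^bsub>L\<^esub> f x"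
    and "f \<zero>\<^bsub>M\<^esub> = \<zero>\<^bsub>L\<^esub>"
proof -
  interpret M: left_module R M by (rule M)
  interpret L: left_module R L by (rule L)
  from iso obtain f where f: "bij_betw f (carrier M) (carrier L)"
    "\<And>x y. x \<in> carrier M \<Longrightarrow> y \<in> carrier M \<Longrightarrow> f (x \<oplus>\<^bsub>M\<^esub> y) = f x \<oplus>\<^bsub>L\<^esub> f y"
    "\<And>r x. r \<in> carrier R \<Longrightarrow> x \<in> carrier M \<Longrightarrow> f (r \<odot>\<^bsub>M\<^esub> x) = r \<odot>\<^bsub>L\<^esub> f x"
    unfolding module_isomorphic_def by auto
  have "f \<zero>\<^bsub>M\<^esub> = \<zero>\<^bsub>L\<^esub>"
    using f(3)[of "\<zero>\<^bsub>R\<^esub>" "\<zero>\<^bsub>M\<^esub>"] f(1) bij_betwE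
    by (metis L.smult_l_null M.M.zero_closed M.R.zero_closed M.smult_r_null)
  with f that show thesis by blast
qed

lemma irreducible_module_isomorphic:
  assumes iso: "module_isomorphic R M L" and M: "irreducible_module R M" and L: "left_module R L"
  shows "irreducible_module R L"
proof -
  interpret M: left_module R M by (rule irreducible_moduleD[OF M])
  interpret L: left_module R L by (rule L)
  obtain f where f: "bij_betw f (carrier M) (carrier L)"
    "\<And>x y. x \<in> carrier M \<Longrightarrow> y \<in> carrier M \<Longrightarrow> f (x \<oplus>\<^bsub>M\<^esub> y) = f x \<oplus>\<^bsub>L\<^esub> f y"
    "\<And>r x. r \<in> carrier R \<Longrightarrow> x \<in> carrier M \<Longrightarrow> f (r \<odot>\<^bsub>M\<^esub> x) = r \<odot>\<^bsub>L\<^esub> f x"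
    "f \<zero>\<^bsub>M\<^esub> = \<zero>\<^bsub>L\<^esub>"
    using module_isomorphicE[OF iso M.left_module_axioms L] by metis
  have inj: "inj_on f (carrier M)" and img: "f ` carrier M = carrier L"
    using f(1) by (auto simp: bij_betw_def)
  have "K = {\<zero>\<^bsub>L\<^esub>} \<or> K = carrier L" if K: "submodule K R L" for K
  proof -
    note Kd = L.submoduleD[OF K]
    have "submodule {u \<in> carrier M. f u \<in> K} R M"
      by (rule M.submoduleI) (auto simp: f Kd M.smult_closed)
    then have "{u \<in> carrier M. f u \<in> K} = {\<zero>\<^bsub>M\<^esub>} \<or> {u \<in> carrier M. f u \<in> K} = carrier M"
      using M unfolding irreducible_module_def by blast
    moreover have "K = f ` {u \<in> carrier M. f u \<in> K}"
      using Kd(1) unfolding img[symmetric] by blast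
    ultimately show ?thesis
      using f(4) img by auto
  qed
  moreover have "carrier L \<noteq> {\<zero>\<^bsub>L\<^esub>}"
  proof -
    obtain x where "x \<in> carrier M" "x \<noteq> \<zero>\<^bsub>M\<^esub>"
      using M unfolding irreducible_module_def by blast
    then have "f x \<noteq> \<zero>\<^bsub>L\<^esub>" "f x \<in> carrier L"
      using inj f(4) img inj_onD[OF inj, of x "\<zero>\<^bsub>M\<^esub>"] by auto
    then show ?thesis by blast
  qed
  ultimately show ?thesis
    using L unfolding irreducible_module_def by blast
qed

section \<open>Quotients\<close>

text \<open>
  Only additive operators that preserve a subgroup are assumed, and not the module laws, because on
  the symbols that span a tensor product the multiplication is additive in the ring element only
  modulo the relations.
\<close>

locale stable_quotient = R?: ring R + M?: abelian_group M
  for R :: "('r, 'n) ring_scheme" (structure) and M :: "('r, 'a) module" (structure)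
    and K :: "'a set" +
  assumes K_subgroup: "subgroup K (add_monoid M)"
    and op_closed: "\<lbrakk>r \<in> carrier R; x \<in> carrier M\<rbrakk> \<Longrightarrow> r \<odot>\<^bsub>M\<^esub> x \<in> carrier M"
    and op_add: "\<lbrakk>r \<in> carrier R; x \<in> carrier M; y \<in> carrier M\<rbrakk>
        \<Longrightarrow> r \<odot>\<^bsub>M\<^esub> (x \<oplus>\<^bsub>M\<^esub> y) = r \<odot>\<^bsub>M\<^esub> x \<oplus>\<^bsub>M\<^esub> r \<odot>\<^bsub>M\<^esub> y"
    and op_stable: "\<lbrakk>r \<in> carrier R; x \<in> K\<rbrakk> \<Longrightarrow> r \<odot>\<^bsub>M\<^esub> x \<in> K"
begin

abbreviation "Q \<equiv> quot_module M K"
abbreviation cls where "cls x \<equiv> K +>\<^bsub>M\<^esub> x"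

lemma K_subset: "K \<subseteq> carrier M"
  using subgroup.subset[OF K_subgroup] by simp

lemma K_closed:
  "\<zero>\<^bsub>M\<^esub> \<in> K" "x \<in> K \<Longrightarrow> y \<in> K \<Longrightarrow> x \<oplus>\<^bsub>M\<^esub> y \<in> K" "x \<in> K \<Longrightarrow> \<ominus>\<^bsub>M\<^esub> x \<in> K"
  using K_subgroup unfolding subgroup_def by (auto simp: a_inv_def)

lemma mem_cls: "x \<in> carrier M \<Longrightarrow> y \<in> cls x \<longleftrightarrow> y \<in> carrier M \<and> y \<ominus>\<^bsub>M\<^esub> x \<in> K"
proof -
  assume x: "x \<in> carrier M"
  have "y = (y \<ominus>\<^bsub>M\<^esub> x) \<oplus>\<^bsub>M\<^esub> x" if "y \<in> carrier M"
    using that x by (simp add: a_minus_def M.add.m_assoc M.l_neg)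
  moreover have "(h \<oplus>\<^bsub>M\<^esub> x) \<ominus>\<^bsub>M\<^esub> x = h" if "h \<in> carrier M" for h
    using that x by (simp add: a_minus_def M.add.m_assoc M.r_neg)
  ultimately show ?thesis
    using K_subset x unfolding a_r_coset_def' by (auto simp: subset_iff)
qed

lemma cls_eq_iff:
  assumes "x \<in> carrier M" "y \<in> carrier M"
  shows "cls x = cls y \<longleftrightarrow> x \<ominus>\<^bsub>M\<^esub> y \<in> K"
proof
  assume "cls x = cls y"
  moreover have "x \<in> cls x"
    using assms K_closed by (simp add: mem_cls a_minus_def M.r_neg)
  ultimately show "x \<ominus>\<^bsub>M\<^esub> y \<in> K"
    using mem_cls assms by simp
next
  assume "x \<ominus>\<^bsub>M\<^esub> y \<in> K"
  then have "x \<in> cls y" using mem_cls assms by simp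
  then show "cls x = cls y"
    using M.a_repr_independence[OF _ assms(2) K_subgroup] by simp
qed

lemma carrier_Q: "carrier Q = cls ` carrier M"
  by (auto simp: quot_module_def A_RCOSETS_def')

lemma zero_Q: "\<zero>\<^bsub>Q\<^esub> = cls \<zero>\<^bsub>M\<^esub>"
  using K_subset by (simp add: quot_module_def)

lemma cls_zero_iff: "x \<in> carrier M \<Longrightarrow> cls x = \<zero>\<^bsub>Q\<^esub> \<longleftrightarrow> x \<in> K"
  by (simp add: zero_Q cls_eq_iff M.minus_zero_right)

lemma cls_carrier: "x \<in> carrier M \<Longrightarrow> cls x \<in> carrier Q"
  by (simp add: carrier_Q)

lemma add_Q:
  assumes "x \<in> carrier M" "y \<in> carrier M"
  shows "cls x \<oplus>\<^bsub>Q\<^esub> cls y = cls (x \<oplus>\<^bsub>M\<^esub> y)"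
proof -
  interpret K: abelian_subgroup K M
    by (intro abelian_subgroupI3 additive_subgroup.intro K_subgroup M.abelian_group_axioms)
  show ?thesis
    using K.a_rcos_sum[of x y] assms by (simp add: quot_module_def)
qed

lemma op_minus: "\<lbrakk>r \<in> carrier R; x \<in> carrier M; y \<in> carrier M\<rbrakk>
  \<Longrightarrow> r \<odot>\<^bsub>M\<^esub> (x \<ominus>\<^bsub>M\<^esub> y) = r \<odot>\<^bsub>M\<^esub> x \<ominus>\<^bsub>M\<^esub> r \<odot>\<^bsub>M\<^esub> y"
proof -
  assume r: "r \<in> carrier R" and x: "x \<in> carrier M" and y: "y \<in> carrier M"
  have "r \<odot>\<^bsub>M\<^esub> x = r \<odot>\<^bsub>M\<^esub> ((x \<ominus>\<^bsub>M\<^esub> y) \<oplus>\<^bsub>M\<^esub> y)"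
    using x y by (simp add: a_minus_def M.add.m_assoc M.l_neg)
  also have "\<dots> = r \<odot>\<^bsub>M\<^esub> (x \<ominus>\<^bsub>M\<^esub> y) \<oplus>\<^bsub>M\<^esub> r \<odot>\<^bsub>M\<^esub> y"
    using r x y by (simp add: op_add)
  finally show ?thesis
    using r x y by (simp add: a_minus_def M.add.m_assoc M.r_neg op_closed)
qed

lemma smult_Q:
  assumes r: "r \<in> carrier R" and x: "x \<in> carrier M"
  shows "r \<odot>\<^bsub>Q\<^esub> cls x = cls (r \<odot>\<^bsub>M\<^esub> x)"
proof -
  have "cls (r \<odot>\<^bsub>M\<^esub> m) = cls (r \<odot>\<^bsub>M\<^esub> x)" if "m \<in> cls x" for m
  proof -
    have m: "m \<in> carrier M" "m \<ominus>\<^bsub>M\<^esub> x \<in> K" using that x mem_cls by auto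
    then have "r \<odot>\<^bsub>M\<^esub> m \<ominus>\<^bsub>M\<^esub> r \<odot>\<^bsub>M\<^esub> x \<in> K"
      using op_minus[OF r m(1) x] op_stable[OF r m(2)] by simp
    then show ?thesis using cls_eq_iff m r x op_closed by simp
  qed
  then have "(\<Union>m\<in>cls x. cls (r \<odot>\<^bsub>M\<^esub> m)) = (\<Union>m\<in>cls x. cls (r \<odot>\<^bsub>M\<^esub> x))"
    by (rule SUP_cong[OF refl])
  moreover have "x \<in> cls x"
    using x K_closed by (simp add: mem_cls a_minus_def M.r_neg)
  ultimately have "(\<Union>m\<in>cls x. cls (r \<odot>\<^bsub>M\<^esub> m)) = cls (r \<odot>\<^bsub>M\<^esub> x)"
    by blast
  then show ?thesis
    by (simp add: quot_module_def)
qed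

lemma abelian_group_Q: "abelian_group Q"
proof (rule abelian_groupI)
  fix C assume "C \<in> carrier Q"
  then obtain x where x: "x \<in> carrier M" "C = cls x" using carrier_Q by auto
  show "\<exists>D\<in>carrier Q. D \<oplus>\<^bsub>Q\<^esub> C = \<zero>\<^bsub>Q\<^esub>"
    by (rule bexI[of _ "cls (\<ominus>\<^bsub>M\<^esub> x)"]) (use x in \<open>simp_all add: add_Q M.l_neg zero_Q cls_carrier\<close>)
qed (auto simp: carrier_Q add_Q zero_Q M.add.m_assoc M.add.m_comm M.add.m_lcomm)

lemma left_module_Q:
  assumes "\<And>a b x. \<lbrakk>a \<in> carrier R; b \<in> carrier R; x \<in> carrier M\<rbrakk>
        \<Longrightarrow> cls ((a \<oplus> b) \<odot>\<^bsub>M\<^esub> x) = cls (a \<odot>\<^bsub>M\<^esub> x \<oplus>\<^bsub>M\<^esub> b \<odot>\<^bsub>M\<^esub> x)"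
    and "\<And>a b x. \<lbrakk>a \<in> carrier R; b \<in> carrier R; x \<in> carrier M\<rbrakk>
        \<Longrightarrow> cls ((a \<otimes> b) \<odot>\<^bsub>M\<^esub> x) = cls (a \<odot>\<^bsub>M\<^esub> (b \<odot>\<^bsub>M\<^esub> x))"
    and "\<And>x. x \<in> carrier M \<Longrightarrow> cls (\<one> \<odot>\<^bsub>M\<^esub> x) = cls x"
  shows "left_module R Q"
  by (intro left_module.intro left_module_axioms.intro abelian_group_Q R.ring_axioms)
    (auto simp: carrier_Q smult_Q add_Q op_closed op_add assms)

end

lemma subquotient:
  fixes M :: "('r, 'a) module" (structure)
  assumes M: "left_module R M" and J: "submodule J R M" and K: "submodule K R M" and KJ: "K \<subseteq> J"
  shows "stable_quotient R (M\<lparr>carrier := J\<rparr>) K"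
proof -
  interpret M: left_module R M by (rule M)
  interpret J: left_module R "M\<lparr>carrier := J\<rparr>" by (rule M.submodule_left_module[OF J])
  note Kd = M.submoduleD[OF K]
  have "submodule K R (M\<lparr>carrier := J\<rparr>)"
    by (rule J.submoduleI) (use KJ Kd in auto)
  then show ?thesis
    by (intro stable_quotient.intro stable_quotient_axioms.intro M.R.ring_axioms
        J.M.abelian_group_axioms submodule.axioms(1))
      (use J.smult_closed J.smult_r_distr Kd in auto)
qed

lemma subquotient_left_module:
  fixes M :: "('r, 'a) module" (structure)
  assumes M: "left_module R M" and J: "submodule J R M" and K: "submodule K R M" and KJ: "K \<subseteq> J"
  shows "left_module R (quot_module (M\<lparr>carrier := J\<rparr>) K)"
proof -
  interpret M: left_module R M by (rule M)
  interpret J: left_module R "M\<lparr>carrier := J\<rparr>" by (rule M.submodule_left_module[OF J])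
  interpret stable_quotient R "M\<lparr>carrier := J\<rparr>" K by (rule subquotient[OF assms])
  show ?thesis
    by (rule left_module_Q)
      (use J.smult_l_distr J.smult_assoc J.smult_one in auto)
qed

lemma irreducible_subquotientI:
  fixes M :: "('r, 'a) module" (structure)
  assumes M: "left_module R M" and J: "submodule J R M" and K: "submodule K R M" and KJ: "K \<subset> J"
    and max: "\<And>S. submodule S R M \<Longrightarrow> K \<subseteq> S \<Longrightarrow> S \<subseteq> J \<Longrightarrow> S = K \<or> S = J"
  shows "irreducible_module R (quot_module (M\<lparr>carrier := J\<rparr>) K)"
proof -
  interpret M: left_module R M by (rule M)
  have KJ': "K \<subseteq> J" using KJ by simp
  interpret stable_quotient R "M\<lparr>carrier := J\<rparr>" K by (rule subquotient[OF M J K KJ'])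
  interpret Q: left_module R Q by (rule subquotient_left_module[OF M J K KJ'])
  note Jd = M.submoduleD[OF J]
  have "S = {\<zero>\<^bsub>Q\<^esub>} \<or> S = carrier Q" if S: "submodule S R Q" for S
  proof -
    note Sd = Q.submoduleD[OF S]
    have sub: "submodule {x \<in> J. cls x \<in> S} R M"
    proof (rule M.submoduleI)
      show "\<zero> \<in> {x \<in> J. cls x \<in> S}"
        using Sd(2) zero_Q Jd(2) by simp
    next
      fix u w assume "u \<in> {x \<in> J. cls x \<in> S}" "w \<in> {x \<in> J. cls x \<in> S}"
      then show "u \<oplus> w \<in> {x \<in> J. cls x \<in> S}"
        using Jd(3) Sd(3)[of "cls u" "cls w"] add_Q[of u w] by simp
    next
      fix a u assume "a \<in> carrier R" "u \<in> {x \<in> J. cls x \<in> S}"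
      then show "a \<odot> u \<in> {x \<in> J. cls x \<in> S}"
        using Jd(5) Sd(5)[of a "cls u"] smult_Q[of a u] by simp
    qed (use Jd in auto)
    have "K \<subseteq> {x \<in> J. cls x \<in> S}"
    proof
      fix u assume u: "u \<in> K"
      then have "u \<in> J" "cls u = \<zero>\<^bsub>Q\<^esub>" using KJ' cls_zero_iff[of u] by auto
      then show "u \<in> {x \<in> J. cls x \<in> S}" using Sd(2) by simp
    qed
    with max[OF sub] have "{x \<in> J. cls x \<in> S} = K \<or> {x \<in> J. cls x \<in> S} = J" by blast
    moreover have "S = cls ` {x \<in> J. cls x \<in> S}"
      using Sd(1) carrier_Q by auto
    moreover have "cls ` K = {\<zero>\<^bsub>Q\<^esub>}"
      using cls_zero_iff KJ' K_closed(1) zero_Q by auto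
    ultimately show ?thesis
      using carrier_Q by auto
  qed
  moreover have "carrier Q \<noteq> {\<zero>\<^bsub>Q\<^esub>}"
  proof -
    obtain x where "x \<in> J" "x \<notin> K" using KJ by blast
    then have "cls x \<in> carrier Q" "cls x \<noteq> \<zero>\<^bsub>Q\<^esub>"
      using cls_zero_iff[of x] cls_carrier[of x] by auto
    then show ?thesis by blast
  qed
  ultimately show ?thesis
    unfolding irreducible_module_def using Q.left_module_axioms by blast
qed


section \<open>Composition series\<close>

text \<open>
  The function \<open>len\<close> plays the role of the dimension. Among the proper submodules of \<open>J\<close> one of
  maximal length leaves an irreducible quotient, and induction on the length continues below it.
\<close>

lemma composition_series_exists:
  fixes M :: "('r, 'a) module" (structure) and len :: "'a set \<Rightarrow> nat"
  assumes M: "left_module R M"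
    and len: "\<And>K J. submodule K R M \<Longrightarrow> submodule J R M \<Longrightarrow> K \<subset> J \<Longrightarrow> len K < len J"
  shows "\<exists>Ks. composition_series R M Ks"
proof -
  interpret left_module R M by (rule M)
  have zero: "submodule {\<zero>} R M"
    by (rule submoduleI) (auto simp: smult_r_null)
  have "\<exists>Ks. Ks \<noteq> [] \<and> hd Ks = {\<zero>} \<and> last Ks = J \<and> (\<forall>K\<in>set Ks. submodule K R M) \<and>
    (\<forall>i. Suc i < length Ks \<longrightarrow> Ks ! i \<subseteq> Ks ! Suc i \<and>
       irreducible_module R (quot_module (M\<lparr>carrier := Ks ! Suc i\<rparr>) (Ks ! i)))"
    if "submodule J R M" for J
    using that
  proof (induction "len J" arbitrary: J rule: less_induct)
    case less
    show ?case
    proof (cases "J = {\<zero>}")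
      case True
      then show ?thesis using zero by (intro exI[of _ "[{\<zero>}]"]) auto
    next
      case False
      let ?P = "\<lambda>K. submodule K R M \<and> K \<subset> J"
      have "?P {\<zero>}" using zero False submoduleD(2)[OF less.prems] by auto
      moreover have "\<forall>K. ?P K \<longrightarrow> len K < len J" using len less.prems by blast
      ultimately obtain K where K: "?P K" and max: "\<And>S. ?P S \<Longrightarrow> len S \<le> len K"
        using ex_has_greatest_nat[of ?P "{\<zero>}" len "len J"] by blast
      have irr: "irreducible_module R (quot_module (M\<lparr>carrier := J\<rparr>) K)"
      proof (rule irreducible_subquotientI[OF M less.prems])
        fix S assume S: "submodule S R M" "K \<subseteq> S" "S \<subseteq> J"
        show "S = K \<or> S = J"
          using max[of S] len[of K S] S K by (metis leD psubsetI)
      qed (use K in auto)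
      have "len K < len J" using len less.prems K by blast
      from less.hyps[OF this conjunct1[OF K]] obtain Ks where
        Ks': "Ks \<noteq> [] \<and> hd Ks = {\<zero>} \<and> last Ks = K \<and> (\<forall>K\<in>set Ks. submodule K R M) \<and>
        (\<forall>i. Suc i < length Ks \<longrightarrow> Ks ! i \<subseteq> Ks ! Suc i \<and>
           irreducible_module R (quot_module (M\<lparr>carrier := Ks ! Suc i\<rparr>) (Ks ! i)))" ..
      then have Ks: "Ks \<noteq> []" "hd Ks = {\<zero>}" "last Ks = K" "\<forall>K\<in>set Ks. submodule K R M"
        and Ksi: "\<And>i. Suc i < length Ks \<Longrightarrow> Ks ! i \<subseteq> Ks ! Suc i \<and>
           irreducible_module R (quot_module (M\<lparr>carrier := Ks ! Suc i\<rparr>) (Ks ! i))"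
        by simp_all
      have "(Ks @ [J]) ! i \<subseteq> (Ks @ [J]) ! Suc i \<and>
          irreducible_module R (quot_module (M\<lparr>carrier := (Ks @ [J]) ! Suc i\<rparr>) ((Ks @ [J]) ! i))"
        if i: "Suc i < length (Ks @ [J])" for i
      proof (cases "Suc i < length Ks")
        case True
        then show ?thesis using Ksi[OF True] by (simp add: nth_append)
      next
        case False
        then have "i = length Ks - 1" "i < length Ks" "Suc i = length Ks" using i Ks(1) by auto
        then have "(Ks @ [J]) ! i = K" "(Ks @ [J]) ! Suc i = J"
          using Ks(1,3) by (simp_all add: nth_append last_conv_nth)
        then show ?thesis using K irr by auto
      qed
      then show ?thesis
        using Ks(1,2,4) less.prems by (intro exI[of _ "Ks @ [J]"]) auto
    qed
  qed
  moreover have "submodule (carrier M) R M"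
    by (rule submoduleI) (auto simp: smult_closed)
  ultimately show ?thesis
    unfolding composition_series_def by blast
qed

text \<open>
  The part of the Jordan-Hoelder theorem that is needed. Going up the series, there is a first member
  that contains some \<open>r x\<close> with \<open>r y \<noteq> 0\<close>. In that step of the series the class of \<open>r x\<close> is nonzero
  and its annihilator still lies in that of \<open>r y\<close>, so Schur's lemma identifies the factor with \<open>L\<close>.
\<close>

lemma composition_factorI:
  fixes M :: "('r, 'a) module" (structure)
  assumes M: "left_module R M" and Ks: "composition_series R M Ks" and L: "irreducible_module R L"
    and x: "x \<in> carrier M" and y: "y \<in> carrier L" "y \<noteq> \<zero>\<^bsub>L\<^esub>"
    and ann: "\<And>r. r \<in> carrier R \<Longrightarrow> r \<odot> x = \<zero> \<Longrightarrow> r \<odot>\<^bsub>L\<^esub> y = \<zero>\<^bsub>L\<^esub>"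
  shows "is_composition_factor R M L"
proof -
  interpret M: left_module R M by (rule M)
  interpret L: left_module R L by (rule irreducible_moduleD[OF L])
  let ?P = "\<lambda>i. \<exists>r\<in>carrier R. r \<odot> x \<in> Ks ! i \<and> r \<odot>\<^bsub>L\<^esub> y \<noteq> \<zero>\<^bsub>L\<^esub>"
  have ne: "Ks \<noteq> []" and hd: "Ks ! 0 = {\<zero>}" and last: "Ks ! (length Ks - 1) = carrier M"
    using Ks by (auto simp: composition_series_def hd_conv_nth last_conv_nth)
  have "?P (length Ks - 1)"
    using last x y by (intro bexI[of _ "\<one>\<^bsub>R\<^esub>"]) (auto simp: M.smult_one L.smult_one)
  moreover have "\<not> ?P 0"
    using hd ann by auto
  ultimately obtain i where i: "i < length Ks - 1" "\<not> ?P i" "?P (Suc i)"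
    using ex_least_nat_less[of ?P "length Ks - 1"] by auto
  then have i': "Suc i < length Ks" by simp
  then have mem: "Ks ! Suc i \<in> set Ks" "Ks ! i \<in> set Ks" by auto
  with Ks i' have J: "submodule (Ks ! Suc i) R M" and K: "submodule (Ks ! i) R M"
    and KJ: "Ks ! i \<subseteq> Ks ! Suc i"
    and irr: "irreducible_module R (quot_module (M\<lparr>carrier := Ks ! Suc i\<rparr>) (Ks ! i))"
    unfolding composition_series_def by simp_all
  interpret Q: stable_quotient R "M\<lparr>carrier := Ks ! Suc i\<rparr>" "Ks ! i"
    by (rule subquotient[OF M J K KJ])
  from i(3) obtain r where r: "r \<in> carrier R" "r \<odot> x \<in> Ks ! Suc i" "r \<odot>\<^bsub>L\<^esub> y \<noteq> \<zero>\<^bsub>L\<^esub>"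
    by blast
  have "module_isomorphic R Q.Q L"
  proof (rule irreducible_isomorphicI[OF irr L, of "Q.cls (r \<odot> x)" "r \<odot>\<^bsub>L\<^esub> y"])
    fix s assume s: "s \<in> carrier R" "s \<odot>\<^bsub>Q.Q\<^esub> Q.cls (r \<odot> x) = \<zero>\<^bsub>Q.Q\<^esub>"
    then have "s \<odot> (r \<odot> x) \<in> Ks ! i"
      using r Q.smult_Q[of s "r \<odot> x"] Q.cls_zero_iff[of "s \<odot> (r \<odot> x)"] M.submoduleD(5)[OF J] by simp
    then have "(s \<otimes>\<^bsub>R\<^esub> r) \<odot> x \<in> Ks ! i"
      using s r x by (simp add: M.smult_assoc)
    then have "(s \<otimes>\<^bsub>R\<^esub> r) \<odot>\<^bsub>L\<^esub> y = \<zero>\<^bsub>L\<^esub>"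
      using i(2) s r by auto
    then show "s \<odot>\<^bsub>L\<^esub> (r \<odot>\<^bsub>L\<^esub> y) = \<zero>\<^bsub>L\<^esub>"
      using s r y by (simp add: L.smult_assoc)
  qed (use r y Q.cls_carrier in \<open>auto simp: L.smult_closed\<close>)
  then show ?thesis
    unfolding is_composition_factor_def using Ks i' by blast
qed


section \<open>Finitely supported functions\<close>

lemma poly_mapping_single_induct:
  assumes single: "\<And>k c. P (Poly_Mapping.single k c)"
    and add: "\<And>f g. P f \<Longrightarrow> P g \<Longrightarrow> P (f + g)"
  shows "P (f :: 'k \<Rightarrow>\<^sub>0 'c :: comm_monoid_add)"
proof (induction f rule: update_induct)
  case const
  show ?case using single[of _ 0] by simp
next
  case (update f a b)
  have "Poly_Mapping.update a b f = f + Poly_Mapping.single a b"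
    by (rule poly_mapping_eqI)
      (use update in \<open>auto simp: lookup_update lookup_add lookup_single in_keys_iff when_def\<close>)
  then show ?case using update add single by simp
qed

text \<open>
  The linear extension of a function on the weight lattice to the group algebra.
\<close>

definition pair_sum :: "(wt \<Rightarrow> complex) \<Rightarrow> grp_alg \<Rightarrow> complex" where
  "pair_sum g d = (\<Sum>\<mu>\<in>Poly_Mapping.keys d. Poly_Mapping.lookup d \<mu> * g \<mu>)"

lemma pair_sum_single [simp]: "pair_sum g (Poly_Mapping.single \<mu> c) = c * g \<mu>"
  by (cases "c = 0") (simp_all add: pair_sum_def)

lemma pair_sum_add [simp]: "pair_sum g (d + e) = pair_sum g d + pair_sum g e"
  unfolding pair_sum_def by (rule setsum_keys_plus_distrib) (simp_all add: algebra_simps)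

lemma pair_sum_diff [simp]: "pair_sum g (d - e) = pair_sum g d - pair_sum g e"
  using pair_sum_add[of g "d - e" e] by simp

lemma pair_sum_fun_diff: "pair_sum (\<lambda>\<mu>. g \<mu> - h \<mu>) d = pair_sum g d - pair_sum h d"
  by (simp add: pair_sum_def right_diff_distrib sum_subtractf)

lemma pair_sum_shift: "pair_sum g (d * gX \<beta>) = pair_sum (\<lambda>\<mu>. g (\<mu> + \<beta>)) d"
  by (induction d rule: poly_mapping_single_induct) (simp_all add: mult_single distrib_right)

text \<open>
  The quotient \<open>d\<close> of the Bernstein relation is only known through its defining equation. Every
  function \<open>g\<close> on the lattice turns that equation into one for the values of linear functionals at
  \<open>d\<close>: a character \<open>g\<close> gives the value of \<open>d\<close> at a point of the torus, and a character times a
  polynomial in a pairing gives derivatives there.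
\<close>

lemma pair_sum_difference:
  assumes "d * (1 - gX \<beta>) = gX \<nu> - gX \<kappa>"
  shows "pair_sum (\<lambda>\<mu>. g \<mu> - g (\<mu> + \<beta>)) d = g \<nu> - g \<kappa>"
proof -
  have "pair_sum g (d * (1 - gX \<beta>)) = g \<nu> - g \<kappa>"
    by (simp add: assms)
  then show ?thesis
    by (simp add: right_diff_distrib pair_sum_fun_diff pair_sum_shift)
qed

lemma flift_single: "flift (Poly_Mapping.single \<mu> c) = fscal c * fX \<mu>"
  by (cases "c = 0") (simp_all add: flift_def fscal_def)

lemma flift_add: "flift (d + e) = flift d + flift e"
  unfolding flift_def
  by (rule setsum_keys_plus_distrib) (simp_all add: fscal_def algebra_simps single_add)

lemma fscal_0 [simp]: "fscal 0 = 0" by (simp add: fscal_def)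
lemma fscal_1 [simp]: "fscal 1 = 1" by (simp add: fscal_def)
lemma fscal_add: "fscal (a + b) = fscal a + fscal b" by (simp add: fscal_def single_add)
lemma fscal_mult: "fscal (a * b) = fscal a * fscal b" by (simp add: fscal_def mult_single)
lemma fscal_uminus: "fscal (- a) = - fscal a" by (simp add: fscal_def single_uminus)

lemma fscal_commute: "f * fscal c = fscal c * f"
  by (induction f rule: poly_mapping_single_induct)
    (simp_all add: fscal_def mult_single mult.commute algebra_simps)

lemma free_alg_induct [case_names scal gen add mult]:
  assumes scal: "\<And>c. P (fscal c)" and gen: "\<And>g. P (fgen g)"
    and add: "\<And>f h. P f \<Longrightarrow> P h \<Longrightarrow> P (f + h)" and mult: "\<And>f h. P f \<Longrightarrow> P h \<Longrightarrow> P (f * h)"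
  shows "P f"
proof (induction f rule: poly_mapping_single_induct)
  case (1 w c)
  have "P (Poly_Mapping.single (Word gs) 1)" for gs
  proof (induction gs)
    case Nil
    show ?case using scal[of 1] by (simp add: fscal_def zero_free_mon_def)
  next
    case (Cons g gs)
    have "Poly_Mapping.single (Word (g # gs)) 1 = fgen g * Poly_Mapping.single (Word gs) (1::complex)"
      by (simp add: fgen_def mult_single plus_free_mon_def)
    then show ?case using mult[OF gen Cons.IH] by simp
  qed
  then have "P (Poly_Mapping.single w 1)" by (cases w) simp
  then have "P (fscal c * Poly_Mapping.single w 1)" by (rule mult[OF scal])
  then show ?case by (simp add: fscal_def mult_single)
qed (rule add)


section \<open>Dividing by one minus a root\<close>

lemma srefl_N1 [simp]: "srefl N1 \<nu> = (3 * snd \<nu> - fst \<nu>, snd \<nu>)"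
  by (simp add: srefl_def pairing_def prod_eq_iff algebra_simps)

lemma srefl_N2 [simp]: "srefl N2 \<nu> = (fst \<nu>, fst \<nu> - snd \<nu>)"
  by (simp add: srefl_def pairing_def prod_eq_iff algebra_simps)

lemma geometric_division:
  "(\<Sum>j<n. gX (\<nu> - (int j * a, int j * b))) * (1 - gX (- (a, b)))
    = gX \<nu> - gX (\<nu> - (int n * a, int n * b))"
proof (induction n)
  case 0 then show ?case by (simp add: zero_prod_def[symmetric])
next
  case (Suc n)
  have "gX (\<nu> - (int n * a, int n * b)) * (1 - gX (- (a, b)))
    = gX (\<nu> - (int n * a, int n * b)) - gX (\<nu> - (int (Suc n) * a, int (Suc n) * b))"
    by (cases \<nu>) (simp add: right_diff_distrib mult_single algebra_simps)
  then show ?case using Suc by (simp add: distrib_right)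
qed

lemma demazure_quotient_exists:
  "\<exists>d. d * (1 - gX (- alpha i)) = gX \<nu> - gX (srefl i \<nu>)"
proof -
  obtain a b where ab: "alpha i = (a, b)" by fastforce
  define p where "p = pairing \<nu> i"
  have s: "srefl i \<nu> = \<nu> - (p * a, p * b)"
    by (simp add: srefl_def p_def ab)
  show ?thesis
  proof (cases "p \<ge> 0")
    case True
    then show ?thesis
      using geometric_division[of \<nu> a b "nat p"] by (auto simp: s ab)
  next
    case False
    let ?d = "\<Sum>j<nat (- p). gX (srefl i \<nu> - (int j * a, int j * b))"
    have "srefl i \<nu> - (int (nat (- p)) * a, int (nat (- p)) * b) = \<nu>"
      using False unfolding s by (cases \<nu>) simp
    then have "?d * (1 - gX (- alpha i)) = gX (srefl i \<nu>) - gX \<nu>"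
      using geometric_division[of "srefl i \<nu>" a b "nat (- p)"] by (simp only: ab)
    then have "(- ?d) * (1 - gX (- alpha i)) = gX \<nu> - gX (srefl i \<nu>)"
      by (simp only: mult_minus_left) simp
    then show ?thesis by blast
  qed
qed


section \<open>The affine Hecke algebra as a quotient ring\<close>

lemma ring_free_alg: "ring free_alg_ring"
proof -
  have "\<exists>y. x + y = 0" for x :: free_alg
    using add.right_inverse by blast
  then show ?thesis
    unfolding ring_of_type_algebra_def using add.right_inverse
    by unfold_locales (auto simp: algebra_simps Units_def)
qed

lemma free_alg_ring_simps [simp]:
  "carrier free_alg_ring = UNIV" "f \<otimes>\<^bsub>free_alg_ring\<^esub> g = f * g" "f \<oplus>\<^bsub>free_alg_ring\<^esub> g = f + g"
  "\<one>\<^bsub>free_alg_ring\<^esub> = 1" "\<zero>\<^bsub>free_alg_ring\<^esub> = 0"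
  by (simp_all add: ring_of_type_algebra_def)

lemma ideal_hecke: "ideal (hecke_ideal q) free_alg_ring"
  unfolding hecke_ideal_def by (rule ring.genideal_ideal[OF ring_free_alg]) simp

lemma ring_hecke: "ring (hecke q)"
  unfolding hecke_def by (rule ideal.quotient_is_ring[OF ideal_hecke])

lemma carrier_hecke: "carrier (hecke q) = range (hclass q)"
  by (auto simp: hecke_def FactRing_def A_RCOSETS_def' hclass_def)

lemma hclass_hom: "hclass q \<in> ring_hom free_alg_ring (hecke q)"
  using ideal.rcos_ring_hom[OF ideal_hecke, of q] by (simp add: hecke_def hclass_def[abs_def])

lemma hclass_carrier [simp]: "hclass q f \<in> carrier (hecke q)"
  by (simp add: carrier_hecke)

lemma hclass_add: "hclass q (f + g) = hclass q f \<oplus>\<^bsub>hecke q\<^esub> hclass q g"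
  using ring_hom_add[OF hclass_hom, of f g] by simp

lemma hclass_mult: "hclass q (f * g) = hclass q f \<otimes>\<^bsub>hecke q\<^esub> hclass q g"
  using ring_hom_mult[OF hclass_hom, of f g] by simp

lemma hclass_1: "hclass q 1 = \<one>\<^bsub>hecke q\<^esub>"
  using ring_hom_one[OF hclass_hom] by simp

lemma hclass_0: "hclass q 0 = \<zero>\<^bsub>hecke q\<^esub>"
proof -
  interpret ring "hecke q" by (rule ring_hecke)
  show ?thesis
    using hclass_add[of q 0 0] by (metis add.r_cancel_one' hclass_carrier add_0)
qed

lemma hclass_uminus: "hclass q (- f) = \<ominus>\<^bsub>hecke q\<^esub> hclass q f"
proof -
  interpret ring "hecke q" by (rule ring_hecke)
  show ?thesis
    using hclass_add[of q "- f" f] by (metis hclass_0 hclass_carrier add.left_inverse minus_equality)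
qed

lemma hclass_eq_iff: "hclass q f = hclass q g \<longleftrightarrow> f - g \<in> hecke_ideal q"
proof -
  interpret ideal "hecke_ideal q" free_alg_ring by (rule ideal_hecke)
  have "f - g = f \<ominus>\<^bsub>free_alg_ring\<^esub> g"
    using add.inv_equality[of "- g" g] by (simp add: a_minus_def a_inv_def[symmetric])
  then show ?thesis
    unfolding hclass_def using quotient_eq_iff_same_a_r_cos[OF ideal_hecke[of q], of f g] by simp
qed

lemma hclass_relation: "f - g \<in> hecke_relations q \<Longrightarrow> hclass q f = hclass q g"
  using ring.genideal_self[OF ring_free_alg, of "hecke_relations q"]
  by (auto simp: hclass_eq_iff hecke_ideal_def)

lemma
  shows hclass_X0: "hclass q (fX 0) = hclass q 1"
    and hclass_X_add: "hclass q (fX \<nu> * fX \<mu>) = hclass q (fX (\<nu> + \<mu>))"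
    and hclass_T_square: "hclass q (fT i * fT i) = hclass q (fscal (q - inverse q) * fT i + 1)"
    and hclass_braid: "hclass q (fT N1 * fT N2 * fT N1 * fT N2 * fT N1 * fT N2)
      = hclass q (fT N2 * fT N1 * fT N2 * fT N1 * fT N2 * fT N1)"
    and hclass_bernstein: "d * (1 - gX (- alpha i)) = gX \<nu> - gX (srefl i \<nu>) \<Longrightarrow>
      hclass q (fX \<nu> * fT i) = hclass q (fT i * fX (srefl i \<nu>) + fscal (q - inverse q) * flift d)"
  by (rule hclass_relation; unfold hecke_relations_def; blast)+


section \<open>Modules over the affine Hecke algebra\<close>

text \<open>
  Modules are studied through the action of the free algebra, where the ordinary ring operations of
  the type are available; the defining relations enter only through equality of classes.
\<close>

locale hecke_module = left_module "hecke q" L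
  for q :: complex and L :: "(free_alg set, 'a) module" (structure)
begin

definition act :: "free_alg \<Rightarrow> 'a \<Rightarrow> 'a" where
  "act f x = hclass q f \<odot> x"

abbreviation sc :: "complex \<Rightarrow> 'a \<Rightarrow> 'a" where "sc c \<equiv> act (fscal c)"
abbreviation opT :: "node \<Rightarrow> 'a \<Rightarrow> 'a" where "opT i \<equiv> act (fT i)"
abbreviation opX :: "wt \<Rightarrow> 'a \<Rightarrow> 'a" where "opX \<nu> \<equiv> act (fX \<nu>)"

lemma act_closed [simp]: "x \<in> carrier L \<Longrightarrow> act f x \<in> carrier L"
  by (simp add: act_def smult_closed)

lemma act_add_left: "x \<in> carrier L \<Longrightarrow> act (f + g) x = act f x \<oplus> act g x"
  by (simp add: act_def hclass_add smult_l_distr)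

lemma act_mult: "x \<in> carrier L \<Longrightarrow> act (f * g) x = act f (act g x)"
  by (simp add: act_def hclass_mult smult_assoc)

lemma act_1 [simp]: "x \<in> carrier L \<Longrightarrow> act 1 x = x"
  by (simp add: act_def hclass_1 smult_one)

lemma act_0_left [simp]: "x \<in> carrier L \<Longrightarrow> act 0 x = \<zero>"
  by (simp add: act_def hclass_0 smult_l_null)

lemma act_add [simp]: "x \<in> carrier L \<Longrightarrow> y \<in> carrier L \<Longrightarrow> act f (x \<oplus> y) = act f x \<oplus> act f y"
  by (simp add: act_def smult_r_distr)

lemma act_0 [simp]: "act f \<zero> = \<zero>"
  by (simp add: act_def smult_r_null)

lemma act_uminus_left: "x \<in> carrier L \<Longrightarrow> act (- f) x = \<ominus> act f x"
  by (simp add: act_def hclass_uminus smult_l_minus)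

lemma sc_sc [simp]: "x \<in> carrier L \<Longrightarrow> sc a (sc b x) = sc (a * b) x"
  by (simp add: fscal_mult act_mult)

lemma sc_add: "x \<in> carrier L \<Longrightarrow> sc (a + b) x = sc a x \<oplus> sc b x"
  by (simp add: fscal_add act_add_left)

lemma sc_uminus: "x \<in> carrier L \<Longrightarrow> sc (- a) x = \<ominus> sc a x"
  by (simp add: fscal_uminus act_uminus_left)

lemma act_sc [simp]: "x \<in> carrier L \<Longrightarrow> act (fgen g) (sc c x) = sc c (act (fgen g) x)"
  by (metis act_mult fscal_commute)

lemma act_cong: "hclass q f = hclass q g \<Longrightarrow> act f x = act g x"
  by (simp add: act_def)

lemma X_0: "x \<in> carrier L \<Longrightarrow> opX 0 x = x"
  using act_cong[OF hclass_X0] by simp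

lemma X_add: "x \<in> carrier L \<Longrightarrow> opX (\<nu> + \<mu>) x = opX \<nu> (opX \<mu> x)"
  using act_cong[OF hclass_X_add] by (metis act_mult)

lemma T_square: "x \<in> carrier L \<Longrightarrow> opT i (opT i x) = sc (q - inverse q) (opT i x) \<oplus> x"
  using act_cong[OF hclass_T_square, of i x] by (simp add: act_mult act_add_left)

lemma braid:
  "x \<in> carrier L \<Longrightarrow> opT N1 (opT N2 (opT N1 (opT N2 (opT N1 (opT N2 x))))) = opT N2 (opT N1 (opT N2 (opT N1 (opT N2 (opT N1 x)))))"
  using act_cong[OF hclass_braid, of x] by (simp add: act_mult)

lemma bernstein:
  assumes "x \<in> carrier L" "d * (1 - gX (- alpha i)) = gX \<nu> - gX (srefl i \<nu>)"
  shows "opX \<nu> (opT i x) = opT i (opX (srefl i \<nu>) x) \<oplus> sc (q - inverse q) (act (flift d) x)"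
  using act_cong[OF hclass_bernstein[OF assms(2)], of x] assms(1) by (simp add: act_mult act_add_left)

end

text \<open>
  The relation \<open>P\<close> is a submodule of the product of two modules. If it consists of the pairs
  \<open>(\<Sum>c\<^sub>k x\<^sub>k, \<Sum>c\<^sub>k y\<^sub>k)\<close>, preservation by the generators means that they act on the \<open>x\<^sub>k\<close> and on the
  \<open>y\<^sub>k\<close> by the same matrices, and the conclusion compares annihilators. With equal modules and \<open>P\<close>
  below the diagonal it is a closure principle.
\<close>

lemma hecke_rel_induct:
  assumes L: "hecke_module q L" and N: "hecke_module q N"
    and car: "\<And>x y. P x y \<Longrightarrow> x \<in> carrier L \<and> y \<in> carrier N"
    and add: "\<And>x y x' y'. P x y \<Longrightarrow> P x' y' \<Longrightarrow> P (x \<oplus>\<^bsub>L\<^esub> x') (y \<oplus>\<^bsub>N\<^esub> y')"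
    and scal: "\<And>c x y. P x y \<Longrightarrow> P (hecke_module.act q L (fscal c) x) (hecke_module.act q N (fscal c) y)"
    and gen: "\<And>g x y. P x y \<Longrightarrow> P (hecke_module.act q L (fgen g) x) (hecke_module.act q N (fgen g) y)"
    and r: "r \<in> carrier (hecke q)" and xy: "P x y"
  shows "P (r \<odot>\<^bsub>L\<^esub> x) (r \<odot>\<^bsub>N\<^esub> y)"
proof -
  interpret L: hecke_module q L by (rule L)
  interpret N: hecke_module q N by (rule N)
  have "\<forall>x y. P x y \<longrightarrow> P (L.act f x) (N.act f y)" for f
  proof (induction f rule: free_alg_induct)
    case (add f h)
    then show ?case using car assms(4) by (auto simp: L.act_add_left N.act_add_left)
  next
    case (mult f h)
    then show ?case using car by (auto simp: L.act_mult N.act_mult)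
  qed (use scal gen in auto)
  then show ?thesis
    using r xy by (auto simp: carrier_hecke L.act_def N.act_def)
qed


section \<open>Flags of weight spaces\<close>

context hecke_module
begin

definition eig :: "(wt \<Rightarrow> complex) \<Rightarrow> 'a set" where
  "eig s = {m \<in> carrier L. \<forall>\<nu>. opX \<nu> m = sc (s \<nu>) m}"

definition subsp :: "'a set \<Rightarrow> bool" where
  "subsp F \<longleftrightarrow> F \<subseteq> carrier L \<and> \<zero> \<in> F \<and> (\<forall>x\<in>F. \<forall>y\<in>F. x \<oplus> y \<in> F) \<and> (\<forall>x\<in>F. \<forall>c. sc c x \<in> F)"

definition stable :: "gen set \<Rightarrow> 'a set \<Rightarrow> bool" where
  "stable G F \<longleftrightarrow> subsp F \<and> (\<forall>g\<in>G. \<forall>x\<in>F. act (fgen g) x \<in> F)"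

definition add_line :: "'a set \<Rightarrow> 'a \<Rightarrow> 'a set" where
  "add_line F b = {y \<oplus> sc c b | y c. y \<in> F}"

definition eig_mod :: "'a set \<Rightarrow> (wt \<Rightarrow> complex) \<Rightarrow> 'a \<Rightarrow> bool" where
  "eig_mod F s b \<longleftrightarrow> b \<in> carrier L \<and> (\<forall>\<nu>. \<exists>z\<in>F. opX \<nu> b = z \<oplus> sc (s \<nu>) b)"

text \<open>
  A chain of subspaces, each obtained from the one before by adding a vector on which the \<open>X\<^sup>\<nu>\<close> act
  by a character modulo that subspace. The vectors need not be independent, so that no basis has to
  be known; the set collects the characters.
\<close>

inductive flag :: "'a set \<Rightarrow> (wt \<Rightarrow> complex) set \<Rightarrow> bool" where
  flag_zero: "flag {\<zero>} {}"
| flag_step: "flag F S \<Longrightarrow> eig_mod F s b \<Longrightarrow> flag (add_line F b) (insert s S)"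

lemma eigD: "m \<in> eig s \<Longrightarrow> m \<in> carrier L" "m \<in> eig s \<Longrightarrow> opX \<nu> m = sc (s \<nu>) m"
  unfolding eig_def by blast+

lemma eig_modD: "eig_mod F s b \<Longrightarrow> \<exists>z\<in>F. opX \<nu> b = z \<oplus> sc (s \<nu>) b"
  unfolding eig_mod_def by blast

lemma subspD:
  assumes "subsp F"
  shows "F \<subseteq> carrier L" "\<zero> \<in> F" "\<And>x y. x \<in> F \<Longrightarrow> y \<in> F \<Longrightarrow> x \<oplus> y \<in> F" "\<And>x c. x \<in> F \<Longrightarrow> sc c x \<in> F"
    "\<And>x. x \<in> F \<Longrightarrow> x \<in> carrier L"
  using assms by (auto simp: subsp_def)

lemma stableD: "stable G F \<Longrightarrow> subsp F" "stable G F \<Longrightarrow> g \<in> G \<Longrightarrow> x \<in> F \<Longrightarrow> act (fgen g) x \<in> F"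
  by (simp_all add: stable_def)

lemma subsp_add_line:
  assumes F: "subsp F" and b: "b \<in> carrier L"
  shows "subsp (add_line F b)"
proof -
  have dec: "\<exists>u a. x = u \<oplus> sc a b \<and> u \<in> F \<and> u \<in> carrier L" if "x \<in> add_line F b" for x
    using that subspD(5)[OF F] by (auto simp: add_line_def)
  have mem: "u \<oplus> sc a b \<in> add_line F b" if "u \<in> F" for u a
    using that by (auto simp: add_line_def)
  have "add_line F b \<subseteq> carrier L"
    using dec b by force
  moreover have "\<zero> \<in> add_line F b"
    using mem[OF subspD(2)[OF F], of 0] b by simp
  moreover have "sc c x \<in> add_line F b" if "x \<in> add_line F b" for c x
  proof -
    obtain u a where u: "x = u \<oplus> sc a b" "u \<in> F" "u \<in> carrier L" using dec[OF \<open>x \<in> _\<close>] by blast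
    have "sc c x = sc c u \<oplus> sc (c * a) b" using u b by simp
    then show ?thesis using mem[OF subspD(4)[OF F u(2)]] by simp
  qed
  moreover have "x \<oplus> y \<in> add_line F b" if "x \<in> add_line F b" "y \<in> add_line F b" for x y
  proof -
    obtain u a where u: "x = u \<oplus> sc a b" "u \<in> F" "u \<in> carrier L" using dec[OF \<open>x \<in> _\<close>] by blast
    obtain w e where w: "y = w \<oplus> sc e b" "w \<in> F" "w \<in> carrier L" using dec[OF \<open>y \<in> _\<close>] by blast
    have "x \<oplus> y = (u \<oplus> w) \<oplus> sc (a + e) b" using u w b by (simp add: sc_add M.add.m_ac)
    then show ?thesis using mem[OF subspD(3)[OF F u(2) w(2)]] by simp
  qed
  ultimately show ?thesis
    unfolding subsp_def by blast
qed

lemma add_line_mono: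
  assumes F: "subsp F" and b: "b \<in> carrier L" and x: "x \<in> F"
  shows "x \<in> add_line F b"
proof -
  have "x = x \<oplus> sc 0 b" using subspD(5)[OF F x] b by simp
  with x show ?thesis unfolding add_line_def by blast
qed

lemma add_line_self:
  assumes F: "subsp F" and b: "b \<in> carrier L"
  shows "b \<in> add_line F b"
proof -
  have "b = \<zero> \<oplus> sc 1 b" using b by simp
  with subspD(2)[OF F] show ?thesis unfolding add_line_def by blast
qed

lemma stable_add_line:
  assumes F: "subsp F" and b: "b \<in> carrier L"
    and img: "\<And>g x. g \<in> G \<Longrightarrow> x \<in> F \<Longrightarrow> act (fgen g) x \<in> add_line F b"
    and imgb: "\<And>g. g \<in> G \<Longrightarrow> act (fgen g) b \<in> add_line F b"
  shows "stable G (add_line F b)"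
proof -
  note Fb = subspD[OF subsp_add_line[OF F b]]
  have "act (fgen g) x \<in> add_line F b" if g: "g \<in> G" and x: "x \<in> add_line F b" for g x
  proof -
    from x obtain u a where u: "x = u \<oplus> sc a b" "u \<in> F" "u \<in> carrier L"
      using subspD(1)[OF F] by (auto simp: add_line_def)
    have "act (fgen g) x = act (fgen g) u \<oplus> sc a (act (fgen g) b)"
      using u b by simp
    then show ?thesis using Fb(3)[OF img[OF g u(2)] Fb(4)[OF imgb[OF g]]] by simp
  qed
  then show ?thesis
    unfolding stable_def using subsp_add_line[OF F b] by blast
qed

lemma subsp_zero: "subsp {\<zero>}"
  by (simp add: subsp_def)

lemma flag_stable: "flag F S \<Longrightarrow> stable (range GX) F"
proof (induction rule: flag.induct)
  case flag_zero
  then show ?case by (simp add: stable_def subsp_zero)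
next
  case (flag_step F S s b)
  note F = stableD(1)[OF flag_step.IH]
  from flag_step.hyps have b: "b \<in> carrier L" by (simp add: eig_mod_def)
  show ?case
  proof (rule stable_add_line[OF F b])
    fix g assume g: "g \<in> range GX"
    show "act (fgen g) x \<in> add_line F b" if "x \<in> F" for x
      using add_line_mono[OF F b] stableD(2)[OF flag_step.IH g that] by simp
    show "act (fgen g) b \<in> add_line F b"
      using g flag_step.hyps unfolding eig_mod_def add_line_def by blast
  qed
qed

text \<open>
  The triangular shape of the action: \<open>X\<^sup>\<nu> - s(\<nu>)\<close> maps each member of a flag into the one before.
\<close>

lemma eig_mod_add_line:
  assumes F: "stable (range GX) F" and b: "eig_mod F s b" and x: "x \<in> add_line F b"
  shows "opX \<nu> x \<oplus> sc (- s \<nu>) x \<in> F"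
proof -
  note Fs = subspD[OF stableD(1)[OF F]]
  have bc: "b \<in> carrier L" using b by (simp add: eig_mod_def)
  from x obtain u a where u: "x = u \<oplus> sc a b" "u \<in> F" "u \<in> carrier L"
    using Fs(1) by (auto simp: add_line_def)
  obtain z where z: "z \<in> F" "opX \<nu> b = z \<oplus> sc (s \<nu>) b" using eig_modD[OF b] by blast
  have zc: "z \<in> carrier L" using z Fs by simp
  have Xu: "opX \<nu> u \<in> F" using stableD(2)[OF F] u by blast
  have "opX \<nu> x \<oplus> sc (- s \<nu>) x
    = (opX \<nu> u \<oplus> sc a z \<oplus> sc (- s \<nu>) u) \<oplus> (sc (a * s \<nu>) b \<oplus> sc (- (a * s \<nu>)) b)"
    using u bc z zc by (simp add: M.add.m_ac mult.commute)
  also have "sc (a * s \<nu>) b \<oplus> sc (- (a * s \<nu>)) b = \<zero>"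
    using bc sc_add[of b "a * s \<nu>" "- (a * s \<nu>)"] by simp
  finally show ?thesis using Fs Xu z u by simp
qed

lemma flag_eigenweight:
  assumes "flag F S" "x \<in> F" "x \<in> eig t" "x \<noteq> \<zero>"
  shows "t \<in> S"
  using assms
proof (induction rule: flag.induct)
  case flag_zero
  then show ?case by simp
next
  case (flag_step F S s b)
  note st = flag_stable[OF flag_step.hyps(1)]
  note xc = eigD(1)[OF flag_step.prems(2)]
  show ?case
  proof (cases "t = s")
    case False
    then obtain \<nu> where \<nu>: "t \<nu> \<noteq> s \<nu>" by blast
    have "sc (t \<nu> - s \<nu>) x \<in> F"
      using eig_mod_add_line[OF st flag_step.hyps(2) flag_step.prems(1), of \<nu>]
        eigD(2)[OF flag_step.prems(2), of \<nu>] sc_add[OF xc, of "t \<nu>" "- s \<nu>"] by simp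
    then have "sc (1 / (t \<nu> - s \<nu>)) (sc (t \<nu> - s \<nu>) x) \<in> F"
      by (rule subspD(4)[OF stableD(1)[OF st]])
    then have "x \<in> F" using \<nu> xc by simp
    then show ?thesis using flag_step.IH flag_step.prems by blast
  qed simp
qed

text \<open>
  At the first member of the flag that meets \<open>K\<close> outside zero, \<open>X\<^sup>\<nu> - s(\<nu>)\<close> maps the
  intersection into zero.
\<close>

lemma flag_eigenvector_exists:
  assumes "flag F S" "stable (range GX) K" "x \<in> F" "x \<in> K" "x \<noteq> \<zero>"
  shows "\<exists>y s. y \<in> K \<and> y \<noteq> \<zero> \<and> y \<in> eig s"
  using assms
proof (induction arbitrary: x rule: flag.induct)
  case flag_zero
  then show ?case by simp
next
  case (flag_step F S s b)
  note st = flag_stable[OF flag_step.hyps(1)]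
  note K = subspD[OF stableD(1)[OF flag_step.prems(1)]]
  show ?case
  proof (cases "\<exists>y. y \<in> F \<and> y \<in> K \<and> y \<noteq> \<zero>")
    case True
    then show ?thesis using flag_step.IH flag_step.prems(1) by blast
  next
    case False
    have xc: "x \<in> carrier L" using K(5)[OF flag_step.prems(3)] .
    have "opX \<nu> x = sc (s \<nu>) x" for \<nu>
    proof -
      have "opX \<nu> x \<oplus> sc (- s \<nu>) x \<in> K"
        using K(3,4) stableD(2)[OF flag_step.prems(1)] flag_step.prems(3) by simp
      then have "opX \<nu> x \<oplus> sc (- s \<nu>) x = \<zero>"
        using False eig_mod_add_line[OF st flag_step.hyps(2) flag_step.prems(2)] by blast
      then show ?thesis
        using xc M.minus_eq_zero_iff[of "opX \<nu> x" "sc (s \<nu>) x"] by (simp add: a_minus_def sc_uminus)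
    qed
    then have "x \<in> eig s" using xc by (simp add: eig_def)
    then show ?thesis using flag_step.prems by blast
  qed
qed

text \<open>
  The length of \<open>K\<close> counts the steps of the flag at which \<open>K\<close> has an element with leading coefficient
  one. It is the dimension of \<open>K\<close> when the vectors of the flag are independent, and a dependent step
  adds one to the length of every subspace.
\<close>

lemma flag_length_function:
  assumes "flag F S"
  shows "\<exists>len :: 'a set \<Rightarrow> nat. \<forall>K J. subsp K \<longrightarrow> subsp J \<longrightarrow> K \<subseteq> J \<longrightarrow>
    len K \<le> len J \<and> (len K = len J \<longrightarrow> J \<inter> F \<subseteq> K)"
  using assms
proof (induction rule: flag.induct)
  case flag_zero
  then show ?case by (intro exI[of _ "\<lambda>_. 0"]) (auto simp: subsp_def)
next
  case (flag_step F S s b)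
  note F = subspD[OF stableD(1)[OF flag_stable[OF flag_step.hyps(1)]]]
  from flag_step.hyps have b: "b \<in> carrier L" by (simp add: eig_mod_def)
  from flag_step.IH obtain len :: "'a set \<Rightarrow> nat" where
    len0: "\<forall>K J. subsp K \<longrightarrow> subsp J \<longrightarrow> K \<subseteq> J \<longrightarrow>
      len K \<le> len J \<and> (len K = len J \<longrightarrow> J \<inter> F \<subseteq> K)" ..
  then have len: "\<And>K J. subsp K \<Longrightarrow> subsp J \<Longrightarrow> K \<subseteq> J \<Longrightarrow> len K \<le> len J"
      "\<And>K J. subsp K \<Longrightarrow> subsp J \<Longrightarrow> K \<subseteq> J \<Longrightarrow> len K = len J \<Longrightarrow> J \<inter> F \<subseteq> K"
    by simp_all
  define hit where "hit K \<longleftrightarrow> (\<exists>y\<in>F. y \<oplus> b \<in> K)" for K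
  define len' where "len' K = len K + (if hit K then 1 else 0)" for K
  have "len' K \<le> len' J \<and> (len' K = len' J \<longrightarrow> J \<inter> add_line F b \<subseteq> K)"
    if K: "subsp K" and J: "subsp J" and KJ: "K \<subseteq> J" for K J
  proof -
    have hit: "hit K \<Longrightarrow> hit J" using KJ by (auto simp: hit_def)
    have le: "len K \<le> len J" using len(1)[OF K J KJ] .
    moreover have "x \<in> K" if eq: "len' K = len' J" and x: "x \<in> J" "x \<in> add_line F b" for x
    proof -
      have eqs: "len K = len J" "hit K = hit J"
        using eq le hit by (auto simp: len'_def split: if_splits)
      note JF = len(2)[OF K J KJ eqs(1)]
      from x obtain u a where u: "x = u \<oplus> sc a b" "u \<in> F" "u \<in> carrier L"
        using F(1) by (auto simp: add_line_def)
      show ?thesis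
      proof (cases "a = 0")
        case True
        then have "x = u" using u b by simp
        then show ?thesis using JF x u by blast
      next
        case False
        have "sc (1 / a) x = sc (1 / a) u \<oplus> b" using u b False by simp
        then have "hit J"
          unfolding hit_def using F(4)[OF u(2), of "1 / a"] subspD(4)[OF J x(1), of "1 / a"] by metis
        then obtain y where y: "y \<in> F" "y \<oplus> b \<in> K" using eqs hit_def by blast
        have yc: "y \<in> carrier L" using F y by blast
        have "x = sc a (y \<oplus> b) \<oplus> (sc (- a) y \<oplus> u)"
        proof -
          have "sc a y \<oplus> sc (- a) y = \<zero>" using yc sc_add[of y a "- a"] by simp
          moreover have "sc a (y \<oplus> b) \<oplus> (sc (- a) y \<oplus> u) = (sc a y \<oplus> sc (- a) y) \<oplus> (u \<oplus> sc a b)"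
            using yc b u by (simp add: M.add.m_ac)
          ultimately show ?thesis using u b by simp
        qed
        moreover have "sc a (y \<oplus> b) \<in> K" using subspD(4)[OF K y(2)] .
        moreover have "sc (- a) y \<oplus> u \<in> K"
        proof -
          have "sc (- a) y \<oplus> u = x \<oplus> sc (- a) (y \<oplus> b)"
          proof -
            have "sc a b \<oplus> sc (- a) b = \<zero>" using b sc_add[of b a "- a"] by simp
            moreover have "(u \<oplus> sc a b) \<oplus> (sc (- a) y \<oplus> sc (- a) b)
                = (sc (- a) y \<oplus> u) \<oplus> (sc a b \<oplus> sc (- a) b)"
              using yc b u by (simp add: M.add.m_ac)
            ultimately show ?thesis using u b yc by simp
          qed
          then have "sc (- a) y \<oplus> u \<in> J"
            using subspD(3)[OF J x(1) subspD(4)[OF J]] KJ y(2) by auto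
          moreover have "sc (- a) y \<oplus> u \<in> F" using F(3,4) y u by simp
          ultimately show ?thesis using JF by blast
        qed
        ultimately show ?thesis using subspD(3)[OF K] by metis
      qed
    qed
    ultimately show ?thesis
      using hit by (auto simp: len'_def)
  qed
  then show ?case by blast
qed

lemma submodule_stable:
  assumes "submodule K (hecke q) L"
  shows "stable UNIV K"
  using submoduleD[OF assms] unfolding stable_def subsp_def by (auto simp: act_def)

lemma stable_smult:
  assumes F: "stable UNIV F" and x: "x \<in> F" and r: "r \<in> carrier (hecke q)"
  shows "r \<odot> x \<in> F"
proof -
  have "r \<odot> x \<in> F \<and> r \<odot> x = r \<odot> x"
    by (rule hecke_rel_induct[where P = "\<lambda>u w. u \<in> F \<and> u = w"])
      (use r x hecke_module_axioms subspD[OF stableD(1)[OF F]] stableD(2)[OF F] in auto)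
  then show ?thesis by simp
qed

lemma act_flift_closed:
  assumes "stable (range GX) F" "x \<in> F"
  shows "act (flift d) x \<in> F"
proof (induction d rule: poly_mapping_single_induct)
  case (1 \<mu> c)
  then show ?case
    using assms subspD[OF stableD(1)[OF assms(1)]] stableD(2)[OF assms(1), of "GX \<mu>"]
    by (simp add: flift_single act_mult)
next
  case (2 d e)
  then show ?case
    using assms subspD[OF stableD(1)[OF assms(1)]] by (simp add: flift_add act_add_left)
qed

lemma act_flift_eig:
  assumes "x \<in> eig s"
  shows "act (flift d) x = sc (pair_sum s d) x"
proof (induction d rule: poly_mapping_single_induct)
  case (1 \<mu> c)
  then show ?case
    using eigD[OF assms] by (simp add: flift_single act_mult)
next
  case (2 d e)
  then show ?case
    using eigD[OF assms] by (simp add: flift_add act_add_left sc_add)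
qed

text \<open>
  In the Bernstein relation the first summand moves the weight \<open>s\<close> to \<open>s \<circ> s\<^sub>i\<close>, and the second one
  stays in the span of the vectors that are already present.
\<close>

lemma eig_mod_T:
  assumes F: "stable (range GX) F" "stable {GT i} F" and b: "eig_mod F s b"
  shows "eig_mod (add_line F b) (s \<circ> srefl i) (opT i b)"
proof -
  note Fs = subspD[OF stableD(1)[OF F(1)]]
  have bc: "b \<in> carrier L" using b by (simp add: eig_mod_def)
  note Fb = subspD[OF subsp_add_line[OF stableD(1)[OF F(1)] bc]]
  have st: "stable (range GX) (add_line F b)"
  proof (rule stable_add_line[OF stableD(1)[OF F(1)] bc])
    fix g assume g: "g \<in> range GX"
    show "act (fgen g) x \<in> add_line F b" if "x \<in> F" for x
      using add_line_mono[OF stableD(1)[OF F(1)] bc] stableD(2)[OF F(1) g that] by simp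
    show "act (fgen g) b \<in> add_line F b"
      using g b unfolding eig_mod_def add_line_def by blast
  qed
  have "\<exists>z\<in>add_line F b. opX \<nu> (opT i b) = z \<oplus> sc ((s \<circ> srefl i) \<nu>) (opT i b)" for \<nu>
  proof -
    obtain d where d: "d * (1 - gX (- alpha i)) = gX \<nu> - gX (srefl i \<nu>)"
      using demazure_quotient_exists by blast
    obtain z where z: "z \<in> F" "opX (srefl i \<nu>) b = z \<oplus> sc (s (srefl i \<nu>)) b"
      using eig_modD[OF b] by blast
    have zc: "z \<in> carrier L" using z Fs by simp
    let ?w = "sc (q - inverse q) (act (flift d) b)"
    have "opX \<nu> (opT i b) = (opT i z \<oplus> ?w) \<oplus> sc (s (srefl i \<nu>)) (opT i b)"
      unfolding bernstein[OF bc d] z using bc zc by (simp add: M.add.m_ac)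
    moreover have "opT i z \<oplus> ?w \<in> add_line F b"
      using Fb(3,4) act_flift_closed[OF st add_line_self[OF stableD(1)[OF F(1)] bc]]
        add_line_mono[OF stableD(1)[OF F(1)] bc] stableD(2)[OF F(2) _ z(1), of "GT i"] by simp
    ultimately show ?thesis by auto
  qed
  then show ?thesis using bc by (simp add: eig_mod_def)
qed

lemma stable_T_add_lines:
  assumes F: "stable {GT i} F" and b: "b \<in> carrier L"
  shows "stable {GT i} (add_line (add_line F b) (opT i b))"
proof -
  note Fs = stableD(1)[OF F]
  note Fb = subsp_add_line[OF Fs b]
  have Tb: "opT i b \<in> carrier L" using b by simp
  note Fbb = subspD[OF subsp_add_line[OF Fb Tb]]
  note self = add_line_self[OF Fb Tb] and mono = add_line_mono[OF Fb Tb]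
  show ?thesis
  proof (rule stable_add_line[OF Fb Tb])
    fix g x assume g: "g \<in> {GT i}"
    have "opT i (opT i b) \<in> add_line (add_line F b) (opT i b)"
      unfolding T_square[OF b] using Fbb(3,4) self mono[OF add_line_self[OF Fs b]] by simp
    with g show "act (fgen g) (opT i b) \<in> add_line (add_line F b) (opT i b)" by simp
    assume "x \<in> add_line F b"
    then obtain u a where u: "x = u \<oplus> sc a b" "u \<in> F" "u \<in> carrier L"
      using subspD(1)[OF Fs] by (auto simp: add_line_def)
    have "opT i x = opT i u \<oplus> sc a (opT i b)" using u b by simp
    moreover have "opT i u \<in> add_line F b" using add_line_mono[OF Fs b] stableD(2)[OF F _ u(2)] by simp
    ultimately show "act (fgen g) x \<in> add_line (add_line F b) (opT i b)"
      using g Fbb(3,4) self mono by simp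
  qed
qed

text \<open>
  The module is spanned by \<open>x\<close>, \<open>T\<^sub>1 x\<close>, \<open>T\<^sub>2 T\<^sub>1 x\<close> and so on, along the minimal representatives of the
  cosets of \<open>s\<^sub>2\<close> in the Weyl group. The chain closes after six steps, because the braid relation turns
  \<open>T\<^sub>2\<close> applied to the last vector into \<open>T\<^sub>1 T\<^sub>2 T\<^sub>1 T\<^sub>2 T\<^sub>1 (T\<^sub>2 x)\<close>.
\<close>

theorem induced_flag:
  assumes x: "x \<in> eig s" and Tx: "opT N2 x = sc c x"
    and gen: "\<And>y. y \<in> carrier L \<Longrightarrow> \<exists>r\<in>carrier (hecke q). y = r \<odot> x"
  shows "flag (carrier L) {s, s \<circ> srefl N1, s \<circ> srefl N1 \<circ> srefl N2, s \<circ> srefl N1 \<circ> srefl N2 \<circ> srefl N1,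
    s \<circ> srefl N1 \<circ> srefl N2 \<circ> srefl N1 \<circ> srefl N2,
    s \<circ> srefl N1 \<circ> srefl N2 \<circ> srefl N1 \<circ> srefl N2 \<circ> srefl N1}"
proof -
  define b1 where "b1 = opT N1 x"
  define b2 where "b2 = opT N2 b1"
  define b3 where "b3 = opT N1 b2"
  define b4 where "b4 = opT N2 b3"
  define b5 where "b5 = opT N1 b4"
  have xc: "x \<in> carrier L" using eigD(1)[OF x] .
  have bc: "b1 \<in> carrier L" "b2 \<in> carrier L" "b3 \<in> carrier L" "b4 \<in> carrier L" "b5 \<in> carrier L"
    using xc by (simp_all add: b1_def b2_def b3_def b4_def b5_def)
  define F1 where "F1 = add_line {\<zero>} x"
  define F2 where "F2 = add_line F1 b1"
  define F3 where "F3 = add_line F2 b2"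
  define F4 where "F4 = add_line F3 b3"
  define F5 where "F5 = add_line F4 b4"
  define F6 where "F6 = add_line F5 b5"
  have st0: "stable {GT i} {\<zero>}" for i by (simp add: stable_def subsp_zero)
  have st1: "stable {GT N2} F1"
    unfolding F1_def
  proof (rule stable_add_line[OF subsp_zero xc])
    show "act (fgen g) x \<in> add_line {\<zero>} x" if "g \<in> {GT N2}" for g
      using that Tx xc by (auto simp: add_line_def)
    show "act (fgen g) y \<in> add_line {\<zero>} x" if "g \<in> {GT N2}" "y \<in> {\<zero>}" for g y
      using that add_line_mono[OF subsp_zero xc] by simp
  qed
  have st2: "stable {GT N1} F2"
    using stable_T_add_lines[OF st0 xc] by (simp add: F2_def F1_def b1_def)
  have st3: "stable {GT N2} F3"
    using stable_T_add_lines[OF st1 bc(1)] by (simp add: F3_def F2_def b2_def)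
  have st4: "stable {GT N1} F4"
    using stable_T_add_lines[OF st2 bc(2)] by (simp add: F4_def F3_def b3_def)
  have st5: "stable {GT N2} F5"
    using stable_T_add_lines[OF st3 bc(3)] by (simp add: F5_def F4_def b4_def)
  have st6: "stable {GT N1} F6"
    using stable_T_add_lines[OF st4 bc(4)] by (simp add: F6_def F5_def b5_def)
  have e0: "eig_mod {\<zero>} s x"
    using x xc by (simp add: eig_mod_def eigD)
  have f1: "flag F1 {s}"
    unfolding F1_def by (rule flag_step[OF flag_zero e0])
  have e1: "eig_mod F1 (s \<circ> srefl N1) b1"
    unfolding b1_def F1_def by (rule eig_mod_T[OF flag_stable[OF flag_zero] st0 e0])
  have f2: "flag F2 {s \<circ> srefl N1, s}"
    unfolding F2_def by (rule flag_step[OF f1 e1])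
  have e2: "eig_mod F2 (s \<circ> srefl N1 \<circ> srefl N2) b2"
    unfolding b2_def F2_def by (rule eig_mod_T[OF flag_stable[OF f1] st1 e1])
  note f3 = flag_step[OF f2 e2, folded F3_def]
  have e3: "eig_mod F3 (s \<circ> srefl N1 \<circ> srefl N2 \<circ> srefl N1) b3"
    unfolding b3_def F3_def by (rule eig_mod_T[OF flag_stable[OF f2] st2 e2])
  note f4 = flag_step[OF f3 e3, folded F4_def]
  have e4: "eig_mod F4 (s \<circ> srefl N1 \<circ> srefl N2 \<circ> srefl N1 \<circ> srefl N2) b4"
    unfolding b4_def F4_def by (rule eig_mod_T[OF flag_stable[OF f3] st3 e3])
  note f5 = flag_step[OF f4 e4, folded F5_def]
  have e5: "eig_mod F5 (s \<circ> srefl N1 \<circ> srefl N2 \<circ> srefl N1 \<circ> srefl N2 \<circ> srefl N1) b5"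
    unfolding b5_def F5_def by (rule eig_mod_T[OF flag_stable[OF f4] st4 e4])
  note f6 = flag_step[OF f5 e5, folded F6_def]
  have T2b5: "opT N2 b5 = sc c b5"
    unfolding b5_def b4_def b3_def b2_def b1_def braid[OF xc, symmetric] Tx
    using xc by simp
  have F5s: "subsp F5" using stableD(1)[OF st5] .
  have "stable {GT N2} F6"
    unfolding F6_def
  proof (rule stable_add_line[OF F5s bc(5)])
    show "act (fgen g) b5 \<in> add_line F5 b5" if "g \<in> {GT N2}" for g
      using that T2b5 subspD(4)[OF subsp_add_line[OF F5s bc(5)] add_line_self[OF F5s bc(5)]] by simp
    show "act (fgen g) y \<in> add_line F5 b5" if "g \<in> {GT N2}" "y \<in> F5" for g y
      using that add_line_mono[OF F5s bc(5)] stableD(2)[OF st5] by simp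
  qed
  have "act (fgen g) y \<in> F6" if "y \<in> F6" for g y
  proof (cases g)
    case (GT i)
    then show ?thesis
      using stableD(2)[OF st6 _ that] stableD(2)[OF \<open>stable {GT N2} F6\<close> _ that] by (cases i) auto
  next
    case (GX \<nu>)
    then show ?thesis using stableD(2)[OF flag_stable[OF f6] _ that] by simp
  qed
  then have F6: "stable UNIV F6" using stableD(1)[OF st6] by (simp add: stable_def)
  have "x \<in> F6"
    unfolding F6_def F5_def F4_def F3_def F2_def F1_def
    by (intro add_line_mono subsp_add_line add_line_self subsp_zero xc bc)
  then have "F6 = carrier L"
    using stable_smult[OF F6] gen subspD(1)[OF stableD(1)[OF F6]] by blast
  with f6 show ?thesis
    by (simp add: insert_commute)
qed

end


section \<open>Six weights\<close>

lemma torusD: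
  assumes "t \<in> torus"
  shows "t \<nu> \<noteq> 0" "t (\<nu> + \<mu>) = t \<nu> * t \<mu>" "t 0 = 1" "t (- \<nu>) = inverse (t \<nu>)"
proof -
  show nz: "t \<nu> \<noteq> 0" for \<nu> using assms by (cases \<nu>) (simp add: torus_def)
  show add: "t (\<nu> + \<mu>) = t \<nu> * t \<mu>" for \<nu> \<mu> using assms unfolding torus_def by blast
  show "t 0 = 1" using add[of 0 0] nz[of 0] by simp
  then show "t (- \<nu>) = inverse (t \<nu>)" using add[of \<nu> "- \<nu>"] nz[of \<nu>] by (simp add: inverse_unique)
qed

lemma torus_pt_torus: "z \<noteq> 0 \<Longrightarrow> w \<noteq> 0 \<Longrightarrow> torus_pt z w \<in> torus"
  by (auto simp: torus_def torus_pt_def power_int_add)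

lemma torus_pt_eq_iff: "torus_pt z w = torus_pt z' w' \<longleftrightarrow> z = z' \<and> w = w'"
proof
  assume eq: "torus_pt z w = torus_pt z' w'"
  show "z = z' \<and> w = w'"
    using fun_cong[OF eq, of "(1, 0)"] fun_cong[OF eq, of "(0, 1)"] by (simp add: torus_pt_def)
qed simp

lemma torus_pt_srefl:
  assumes "z \<noteq> 0" "w \<noteq> 0"
  shows "torus_pt z w \<circ> srefl N1 = torus_pt (inverse z) (w * z ^ 3)"
    and "torus_pt z w \<circ> srefl N2 = torus_pt (z * w) (inverse w)"
proof -
  have "z powi (3 * b - a) * w powi b = inverse z powi a * (w * z ^ 3) powi b" for a b
  proof -
    have "(z ^ 3) powi b = z powi (3 * b)"
      using power_int_mult[of z 3 b] by simp
    then show ?thesis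
      using assms by (simp add: power_int_diff power_int_mult_distrib power_int_inverse divide_inverse)
  qed
  then show "torus_pt z w \<circ> srefl N1 = torus_pt (inverse z) (w * z ^ 3)"
    by (auto simp: torus_pt_def fun_eq_iff)
  have "z powi a * w powi (a - b) = (z * w) powi a * inverse w powi b" for a b
    using assms by (simp add: power_int_diff power_int_mult_distrib power_int_inverse divide_inverse)
  then show "torus_pt z w \<circ> srefl N2 = torus_pt (z * w) (inverse w)"
    by (auto simp: torus_pt_def fun_eq_iff)
qed

text \<open>
  The orbit of \<open>wt0 p\<close>, numbered so that \<open>s\<^sub>2, s\<^sub>1, s\<^sub>2, s\<^sub>1, s\<^sub>2\<close> lead from each weight to the next one,
  while \<open>s\<^sub>1\<close> fixes both ends. Inverting \<open>p\<close> reverses the order.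
\<close>

definition wt0 where "wt0 p = torus_pt 1 p"
definition wt1 where "wt1 p = torus_pt p (inverse p)"
definition wt2 where "wt2 p = torus_pt (inverse p) (p ^ 2)"
definition wt3 where "wt3 p = torus_pt p (inverse p ^ 2)"
definition wt4 where "wt4 p = torus_pt (inverse p) p"
definition wt5 where "wt5 p = torus_pt 1 (inverse p)"

lemmas wt_defs = wt0_def wt1_def wt2_def wt3_def wt4_def wt5_def

lemma wt_inverse:
  "wt0 (inverse p) = wt5 p" "wt1 (inverse p) = wt4 p" "wt2 (inverse p) = wt3 p"
  "wt3 (inverse p) = wt2 p" "wt4 (inverse p) = wt1 p" "wt5 (inverse p) = wt0 p"
  by (simp_all add: wt_defs)

definition wt_orbit where "wt_orbit p = {wt0 p, wt1 p, wt2 p, wt3 p, wt4 p, wt5 p}"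

lemma wt_orbit_inverse: "wt_orbit (inverse p) = wt_orbit p"
  unfolding wt_orbit_def wt_inverse by blast

lemma wt_torus: "p \<noteq> 0 \<Longrightarrow> s \<in> wt_orbit p \<Longrightarrow> s \<in> torus"
  by (auto simp: wt_orbit_def wt_defs intro!: torus_pt_torus)

lemma wt_srefl:
  assumes "p \<noteq> 0"
  shows "wt0 p \<circ> srefl N1 = wt0 p" "wt0 p \<circ> srefl N2 = wt1 p" "wt1 p \<circ> srefl N1 = wt2 p"
    "wt1 p \<circ> srefl N2 = wt0 p" "wt2 p \<circ> srefl N1 = wt1 p" "wt2 p \<circ> srefl N2 = wt3 p"
    "wt3 p \<circ> srefl N1 = wt4 p" "wt3 p \<circ> srefl N2 = wt2 p" "wt4 p \<circ> srefl N1 = wt3 p"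
    "wt4 p \<circ> srefl N2 = wt5 p" "wt5 p \<circ> srefl N1 = wt5 p" "wt5 p \<circ> srefl N2 = wt4 p"
  using assms by (simp_all add: wt_defs torus_pt_srefl torus_pt_eq_iff field_simps eval_nat_numeral)

lemma wt_alpha:
  "wt0 p (alpha N2) = p" "wt1 p (alpha N1) = p" "wt1 p (alpha N2) = inverse p"
  "wt2 p (alpha N1) = inverse p" "wt2 p (alpha N2) = p ^ 2" "wt3 p (alpha N1) = p" "wt4 p (alpha N2) = p"
  by (simp_all add: wt_defs torus_pt_def)

lemma wt0_notin:
  assumes "p \<noteq> 0" "p \<noteq> 1" "p \<noteq> -1"
  shows "wt0 p \<notin> {wt1 p, wt2 p, wt3 p, wt4 p, wt5 p}"
proof -
  have "p = inverse p \<Longrightarrow> False"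
    using assms by (metis field_class.field_inverse power2_eq_1_iff power2_eq_square)
  moreover have "inverse p \<noteq> 1" using assms by (metis inverse_1 inverse_inverse_eq)
  ultimately show ?thesis using assms by (auto simp: wt_defs torus_pt_eq_iff)
qed

section \<open>Eigenvectors and intertwiners\<close>

lemma pair_sum_torus:
  assumes "t \<in> torus" "d * (1 - gX (- alpha i)) = gX \<nu> - gX (srefl i \<nu>)"
  shows "pair_sum t d * (1 - inverse (t (alpha i))) = t \<nu> - (t \<circ> srefl i) \<nu>"
proof -
  have "pair_sum (\<lambda>\<mu>. t \<mu> - t (\<mu> + - alpha i)) d = pair_sum t d * (1 - inverse (t (alpha i)))"
    by (simp only: torusD(2)[OF assms(1)] torusD(4)[OF assms(1)])
      (simp add: pair_sum_def sum_distrib_left sum_distrib_right algebra_simps)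
  then show ?thesis using pair_sum_difference[OF assms(2), of t] by simp
qed

context hecke_module
begin

lemma eig_torusI:
  assumes s: "s \<in> torus" and m: "m \<in> carrier L"
    and e: "opX (1, 0) m = sc (s (1, 0)) m" "opX (0, 1) m = sc (s (0, 1)) m"
  shows "m \<in> eig s"
proof -
  let ?E = "\<lambda>\<nu>. opX \<nu> m = sc (s \<nu>) m"
  have add: "?E (\<nu> + \<mu>)" if "?E \<nu>" "?E \<mu>" for \<nu> \<mu>
    using that m torusD(2)[OF s, of \<nu> \<mu>] by (simp add: X_add mult.commute)
  have neg: "?E (- \<nu>)" if E: "?E \<nu>" for \<nu>
  proof -
    have "m = opX (- \<nu>) (opX \<nu> m)"
      using m X_add[OF m, of "- \<nu>" \<nu>] by (simp add: X_0)
    also have "\<dots> = sc (s \<nu>) (opX (- \<nu>) m)" using E m by simp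
    finally have "sc (inverse (s \<nu>)) m = sc (inverse (s \<nu>)) (sc (s \<nu>) (opX (- \<nu>) m))" by simp
    then show ?thesis using m torusD(1)[OF s, of \<nu>] torusD(4)[OF s, of \<nu>] by simp
  qed
  have zero: "?E 0" using m torusD(3)[OF s] by (simp add: X_0)
  have nat1: "?E (int n, 0)" for n
  proof (induction n)
    case (Suc n)
    then show ?case using add[OF e(1) Suc] by simp
  qed (use zero in \<open>simp add: zero_prod_def\<close>)
  have nat2: "?E (0, int n)" for n
  proof (induction n)
    case (Suc n)
    then show ?case using add[OF e(2) Suc] by simp
  qed (use zero in \<open>simp add: zero_prod_def\<close>)
  have int1: "?E (a, 0)" for a
    using nat1[of "nat a"] neg[OF nat1[of "nat (- a)"]] by (cases "a \<ge> 0") simp_all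
  have int2: "?E (0, a)" for a
    using nat2[of "nat a"] neg[OF nat2[of "nat (- a)"]] by (cases "a \<ge> 0") simp_all
  have "?E \<nu>" for \<nu>
    using add[OF int1[of "fst \<nu>"] int2[of "snd \<nu>"]] by simp
  then show ?thesis using m by (simp add: eig_def)
qed

lemma gen_weight_space_act:
  "gen_weight_space q L s = {m \<in> carrier L. \<forall>\<nu>. \<exists>k>0. act ((fX \<nu> - fscal (s \<nu>)) ^ k) m = \<zero>}"
proof -
  have "hX q \<nu> \<ominus>\<^bsub>hecke q\<^esub> hscal q c = hclass q (fX \<nu> - fscal c)" for \<nu> c
    by (simp add: hX_def hscal_def a_minus_def hclass_add[symmetric] hclass_uminus[symmetric])
  moreover have "hclass q f [^]\<^bsub>hecke q\<^esub> (k::nat) = hclass q (f ^ k)" for f k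
    by (induction k) (simp_all add: hclass_1[symmetric] hclass_mult[symmetric] power_Suc2 del: power_Suc)
  ultimately show ?thesis
    by (simp add: gen_weight_space_def act_def)
qed

lemma power_kernel_vector:
  assumes "act (f ^ k) m = \<zero>" "m \<in> carrier L" "m \<noteq> \<zero>"
  obtains j where "act (f ^ j) m \<noteq> \<zero>" "act f (act (f ^ j) m) = \<zero>"
proof -
  have "\<exists>j<k. (\<forall>i\<le>j. act (f ^ i) m \<noteq> \<zero>) \<and> act (f ^ Suc j) m = \<zero>"
    by (rule ex_least_nat_less) (use assms in auto)
  then show thesis
    using that assms(2) act_mult[of m f] by auto
qed

text \<open>
  The operators \<open>X\<^sup>\<nu> - s(\<nu>)\<close> for the two basis vectors \<open>\<nu>\<close> of the lattice commute and are nilpotent on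
  \<open>m\<close>, so suitable powers of them lead from \<open>m\<close> to a common nonzero kernel vector.
\<close>

lemma gen_weight_space_eig:
  assumes s: "s \<in> torus" and m: "m \<in> gen_weight_space q L s" "m \<noteq> \<zero>"
  shows "\<exists>m\<in>eig s. m \<noteq> \<zero>"
proof -
  let ?f = "fX (1, 0) - fscal (s (1, 0))" and ?g = "fX (0, 1) - fscal (s (0, 1))"
  have mc: "m \<in> carrier L" using m by (simp add: gen_weight_space_act)
  obtain k l where kl: "act (?f ^ k) m = \<zero>" "act (?g ^ l) m = \<zero>"
    using m(1) unfolding gen_weight_space_act by blast
  obtain j where j: "act (?f ^ j) m \<noteq> \<zero>" "act ?f (act (?f ^ j) m) = \<zero>"
    by (rule power_kernel_vector[OF kl(1) mc m(2)])
  define n where "n = act (?f ^ j) m"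
  have nc: "n \<in> carrier L" using mc by (simp add: n_def)
  have act_diff: "act (f - h) x = act f x \<oplus> \<ominus> act h x" if "x \<in> carrier L" for f h x
    using act_add_left[OF that, of f "- h"] act_uminus_left[OF that, of h] by simp
  have eigI: "opX \<nu> x = sc c x" if "act (fX \<nu> - fscal c) x = \<zero>" "x \<in> carrier L" for \<nu> c x
    using that act_diff[of x "fX \<nu>" "fscal c"] M.minus_eq_zero_iff[of "opX \<nu> x" "sc c x"]
    by (simp add: a_minus_def)
  have eigD': "act (fX \<nu> - fscal c) x = \<zero>" if "opX \<nu> x = sc c x" "x \<in> carrier L" for \<nu> c x
    using that act_diff[of x "fX \<nu>" "fscal c"] by (simp add: M.r_neg)
  have comm: "act ?f (act ?g x) = act ?g (act ?f x)" if "x \<in> carrier L" for x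
  proof -
    have "hclass q (fX (1, 0) * fX (0, 1)) = hclass q (fX (0, 1) * fX (1, 0))"
      by (simp add: hclass_X_add)
    moreover have expand: "(f - fscal a) * (h - fscal b) = f * h + (fscal (a * b) - fscal a * h - fscal b * f)"
      for f h a b
      by (simp add: left_diff_distrib right_diff_distrib fscal_commute[of f b] fscal_mult)
    moreover have "fscal (b * a) - fscal b * f - fscal a * h = fscal (a * b) - fscal a * h - fscal b * f"
      for f h a b
      by (simp add: mult.commute)
    ultimately have "hclass q (?f * ?g) = hclass q (?g * ?f)"
      by (metis hclass_add)
    then show ?thesis using that act_cong[of "?f * ?g" "?g * ?f" x] by (simp add: act_mult)
  qed
  have commk: "act (?f ^ a) (act ?g x) = act ?g (act (?f ^ a) x)" if "x \<in> carrier L" for a x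
    by (induction a) (use that comm in \<open>simp_all add: act_mult\<close>)
  have commkl: "act (?f ^ a) (act (?g ^ b) x) = act (?g ^ b) (act (?f ^ a) x)" if "x \<in> carrier L" for a b x
    by (induction b) (use that commk in \<open>simp_all add: act_mult\<close>)
  have "act (?g ^ l) n = \<zero>"
    unfolding n_def commkl[OF mc, symmetric] kl by simp
  then obtain i where i: "act (?g ^ i) n \<noteq> \<zero>" "act ?g (act (?g ^ i) n) = \<zero>"
    by (rule power_kernel_vector[OF _ nc]) (use j n_def in auto)
  have "act ?f (act (?g ^ i) n) = \<zero>"
    using commkl[OF nc, of 1 i] j by (simp add: n_def)
  then have "act (?g ^ i) n \<in> eig s"
    using i nc by (intro eig_torusI[OF s] eigI) auto
  then show ?thesis using i by blast
qed

lemma eig_weight: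
  assumes s: "s \<in> torus" and m: "m \<in> eig s" "m \<noteq> \<zero>"
  shows "s \<in> weights q L"
proof -
  have mc: "m \<in> carrier L" using eigD(1)[OF m(1)] .
  have "act ((fX \<nu> - fscal (s \<nu>)) ^ 1) m = \<zero>" for \<nu>
    using act_add_left[OF mc, of "fX \<nu>" "- fscal (s \<nu>)"] act_uminus_left[OF mc, of "fscal (s \<nu>)"]
      eigD(2)[OF m(1), of \<nu>] mc by (simp add: M.r_neg)
  then have "m \<in> gen_weight_space q L s"
    unfolding gen_weight_space_act using mc by (blast intro: zero_less_one)
  then show ?thesis using s m by (auto simp: weights_def)
qed

lemma weight_eig:
  assumes "s \<in> weights q L"
  shows "s \<in> torus" "\<exists>m\<in>eig s. m \<noteq> \<zero>"
proof -
  show s: "s \<in> torus" using assms by (simp add: weights_def)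
  have "\<zero> \<in> gen_weight_space q L s"
    unfolding gen_weight_space_act by auto
  then obtain m where "m \<in> gen_weight_space q L s" "m \<noteq> \<zero>"
    using assms by (auto simp: weights_def)
  then show "\<exists>m\<in>eig s. m \<noteq> \<zero>" using gen_weight_space_eig[OF s] by blast
qed

text \<open>
  The intertwining operator at weight \<open>s\<close>, where \<open>c\<close> is \<open>(q - q\<^sup>-\<^sup>1) / (1 - s(-\<alpha>\<^sub>i))\<close>.
\<close>

definition tau :: "node \<Rightarrow> complex \<Rightarrow> 'a \<Rightarrow> 'a" where
  "tau i c m = opT i m \<oplus> sc (- c) m"

lemma tau_closed [simp]: "m \<in> carrier L \<Longrightarrow> tau i c m \<in> carrier L"
  by (simp add: tau_def)

lemma T_eq_tau:
  assumes m: "m \<in> carrier L"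
  shows "opT i m = sc c m \<oplus> tau i c m"
proof -
  have "sc c m \<oplus> tau i c m = opT i m \<oplus> (sc c m \<oplus> sc (- c) m)"
    using m by (simp add: tau_def M.add.m_ac)
  then show ?thesis using m sc_add[OF m, of c "- c"] by simp
qed

lemma tau_eq_0: "m \<in> carrier L \<Longrightarrow> tau i c m = \<zero> \<Longrightarrow> opT i m = sc c m"
  using T_eq_tau[of m i c] by simp

lemma tau_eig:
  assumes s: "s \<in> torus" and m: "m \<in> eig s"
    and ne: "s (alpha i) \<noteq> 1" and c: "c * (1 - inverse (s (alpha i))) = q - inverse q"
  shows "tau i c m \<in> eig (s \<circ> srefl i)"
proof -
  note mc = eigD(1)[OF m]
  have "opX \<nu> (tau i c m) = sc (s (srefl i \<nu>)) (tau i c m)" for \<nu>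
  proof -
    obtain d where d: "d * (1 - gX (- alpha i)) = gX \<nu> - gX (srefl i \<nu>)"
      using demazure_quotient_exists by blast
    let ?P = "pair_sum s d" and ?b = "1 - inverse (s (alpha i))"
    have b: "?b \<noteq> 0" using ne by (metis inverse_1 inverse_inverse_eq right_minus_eq)
    have P: "?P * ?b = s \<nu> - s (srefl i \<nu>)"
      using pair_sum_torus[OF s d] by simp
    have "((q - inverse q) * ?P - c * s \<nu>) * ?b = - c * s (srefl i \<nu>) * ?b"
    proof -
      have "((q - inverse q) * ?P - c * s \<nu>) * ?b = (c * ?b) * (?P * ?b) - c * s \<nu> * ?b"
        unfolding c[symmetric] by (simp add: algebra_simps)
      then show ?thesis unfolding P by (simp add: algebra_simps)
    qed
    then have coef: "(q - inverse q) * ?P - c * s \<nu> = - c * s (srefl i \<nu>)"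
      by (rule mult_right_cancel[OF b, THEN iffD1])
    have "opX \<nu> (tau i c m) = opT i (sc (s (srefl i \<nu>)) m) \<oplus> sc (q - inverse q) (sc ?P m)
        \<oplus> sc (- c * s \<nu>) m"
      using mc eigD(2)[OF m] by (simp add: tau_def bernstein[OF mc d] act_flift_eig[OF m])
    also have "\<dots> = sc (s (srefl i \<nu>)) (opT i m) \<oplus> sc ((q - inverse q) * ?P - c * s \<nu>) m"
      using mc sc_add[OF mc, of "(q - inverse q) * ?P" "- c * s \<nu>"] by (simp add: M.add.m_assoc)
    also have "\<dots> = sc (s (srefl i \<nu>)) (tau i c m)"
      unfolding coef using mc by (simp add: tau_def mult.commute)
    finally show ?thesis .
  qed
  then show ?thesis using mc by (simp add: eig_def)
qed

text \<open>
  The last coefficient vanishes precisely for \<open>c = q\<close> and \<open>c = - q\<^sup>-\<^sup>1\<close>; these are the values of \<open>c\<close>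
  at a weight \<open>s\<close> with \<open>s(\<alpha>\<^sub>i) = q\<^sup>2\<close> and \<open>s(\<alpha>\<^sub>i) = q\<^sup>-\<^sup>2\<close>, where the intertwiner is not invertible.
\<close>

lemma T_tau:
  assumes m: "m \<in> carrier L"
  shows "opT i (tau i c m) = sc (q - inverse q - c) (tau i c m) \<oplus> sc (1 + c * (q - inverse q - c)) m"
proof -
  let ?Q = "q - inverse q"
  have "opT i (tau i c m) = sc ?Q (opT i m) \<oplus> m \<oplus> sc (- c) (opT i m)"
    using m by (simp add: tau_def T_square)
  also have "\<dots> = sc (?Q - c) (opT i m) \<oplus> m"
    using m sc_add[of "opT i m" ?Q "- c"] by (simp add: M.add.m_ac)
  finally have T: "opT i (tau i c m) = sc (?Q - c) (opT i m) \<oplus> m" .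
  have "sc ((?Q - c) * - c) m \<oplus> sc (1 + c * (?Q - c)) m = m"
    using m sc_add[of m "(?Q - c) * - c" "1 + c * (?Q - c)"] by (simp add: algebra_simps)
  moreover have "sc (?Q - c) (tau i c m) = sc (?Q - c) (opT i m) \<oplus> sc ((?Q - c) * - c) m"
    using m by (simp add: tau_def)
  ultimately show ?thesis using m T by (simp add: M.add.m_assoc)
qed

end


section \<open>The Weyl group orbit\<close>

lemma srefl_involution: "srefl i \<circ> srefl i = id"
  by (cases i) (auto simp: fun_eq_iff)

lemma bij_srefl: "bij (srefl i)"
  using o_bij[OF srefl_involution srefl_involution] .

lemma inv_srefl: "inv_into UNIV (srefl i) = srefl i"
  using inv_unique_comp[OF srefl_involution srefl_involution] .

lemma weyl_act_srefl: "weyl_act (srefl i) t = t \<circ> srefl i"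
  by (simp add: weyl_act_def[abs_def] inv_srefl comp_def)

lemma weyl_act_comp:
  assumes "bij g" "bij h"
  shows "weyl_act (g \<circ> h) t = weyl_act g (weyl_act h t)"
  using o_inv_distrib[OF assms] by (simp add: weyl_act_def[abs_def])

lemma BijGroup_UNIV:
  "carrier (BijGroup (UNIV :: wt set)) = {f. bij f}" "\<one>\<^bsub>BijGroup (UNIV :: wt set)\<^esub> = id"
  "g \<in> {f. bij f} \<Longrightarrow> h \<in> {f. bij f} \<Longrightarrow> g \<otimes>\<^bsub>BijGroup (UNIV :: wt set)\<^esub> h = g \<circ> h"
  by (auto simp: BijGroup_def Bij_def compose_def fun_eq_iff)

lemma weyl_group_srefl:
  assumes "w \<in> weyl_group"
  shows "bij w" and "srefl i \<circ> w \<in> weyl_group"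
proof -
  have gens: "{srefl N1, srefl N2} \<subseteq> carrier (BijGroup UNIV)"
    using bij_srefl by (auto simp: BijGroup_UNIV)
  show bw: "bij w"
    using group.generate_incl[OF group_BijGroup gens] assms
    unfolding weyl_group_def BijGroup_UNIV by blast
  have "srefl i \<in> generate (BijGroup UNIV) {srefl N1, srefl N2}"
    by (cases i) (auto intro: generate.incl)
  then show "srefl i \<circ> w \<in> weyl_group"
    using generate.eng[of "srefl i" "BijGroup UNIV" "{srefl N1, srefl N2}" w] assms bw bij_srefl
    unfolding weyl_group_def by (simp add: BijGroup_UNIV)
qed

lemma wt_orbit_srefl: "p \<noteq> 0 \<Longrightarrow> t \<in> wt_orbit p \<Longrightarrow> t \<circ> srefl i \<in> wt_orbit p"
  unfolding wt_orbit_def by (cases i) (auto simp: wt_srefl)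

lemma weyl_orbit:
  assumes p: "p \<noteq> 0"
  shows "(\<lambda>w. weyl_act w (torus_pt 1 p)) ` weyl_group = wt_orbit p"
proof
  have inv_gen: "inv\<^bsub>BijGroup (UNIV :: wt set)\<^esub> srefl i = srefl i" for i
    using inv_BijGroup[of "srefl i" UNIV] bij_srefl[of i] inv_srefl[of i]
    by (simp add: Bij_def restrict_def)
  have "bij w \<and> (\<forall>t\<in>wt_orbit p. weyl_act w t \<in> wt_orbit p)"
    if "w \<in> generate (BijGroup UNIV) {srefl N1, srefl N2}" for w
    using that
  proof (induction rule: generate.induct)
    case one
    then show ?case by (simp add: BijGroup_UNIV weyl_act_def[abs_def] bij_id[unfolded id_def])
  next
    case (incl h)
    then obtain i where "h = srefl i" by blast
    then show ?case using wt_orbit_srefl[OF p, of _ i] bij_srefl[of i] by (simp only: weyl_act_srefl) blast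
  next
    case (inv h)
    then obtain i where "h = srefl i" by blast
    then show ?case
      using wt_orbit_srefl[OF p, of _ i] bij_srefl[of i] by (simp only: weyl_act_srefl inv_gen) blast
  next
    case (eng h1 h2)
    then have h: "bij h1" "bij h2" by blast+
    then have mult: "h1 \<otimes>\<^bsub>BijGroup UNIV\<^esub> h2 = h1 \<circ> h2" by (simp only: BijGroup_UNIV mem_Collect_eq)
    show ?case
      unfolding mult weyl_act_comp[OF h] using bij_comp[OF h(2,1)] eng.IH by blast
  qed
  moreover have "torus_pt 1 p \<in> wt_orbit p" by (simp add: wt_orbit_def wt0_def)
  ultimately show "(\<lambda>w. weyl_act w (torus_pt 1 p)) ` weyl_group \<subseteq> wt_orbit p"
    unfolding weyl_group_def by blast
next
  let ?O = "(\<lambda>w. weyl_act w (torus_pt 1 p)) ` weyl_group"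
  have step: "t \<circ> srefl i \<in> ?O" if t: "t \<in> ?O" for t i
  proof -
    obtain w where w: "w \<in> weyl_group" "t = weyl_act w (torus_pt 1 p)" using t by blast
    have "t \<circ> srefl i = weyl_act (srefl i \<circ> w) (torus_pt 1 p)"
      unfolding w(2) weyl_act_comp[OF bij_srefl weyl_group_srefl(1)[OF w(1)]] weyl_act_srefl ..
    then show ?thesis using weyl_group_srefl(2)[OF w(1)] by blast
  qed
  have "id \<in> weyl_group"
    using generate.one[of "BijGroup UNIV" "{srefl N1, srefl N2}"] by (simp add: weyl_group_def BijGroup_UNIV)
  moreover have "weyl_act id (torus_pt 1 p) = wt0 p" by (simp add: weyl_act_def[abs_def] wt0_def)
  ultimately have 0: "wt0 p \<in> ?O" by (metis imageI)
  have 1: "wt1 p \<in> ?O" using step[OF 0, of N2] by (simp add: wt_srefl p)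
  have 2: "wt2 p \<in> ?O" using step[OF 1, of N1] by (simp add: wt_srefl p)
  have 3: "wt3 p \<in> ?O" using step[OF 2, of N2] by (simp add: wt_srefl p)
  have 4: "wt4 p \<in> ?O" using step[OF 3, of N1] by (simp add: wt_srefl p)
  have 5: "wt5 p \<in> ?O" using step[OF 4, of N2] by (simp add: wt_srefl p)
  show "wt_orbit p \<subseteq> ?O" unfolding wt_orbit_def using 0 1 2 3 4 5 by blast
qed

lemma weyl_act_longest: "weyl_act w0 (torus_pt 1 p) = torus_pt 1 (inverse p)"
proof -
  have w0: "w0 \<nu> = - \<nu>" for \<nu> by (cases \<nu>) (simp add: w0_def)
  then have "w0 \<circ> w0 = id" by (simp add: fun_eq_iff)
  then have "inv_into UNIV w0 = w0" by (intro inv_unique_comp)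
  then show ?thesis
    by (auto simp: weyl_act_def[abs_def] w0 torus_pt_def power_int_minus power_int_inverse fun_eq_iff)
qed

section \<open>Replacing the parameter by its negative inverse\<close>

text \<open>
  The relations depend on \<open>q\<close> only through \<open>q - q\<^sup>-\<^sup>1\<close>. Hence the module induced from the other end of
  the orbit is the module induced from \<open>wt0\<close> for the parameter \<open>- q\<^sup>-\<^sup>1\<close>, and each statement about
  one of them is a statement about both.
\<close>

lemma hecke_parameter:
  "hecke (- inverse q) = hecke q" "hclass (- inverse q) = hclass q" "hscal (- inverse q) = hscal q"
  "hT (- inverse q) = hT q" "hX (- inverse q) = hX q" "parabolic (- inverse q) = parabolic q"
proof -
  have "hecke_relations (- inverse q) = hecke_relations q"
    by (simp add: hecke_relations_def)
  then have "hecke_ideal (- inverse q) = hecke_ideal q" by (simp add: hecke_ideal_def)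
  then show h: "hecke (- inverse q) = hecke q" "hclass (- inverse q) = hclass q"
    by (simp_all add: hecke_def hclass_def[abs_def])
  then show "hscal (- inverse q) = hscal q" "hT (- inverse q) = hT q" "hX (- inverse q) = hX q"
    by (simp_all add: hscal_def[abs_def] hT_def[abs_def] hX_def[abs_def])
  with h show "parabolic (- inverse q) = parabolic q"
    by (simp add: parabolic_def[abs_def])
qed

lemma parameter_conditions:
  fixes q :: complex
  assumes q: "q \<noteq> 0" "q\<^sup>2 \<noteq> 1" "q\<^sup>2 \<noteq> -1"
  shows "- inverse q \<noteq> 0" "(- inverse q)\<^sup>2 \<noteq> 1" "(- inverse q)\<^sup>2 \<noteq> -1"
proof -
  have sq: "(- inverse q)\<^sup>2 = inverse (q\<^sup>2)" by (simp add: power_inverse)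
  have "inverse x \<noteq> 1" if "x \<noteq> 1" for x :: complex
    using that by (metis inverse_1 inverse_inverse_eq)
  moreover have "inverse x \<noteq> -1" if "x \<noteq> -1" for x :: complex
    using that by (metis inverse_1 inverse_inverse_eq inverse_minus_eq)
  ultimately show "- inverse q \<noteq> 0" "(- inverse q)\<^sup>2 \<noteq> 1" "(- inverse q)\<^sup>2 \<noteq> -1"
    using q unfolding sq by simp_all
qed

section \<open>Irreducible modules with the given central character\<close>

text \<open>
  A \<open>mixed_line\<close> is a one-dimensional submodule on which \<open>T\<^sub>1\<close> and \<open>T\<^sub>2\<close> have different eigenvalues. A
  \<open>middle_vector\<close> \<open>m\<close> and its image \<open>\<tau>\<^sub>2 m\<close> span a submodule with weights \<open>wt2\<close> and \<open>wt3\<close>; the image may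
  be zero, which covers the case in which \<open>r\<^sup>2\<close> is a primitive third root of unity. The number
  \<open>middle_const r\<close> is the constant \<open>c\<close> of the intertwiner \<open>\<tau>\<^sub>2\<close> at \<open>wt2\<close>.
\<close>

context hecke_module
begin

definition mixed_line :: "complex \<Rightarrow> 'a \<Rightarrow> bool" where
  "mixed_line r m \<longleftrightarrow> m \<noteq> \<zero> \<and> m \<in> eig (wt4 (r ^ 2)) \<and> opT N1 m = sc (- inverse r) m \<and> opT N2 m = sc r m"

definition middle_const :: "complex \<Rightarrow> complex" where
  "middle_const r = r ^ 3 / (r ^ 2 + 1)"

definition middle_vector :: "complex \<Rightarrow> 'a \<Rightarrow> bool" where
  "middle_vector r m \<longleftrightarrow> m \<noteq> \<zero> \<and> m \<in> carrier L \<and> opT N1 m = sc (- inverse r) m \<and> m \<in> eig (wt2 (r ^ 2)) \<and>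
    tau N2 (middle_const r) m \<in> eig (wt3 (r ^ 2)) \<and>
    opT N1 (tau N2 (middle_const r) m) = sc r (tau N2 (middle_const r) m)"

text \<open>
  Without the weights at the two ends of the orbit, the intertwiners walk from \<open>wt1\<close> to \<open>wt4\<close> and
  must stop. Between \<open>wt1\<close> and \<open>wt2\<close>, and between \<open>wt3\<close> and \<open>wt4\<close>, the square of the intertwiner is
  zero, so a nonzero image is killed on the way back; at \<open>wt1\<close> and \<open>wt4\<close> the step to the missing end
  is zero as well. This leaves a vector that spans a line, or a vector of weight \<open>wt2\<close> whose image in
  weight \<open>wt3\<close> goes no further.
\<close>

lemma inner_weight_vector:
  assumes q: "q \<noteq> 0" "q\<^sup>2 \<noteq> 1" "q\<^sup>2 \<noteq> -1"
    and no0: "\<And>m. m \<in> eig (wt0 (q\<^sup>2)) \<Longrightarrow> m = \<zero>"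
    and no5: "\<And>m. m \<in> eig (wt5 (q\<^sup>2)) \<Longrightarrow> m = \<zero>"
    and m: "m \<in> eig (wt1 (q\<^sup>2)) \<or> m \<in> eig (wt2 (q\<^sup>2))" "m \<noteq> \<zero>"
  shows "(\<exists>m. mixed_line q m) \<or> (\<exists>m. mixed_line (- inverse q) m) \<or> (\<exists>m. middle_vector q m)"
proof -
  let ?p = "q\<^sup>2"
  have p0: "?p \<noteq> 0" using q by simp
  have tor: "wt1 ?p \<in> torus" "wt2 ?p \<in> torus" "wt3 ?p \<in> torus" "wt4 ?p \<in> torus"
    using wt_torus[OF p0] by (simp_all add: wt_orbit_def)
  have ip: "inverse ?p \<noteq> 1" using q by (metis inverse_1 inverse_inverse_eq)
  have cp: "q * (1 - inverse ?p) = q - inverse q"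
    using q by (simp add: field_simps power2_eq_square)
  have cm: "(- inverse q) * (1 - inverse (inverse ?p)) = q - inverse q"
    using q by (simp add: field_simps power2_eq_square)
  have q1: "?p + 1 \<noteq> 0" using q(3) by (metis add_eq_0_iff2)
  have p2: "?p ^ 2 \<noteq> 1" using q unfolding power2_eq_1_iff[of ?p] by blast
  have ca: "middle_const q * (1 - inverse (?p ^ 2)) = q - inverse q"
  proof -
    have "1 - inverse (?p ^ 2) = (?p + 1) * (?p - 1) / ?p ^ 2"
      using p0 by (simp add: field_simps power2_eq_square)
    then have "middle_const q * (1 - inverse (?p ^ 2)) = q ^ 3 * (?p - 1) / ?p ^ 2"
      using q1 by (simp add: middle_const_def)
    also have "\<dots> = q - inverse q"
      using q(1) by (simp add: field_simps eval_nat_numeral)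
    finally show ?thesis .
  qed
  have p_sq: "(- inverse q)\<^sup>2 = inverse ?p" by (simp add: power_inverse)
  have T1: "opT N2 n = sc (- inverse q) n" if n: "n \<in> eig (wt1 ?p)" for n
  proof -
    have "tau N2 (- inverse q) n \<in> eig (wt1 ?p \<circ> srefl N2)"
      by (rule tau_eig[OF tor(1) n]) (use ip cm in \<open>simp_all add: wt_alpha del: alpha.simps\<close>)
    then have "tau N2 (- inverse q) n = \<zero>" unfolding wt_srefl[OF p0] by (rule no0)
    then show ?thesis using tau_eq_0 eigD(1)[OF n] by blast
  qed
  have mixed: "mixed_line (- inverse q) n" if "n \<in> eig (wt1 ?p)" "n \<noteq> \<zero>" "opT N1 n = sc q n" for n
    using that T1 unfolding mixed_line_def p_sq by (simp add: wt_inverse)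
  have case2: ?thesis if m: "m \<in> eig (wt2 ?p)" "m \<noteq> \<zero>" for m
  proof -
    note mc = eigD(1)[OF m(1)]
    let ?n = "tau N1 (- inverse q) m"
    have n: "?n \<in> eig (wt1 ?p)"
      using tau_eig[OF tor(2) m(1), of N1 "- inverse q"] ip cm by (simp add: wt_alpha wt_srefl[OF p0] del: alpha.simps)
    show ?thesis
    proof (cases "?n = \<zero>")
      case False
      have "opT N1 ?n = sc q ?n"
        using T_tau[OF mc, of N1 "- inverse q"] q mc by simp
      then show ?thesis using mixed[OF n False] by blast
    next
      case True
      then have Tm: "opT N1 m = sc (- inverse q) m" using tau_eq_0 mc by blast
      let ?n = "tau N2 (middle_const q) m"
      have n: "?n \<in> eig (wt3 ?p)"
        using tau_eig[OF tor(2) m(1), of N2 "middle_const q"] p2 ca by (simp add: wt_alpha wt_srefl[OF p0] del: alpha.simps)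
      let ?k = "tau N1 q ?n"
      have nc: "?n \<in> carrier L" using mc by simp
      have k: "?k \<in> eig (wt4 ?p)"
        using tau_eig[OF tor(3) n, of N1 q] q cp by (simp add: wt_alpha wt_srefl[OF p0] del: alpha.simps)
      show ?thesis
      proof (cases "?k = \<zero>")
        case True
        then have "opT N1 ?n = sc q ?n" using tau_eq_0[OF nc] by blast
        then have "middle_vector q m"
          using m mc n Tm unfolding middle_vector_def by blast
        then show ?thesis by blast
      next
        case False
        have kc: "?k \<in> carrier L" using nc by simp
        have T1k: "opT N1 ?k = sc (- inverse q) ?k"
          using T_tau[OF nc, of N1 q] q nc by simp
        have "tau N2 q ?k \<in> eig (wt5 ?p)"
          using tau_eig[OF tor(4) k, of N2 q] q cp by (simp add: wt_alpha wt_srefl[OF p0] del: alpha.simps)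
        then have "opT N2 ?k = sc q ?k" using no5 tau_eq_0[OF kc] by blast
        then have "mixed_line q ?k" unfolding mixed_line_def using k T1k False by blast
        then show ?thesis by blast
      qed
    qed
  qed
  show ?thesis
  proof (cases "m \<in> eig (wt2 ?p)")
    case True
    then show ?thesis using case2 m(2) by blast
  next
    case False
    then have m1: "m \<in> eig (wt1 ?p)" using m by blast
    have n: "tau N1 q m \<in> eig (wt2 ?p)"
      using tau_eig[OF tor(1) m1, of N1 q] q cp by (simp add: wt_alpha wt_srefl[OF p0] del: alpha.simps)
    show ?thesis
    proof (cases "tau N1 q m = \<zero>")
      case True
      then show ?thesis using mixed[OF m1 m(2)] tau_eq_0 eigD(1)[OF m1] by blast
    next
      case False
      then show ?thesis using case2[OF n] by blast
    qed
  qed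
qed

lemma parameter_invariance:
  "hecke_module (- inverse q) L" "hecke_module.eig (- inverse q) L = eig"
  "hecke_module.mixed_line (- inverse q) L = mixed_line"
  "hecke_module.middle_vector (- inverse q) L = middle_vector"
proof -
  let ?q = "- inverse q"
  show "hecke_module ?q L"
    using left_module_axioms by (simp add: hecke_module_def hecke_parameter)
  then interpret D: hecke_module ?q L .
  have act: "D.act = act"
    by (simp add: D.act_def[abs_def] act_def[abs_def] hecke_parameter)
  show "D.eig = eig" "D.mixed_line = mixed_line" "D.middle_vector = middle_vector"
    by (simp_all add: D.eig_def[abs_def] eig_def[abs_def] D.mixed_line_def[abs_def] mixed_line_def[abs_def]
        D.middle_vector_def[abs_def] middle_vector_def[abs_def] D.tau_def[abs_def] tau_def[abs_def] act
        D.middle_const_def[abs_def] middle_const_def[abs_def])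
qed

text \<open>
  Passing to \<open>- q\<^sup>-\<^sup>1\<close> reverses the orbit, so the weights \<open>wt3\<close>, \<open>wt4\<close> and \<open>wt5\<close> are reduced to
  \<open>wt2\<close>, \<open>wt1\<close> and \<open>wt0\<close>.
\<close>

theorem orbit_classification:
  assumes q: "q \<noteq> 0" "q\<^sup>2 \<noteq> 1" "q\<^sup>2 \<noteq> -1"
    and s: "s \<in> wt_orbit (q\<^sup>2)" and m: "m \<in> eig s" "m \<noteq> \<zero>"
  shows "\<exists>r\<in>{q, - inverse q}. (\<exists>m\<in>eig (wt0 (r\<^sup>2)). m \<noteq> \<zero>) \<or> (\<exists>m. mixed_line r m) \<or> (\<exists>m. middle_vector r m)"
proof -
  let ?q = "- inverse q"
  have sq: "?q\<^sup>2 = inverse (q\<^sup>2)" by (simp add: power_inverse)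
  interpret D: hecke_module ?q L by (rule parameter_invariance(1))
  note same = parameter_invariance(2-4)
  have q': "?q \<noteq> 0" "?q\<^sup>2 \<noteq> 1" "?q\<^sup>2 \<noteq> -1"
    by (rule parameter_conditions[OF q])+
  show ?thesis
  proof (cases "(\<exists>m\<in>eig (wt0 (q\<^sup>2)). m \<noteq> \<zero>) \<or> (\<exists>m\<in>eig (wt5 (q\<^sup>2)). m \<noteq> \<zero>)")
    case True
    then have "(\<exists>m\<in>eig (wt0 (q\<^sup>2)). m \<noteq> \<zero>) \<or> (\<exists>m\<in>eig (wt0 (?q\<^sup>2)). m \<noteq> \<zero>)"
      unfolding sq wt_inverse .
    then show ?thesis by blast
  next
    case False
    then have no: "\<And>m. m \<in> eig (wt0 (q\<^sup>2)) \<Longrightarrow> m = \<zero>" "\<And>m. m \<in> eig (wt5 (q\<^sup>2)) \<Longrightarrow> m = \<zero>" by blast+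
    have "s = wt1 (q\<^sup>2) \<or> s = wt2 (q\<^sup>2) \<or> s = wt3 (q\<^sup>2) \<or> s = wt4 (q\<^sup>2)"
      using s m no unfolding wt_orbit_def by blast
    then consider "m \<in> eig (wt1 (q\<^sup>2)) \<or> m \<in> eig (wt2 (q\<^sup>2))"
      | "m \<in> eig (wt1 (?q\<^sup>2)) \<or> m \<in> eig (wt2 (?q\<^sup>2))"
      unfolding sq wt_inverse using m by blast
    then show ?thesis
    proof cases
      case 1
      then show ?thesis using inner_weight_vector[OF q no _ m(2)] by blast
    next
      case 2
      have no': "\<And>k. k \<in> eig (wt0 (?q\<^sup>2)) \<Longrightarrow> k = \<zero>" "\<And>k. k \<in> eig (wt5 (?q\<^sup>2)) \<Longrightarrow> k = \<zero>"
        unfolding sq wt_inverse using no by blast+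
      have "(\<exists>m. mixed_line ?q m) \<or> (\<exists>m. mixed_line (- inverse ?q) m) \<or> (\<exists>m. middle_vector ?q m)"
        by (rule D.inner_weight_vector[OF q', unfolded same, OF no' 2 m(2)])
      then show ?thesis by auto
    qed
  qed
qed

text \<open>
  Otherwise \<open>\<tau>\<^sub>2 m\<close> is an eigenvector of weight \<open>wt1\<close> that generates the module. The flag that starts
  there never returns to \<open>wt0\<close>, although \<open>m\<close> has that weight.
\<close>

lemma wt0_eig_T2:
  assumes q: "q \<noteq> 0" "q\<^sup>2 \<noteq> 1" "q\<^sup>2 \<noteq> -1"
    and irr: "irreducible_module (hecke q) L" and m: "m \<in> eig (wt0 (q\<^sup>2))" "m \<noteq> \<zero>"
  shows "opT N2 m = sc q m"
proof (rule ccontr)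
  assume ne: "opT N2 m \<noteq> sc q m"
  let ?p = "q\<^sup>2"
  have p0: "?p \<noteq> 0" using q by simp
  note mc = eigD(1)[OF m(1)]
  have cp: "q * (1 - inverse ?p) = q - inverse q"
    using q by (simp add: field_simps power2_eq_square)
  let ?n = "tau N2 q m"
  have n0: "?n \<noteq> \<zero>" using ne tau_eq_0[OF mc] by blast
  have n: "?n \<in> eig (wt1 ?p)"
    using tau_eig[OF wt_torus[OF p0] m(1), of N2 q] q cp by (simp add: wt_alpha wt_srefl[OF p0] wt_orbit_def del: alpha.simps)
  have Tn: "opT N2 ?n = sc (- inverse q) ?n"
    using T_tau[OF mc, of N2 q] q mc by simp
  have "flag (carrier L) {wt1 ?p, wt2 ?p, wt3 ?p, wt4 ?p, wt5 ?p}"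
    using induced_flag[OF n Tn irreducible_cyclic[OF irr eigD(1)[OF n] n0]]
    unfolding wt_srefl[OF p0] by simp
  then have "wt0 ?p \<in> {wt1 ?p, wt2 ?p, wt3 ?p, wt4 ?p, wt5 ?p}"
    using flag_eigenweight[OF _ mc m] by blast
  then show False using wt0_notin[OF p0] q by blast
qed

end


section \<open>Extension of scalars\<close>

locale scalar_extension = A: ring R + V: left_module "R\<lparr>carrier := B\<rparr>" V
  for R :: "('r, 'n) ring_scheme" (structure) and B :: "'r set" and V :: "('r, 'a) module" +
  assumes B_subset: "B \<subseteq> carrier R"
begin

abbreviation "F \<equiv> tensor_symbols R V"
abbreviation "S \<equiv> carrier R \<times> carrier V"
abbreviation "rel \<equiv> generate (free_Abelian_group S) (tensor_relations R B V)"
abbreviation left where "left r \<equiv> frag_extend (\<lambda>(a, v). frag_of (r \<otimes> a, v))"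

lemma keys_in_add: "Poly_Mapping.keys x \<subseteq> U \<Longrightarrow> Poly_Mapping.keys y \<subseteq> U \<Longrightarrow> Poly_Mapping.keys (x + y) \<subseteq> U"
  by (rule order_trans[OF keys_add Un_least])

lemma keys_in_diff: "Poly_Mapping.keys x \<subseteq> U \<Longrightarrow> Poly_Mapping.keys y \<subseteq> U \<Longrightarrow> Poly_Mapping.keys (x - y :: _ \<Rightarrow>\<^sub>0 int) \<subseteq> U"
  by (rule order_trans[OF keys_diff Un_least])

lemma keys_in_free: "x \<in> carrier (free_Abelian_group U) \<Longrightarrow> Poly_Mapping.keys x \<subseteq> U"
  by simp

lemma F_simps [simp]:
  "carrier F = {x. Poly_Mapping.keys x \<subseteq> S}" "x \<oplus>\<^bsub>F\<^esub> y = x + y" "\<zero>\<^bsub>F\<^esub> = 0" "r \<odot>\<^bsub>F\<^esub> x = left r x"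
  by (auto simp: tensor_symbols_def)

lemma F_inv: "inv\<^bsub>add_monoid F\<^esub> x = inv\<^bsub>free_Abelian_group S\<^esub> x"
  by (simp add: m_inv_def free_Abelian_group_def)

lemma F_abelian: "abelian_group F"
proof (rule abelian_groupI)
  fix x assume "x \<in> carrier F"
  then show "\<exists>y\<in>carrier F. y \<oplus>\<^bsub>F\<^esub> x = \<zero>\<^bsub>F\<^esub>"
    by (intro bexI[of _ "- x"]) auto
next
  fix x y assume "x \<in> carrier F" "y \<in> carrier F"
  then show "x \<oplus>\<^bsub>F\<^esub> y \<in> carrier F"
    using keys_in_add[of x S y] by (simp del: Product_Type.mem_Times_iff)
qed (auto simp: algebra_simps)

lemma F_minus: "x \<in> carrier F \<Longrightarrow> y \<in> carrier F \<Longrightarrow> x \<ominus>\<^bsub>F\<^esub> y = x - y"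
  unfolding a_minus_def a_inv_def F_inv by simp

lemma relations_carrier: "tensor_relations R B V \<subseteq> carrier (free_Abelian_group S)"
proof -
  have "frag_of x - frag_of y \<in> carrier (free_Abelian_group S)"
    "frag_of x - frag_of y - frag_of z \<in> carrier (free_Abelian_group S)"
    if "x \<in> S" "y \<in> S" "z \<in> S" for x y z
  proof -
    have "Poly_Mapping.keys (frag_of x - frag_of y) \<subseteq> S"
      using keys_diff[of "frag_of x" "frag_of y"] that by auto
    then show "frag_of x - frag_of y \<in> carrier (free_Abelian_group S)"
      and "frag_of x - frag_of y - frag_of z \<in> carrier (free_Abelian_group S)"
      using keys_diff[of "frag_of x - frag_of y" "frag_of z"] that by auto
  qed
  moreover have "b \<odot>\<^bsub>V\<^esub> v \<in> carrier V" if "b \<in> B" "v \<in> carrier V" for b v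
    using V.smult_closed that by simp
  moreover have "b \<in> carrier R" if "b \<in> B" for b using B_subset that by blast
  ultimately show ?thesis
    unfolding tensor_relations_def by (auto simp del: carrier_free_Abelian_group_iff)
qed

lemma rel_subgroup_free: "subgroup rel (free_Abelian_group S)"
  using group.generate_is_subgroup[OF group_free_Abelian_group relations_carrier] .

lemma rel_subgroup: "subgroup rel (add_monoid F)"
  using rel_subgroup_free unfolding subgroup_def F_inv
  by (simp add: tensor_symbols_def)

lemma rel_closed:
  "0 \<in> rel" "x \<in> rel \<Longrightarrow> y \<in> rel \<Longrightarrow> x + y \<in> rel" "x \<in> rel \<Longrightarrow> y \<in> rel \<Longrightarrow> x - y \<in> rel"
proof -
  show "0 \<in> rel" using subgroup.one_closed[OF rel_subgroup_free] by simp
  show "x + y \<in> rel" if "x \<in> rel" "y \<in> rel" for x y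
    using subgroup.m_closed[OF rel_subgroup_free that] by simp
  show "x - y \<in> rel" if x: "x \<in> rel" and y: "y \<in> rel" for x y
  proof -
    have "Poly_Mapping.keys y \<subseteq> S"
      using keys_in_free subgroup.subset[OF rel_subgroup_free] y by blast
    then have "- y \<in> rel"
      using subgroup.m_inv_closed[OF rel_subgroup_free y] by simp
    with x have "x + - y \<in> rel" using subgroup.m_closed[OF rel_subgroup_free, of x "- y"] by simp
    then show ?thesis by simp
  qed
qed

lemma left_relation:
  assumes r: "r \<in> carrier R" and x: "x \<in> tensor_relations R B V"
  shows "left r x \<in> tensor_relations R B V"
proof -
  consider (1) a b v where "x = frag_of (a \<oplus> b, v) - frag_of (a, v) - frag_of (b, v)"
      "a \<in> carrier R" "b \<in> carrier R" "v \<in> carrier V"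
    | (2) a v w where "x = frag_of (a, v \<oplus>\<^bsub>V\<^esub> w) - frag_of (a, v) - frag_of (a, w)"
      "a \<in> carrier R" "v \<in> carrier V" "w \<in> carrier V"
    | (3) a b v where "x = frag_of (a \<otimes> b, v) - frag_of (a, b \<odot>\<^bsub>V\<^esub> v)"
      "a \<in> carrier R" "b \<in> B" "v \<in> carrier V"
    using x unfolding tensor_relations_def by blast
  then show ?thesis
  proof cases
    case 1
    then have "left r x = frag_of (r \<otimes> a \<oplus> r \<otimes> b, v) - frag_of (r \<otimes> a, v) - frag_of (r \<otimes> b, v)"
      using r by (simp add: frag_extend_diff A.r_distr)
    then show ?thesis using 1 r A.m_closed unfolding tensor_relations_def by blast
  next
    case 2
    then have "left r x = frag_of (r \<otimes> a, v \<oplus>\<^bsub>V\<^esub> w) - frag_of (r \<otimes> a, v) - frag_of (r \<otimes> a, w)"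
      by (simp add: frag_extend_diff)
    then show ?thesis using 2 r A.m_closed unfolding tensor_relations_def by blast
  next
    case 3
    then have "left r x = frag_of ((r \<otimes> a) \<otimes> b, v) - frag_of (r \<otimes> a, b \<odot>\<^bsub>V\<^esub> v)"
      using r B_subset by (simp add: frag_extend_diff A.m_assoc subset_iff)
    then show ?thesis using 3 r A.m_closed unfolding tensor_relations_def by blast
  qed
qed

lemma left_rel:
  assumes r: "r \<in> carrier R" and x: "x \<in> rel"
  shows "left r x \<in> rel"
  using x
proof (induction rule: generate.induct)
  case one
  then show ?case using rel_closed(1) by simp
next
  case (incl h)
  then show ?case by (rule generate.incl[OF left_relation[OF r]])
next
  case (inv h)
  then have "Poly_Mapping.keys h \<subseteq> S" using relations_carrier keys_in_free by blast
  then have "left r (inv\<^bsub>free_Abelian_group S\<^esub> h) = 0 - left r h"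
    by (simp add: frag_extend_minus)
  moreover have "left r h \<in> rel" by (rule generate.incl[OF left_relation[OF r inv]])
  ultimately show ?case using rel_closed(3)[OF rel_closed(1)] by simp
next
  case (eng h1 h2)
  then show ?case using rel_closed(2) by (simp add: frag_extend_add)
qed

lemma left_closed:
  assumes r: "r \<in> carrier R" and x: "Poly_Mapping.keys x \<subseteq> S"
  shows "Poly_Mapping.keys (left r x) \<subseteq> S"
proof -
  have "Poly_Mapping.keys (case y of (a, v) \<Rightarrow> frag_of (r \<otimes> a, v)) \<subseteq> S" if "y \<in> Poly_Mapping.keys x" for y
    using that x r by (cases y) auto
  then show ?thesis
    using keys_frag_extend[of "\<lambda>(a, v). frag_of (r \<otimes> a, v)" x] by blast
qed

sublocale Ind: stable_quotient R F rel
  by (intro stable_quotient.intro stable_quotient_axioms.intro A.ring_axioms F_abelian rel_subgroup)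
    (auto simp: left_closed frag_extend_add left_rel simp del: Product_Type.mem_Times_iff)

lemma induced_module_eq: "induced_module R B V = Ind.Q"
  by (simp add: induced_module_def)

lemma cls_eqI: "x \<in> carrier F \<Longrightarrow> y \<in> carrier F \<Longrightarrow> x - y \<in> rel \<Longrightarrow> Ind.cls x = Ind.cls y"
  by (subst Ind.cls_eq_iff) (simp_all add: F_minus)

lemma rel_free_induct:
  assumes x: "Poly_Mapping.keys x \<subseteq> S"
    and f: "\<And>x y. f (x - y) = f x - f y" and g: "\<And>a v. a \<in> carrier R \<Longrightarrow> v \<in> carrier V \<Longrightarrow> f (frag_of (a, v)) \<in> rel"
  shows "f x \<in> rel"
  using x
proof (induction rule: frag_induction)
  case zero
  then show ?case using f[of 0 0] rel_closed(1) by simp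
next
  case (one x)
  then show ?case using g by auto
next
  case (diff a b)
  then show ?case using f rel_closed(3) by simp
qed

lemma induced_left_module: "left_module R Ind.Q"
proof (rule Ind.left_module_Q)
  fix a b x assume a: "a \<in> carrier R" and b: "b \<in> carrier R" and x: "x \<in> carrier F"
  then have xk: "Poly_Mapping.keys x \<subseteq> S" by simp
  note cl = left_closed[OF _ xk]
  have "left (a \<oplus> b) x - (left a x + left b x) \<in> rel"
  proof (rule rel_free_induct[OF xk, of "\<lambda>x. left (a \<oplus> b) x - (left a x + left b x)"])
    fix c v assume c: "c \<in> carrier R" and v: "v \<in> carrier V"
    have "frag_of (a \<otimes> c \<oplus> b \<otimes> c, v) - frag_of (a \<otimes> c, v) - frag_of (b \<otimes> c, v) \<in> tensor_relations R B V"
      unfolding tensor_relations_def using a b c v A.m_closed by blast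
    then have "frag_of (a \<otimes> c \<oplus> b \<otimes> c, v) - frag_of (a \<otimes> c, v) - frag_of (b \<otimes> c, v) \<in> rel"
      by (rule generate.incl)
    then show "left (a \<oplus> b) (frag_of (c, v)) - (left a (frag_of (c, v)) + left b (frag_of (c, v))) \<in> rel"
      using a b c by (simp add: A.l_distr diff_diff_eq)
  qed (simp add: frag_extend_diff)
  moreover have "left a x + left b x \<in> carrier F"
    using cl[OF a] cl[OF b] keys_add[of "left a x" "left b x"] by auto
  ultimately show "Ind.cls ((a \<oplus> b) \<odot>\<^bsub>F\<^esub> x) = Ind.cls (a \<odot>\<^bsub>F\<^esub> x \<oplus>\<^bsub>F\<^esub> b \<odot>\<^bsub>F\<^esub> x)"
    using cl[of "a \<oplus> b"] a b by (simp add: cls_eqI)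
  have "left (a \<otimes> b) x - left a (left b x) \<in> rel"
  proof (rule rel_free_induct[OF xk, of "\<lambda>x. left (a \<otimes> b) x - left a (left b x)"])
    fix c v assume c: "c \<in> carrier R" and v: "v \<in> carrier V"
    show "left (a \<otimes> b) (frag_of (c, v)) - left a (left b (frag_of (c, v))) \<in> rel"
      using a b c rel_closed(1) by (simp add: A.m_assoc)
  qed (simp add: frag_extend_diff)
  then show "Ind.cls ((a \<otimes> b) \<odot>\<^bsub>F\<^esub> x) = Ind.cls (a \<odot>\<^bsub>F\<^esub> (b \<odot>\<^bsub>F\<^esub> x))"
    using cl[of "a \<otimes> b"] left_closed[OF a cl[OF b]] a b by (simp add: cls_eqI)
next
  fix x assume x: "x \<in> carrier F"
  then have xk: "Poly_Mapping.keys x \<subseteq> S" by simp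
  have "left \<one> x - x \<in> rel"
    by (rule rel_free_induct[OF xk, of "\<lambda>x. left \<one> x - x"])
      (simp_all add: frag_extend_diff rel_closed(1))
  then show "Ind.cls (\<one> \<odot>\<^bsub>F\<^esub> x) = Ind.cls x"
    using left_closed[OF _ xk, of \<one>] x by (simp add: cls_eqI)
qed

definition symb where "symb a v = Ind.cls (frag_of (a, v))"

lemma symb_carrier: "a \<in> carrier R \<Longrightarrow> v \<in> carrier V \<Longrightarrow> symb a v \<in> carrier Ind.Q"
  unfolding symb_def by (rule Ind.cls_carrier) simp

lemma smult_symb:
  "r \<in> carrier R \<Longrightarrow> a \<in> carrier R \<Longrightarrow> v \<in> carrier V \<Longrightarrow> r \<odot>\<^bsub>Ind.Q\<^esub> symb a v = symb (r \<otimes> a) v"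
  unfolding symb_def by (subst Ind.smult_Q) simp_all

lemma symb_balanced:
  assumes "a \<in> carrier R" "b \<in> B" "v \<in> carrier V"
  shows "symb (a \<otimes> b) v = symb a (b \<odot>\<^bsub>V\<^esub> v)"
proof -
  have "frag_of (a \<otimes> b, v) - frag_of (a, b \<odot>\<^bsub>V\<^esub> v) \<in> tensor_relations R B V"
    unfolding tensor_relations_def using assms by blast
  then have "frag_of (a \<otimes> b, v) - frag_of (a, b \<odot>\<^bsub>V\<^esub> v) \<in> rel"
    by (rule generate.incl)
  moreover have "b \<odot>\<^bsub>V\<^esub> v \<in> carrier V" "b \<in> carrier R" using assms V.smult_closed B_subset by auto
  ultimately show ?thesis
    unfolding symb_def using assms by (intro cls_eqI) auto
qed

lemma induced_cyclic:
  assumes v: "v \<in> carrier V" and gen: "\<And>w. w \<in> carrier V \<Longrightarrow> \<exists>b\<in>B. w = b \<odot>\<^bsub>V\<^esub> v"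
    and y: "y \<in> carrier Ind.Q"
  shows "\<exists>r\<in>carrier R. y = r \<odot>\<^bsub>Ind.Q\<^esub> symb \<one> v"
proof -
  interpret I: left_module R Ind.Q by (rule induced_left_module)
  have sub: "submodule {r \<odot>\<^bsub>Ind.Q\<^esub> symb \<one> v | r. r \<in> carrier R} R Ind.Q"
    using I.cyclic_submodule symb_carrier v by blast
  note sd = I.submoduleD[OF sub]
  obtain x where x: "x \<in> carrier F" "y = Ind.cls x" using y Ind.carrier_Q by auto
  have keys: "Poly_Mapping.keys x \<subseteq> S" using x by simp
  have "Ind.cls x \<in> {r \<odot>\<^bsub>Ind.Q\<^esub> symb \<one> v | r. r \<in> carrier R}"
  proof (rule free_Abelian_group_induct[OF keys])
    show "Ind.cls 0 \<in> {r \<odot>\<^bsub>Ind.Q\<^esub> symb \<one> v | r. r \<in> carrier R}"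
      using sd(2) Ind.zero_Q by simp
  next
    fix x y
    assume k: "Poly_Mapping.keys x \<subseteq> S" "Poly_Mapping.keys y \<subseteq> S"
      and mem: "Ind.cls x \<in> {r \<odot>\<^bsub>Ind.Q\<^esub> symb \<one> v | r. r \<in> carrier R}"
        "Ind.cls y \<in> {r \<odot>\<^bsub>Ind.Q\<^esub> symb \<one> v | r. r \<in> carrier R}"
    have c: "x \<in> carrier F" "y \<in> carrier F" "x - y \<in> carrier F"
      using k keys_in_diff[OF k] by simp_all
    note cl = Ind.cls_carrier[OF c(1)] Ind.cls_carrier[OF c(2)] Ind.cls_carrier[OF c(3)]
    have "Ind.cls x = Ind.cls (x - y) \<oplus>\<^bsub>Ind.Q\<^esub> Ind.cls y"
      using Ind.add_Q[OF c(3,2)] by simp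
    then have "Ind.cls x \<ominus>\<^bsub>Ind.Q\<^esub> Ind.cls y = Ind.cls (x - y)"
      using cl by (simp add: a_minus_def I.M.add.m_assoc I.M.r_neg)
    then show "Ind.cls (x - y) \<in> {r \<odot>\<^bsub>Ind.Q\<^esub> symb \<one> v | r. r \<in> carrier R}"
      using sd(4)[OF mem] by simp
  next
    fix s assume "s \<in> S"
    then obtain a w where s: "s = (a, w)" "a \<in> carrier R" "w \<in> carrier V" by blast
    then obtain b where b: "b \<in> B" "w = b \<odot>\<^bsub>V\<^esub> v" using gen by blast
    have bc: "b \<in> carrier R" using b B_subset by blast
    have "Ind.cls (frag_of s) = (a \<otimes> b) \<odot>\<^bsub>Ind.Q\<^esub> symb \<one> v"
      unfolding s(1) b(2) symb_def[symmetric] symb_balanced[OF s(2) b(1) v, symmetric]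
      using smult_symb[of "a \<otimes> b" \<one> v] s bc v by simp
    then show "Ind.cls (frag_of s) \<in> {r \<odot>\<^bsub>Ind.Q\<^esub> symb \<one> v | r. r \<in> carrier R}"
      using s bc by blast
  qed
  then show ?thesis using x by blast
qed

text \<open>
  Extension of scalars is left adjoint to restriction: the hypotheses on \<open>g\<close> say that \<open>a \<otimes> w \<mapsto> a g(w)\<close>
  respects the relations of the tensor product. Only the consequence for annihilators is recorded.
\<close>

lemma induced_universal:
  assumes L: "left_module R L"
    and g: "\<And>w. w \<in> carrier V \<Longrightarrow> g w \<in> carrier L"
    and g_add: "\<And>v w. v \<in> carrier V \<Longrightarrow> w \<in> carrier V \<Longrightarrow> g (v \<oplus>\<^bsub>V\<^esub> w) = g v \<oplus>\<^bsub>L\<^esub> g w"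
    and g_smult: "\<And>b w. b \<in> B \<Longrightarrow> w \<in> carrier V \<Longrightarrow> g (b \<odot>\<^bsub>V\<^esub> w) = b \<odot>\<^bsub>L\<^esub> g w"
    and r: "r \<in> carrier R" and v: "v \<in> carrier V" and zero: "r \<odot>\<^bsub>Ind.Q\<^esub> symb \<one> v = \<zero>\<^bsub>Ind.Q\<^esub>"
  shows "r \<odot>\<^bsub>L\<^esub> g v = \<zero>\<^bsub>L\<^esub>"
proof -
  interpret L: left_module R L by (rule L)
  have "(\<lambda>(a, w). a \<odot>\<^bsub>L\<^esub> g w) ` S \<subseteq> carrier (add_monoid L)"
    using g L.smult_closed by auto
  then obtain h where h: "h \<in> hom (free_Abelian_group S) (add_monoid L)"
    and h_of: "\<And>x. x \<in> S \<Longrightarrow> h (frag_of x) = (\<lambda>(a, w). a \<odot>\<^bsub>L\<^esub> g w) x"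
    by (rule comm_group.free_Abelian_group_universal[OF L.M.a_comm_group]) blast
  have hs: "h (frag_of (a, w)) = a \<odot>\<^bsub>L\<^esub> g w" if "a \<in> carrier R" "w \<in> carrier V" for a w
    using h_of that by simp
  interpret h: group_hom "free_Abelian_group S" "add_monoid L" h
    using h L.M.a_group by (simp add: group_hom_def group_hom_axioms_def)
  have h_diff: "h (x - y) = h x \<ominus>\<^bsub>L\<^esub> h y" if "Poly_Mapping.keys x \<subseteq> S" "Poly_Mapping.keys y \<subseteq> S" for x y
  proof -
    have "x - y = x \<otimes>\<^bsub>free_Abelian_group S\<^esub> inv\<^bsub>free_Abelian_group S\<^esub> y" using that by simp
    then show ?thesis
      using h.hom_mult[of x "- y"] h.hom_inv[of y] that by (simp add: a_minus_def a_inv_def)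
  qed
  have h_rel: "h x = \<zero>\<^bsub>L\<^esub>" if "x \<in> tensor_relations R B V" for x
  proof -
    have cancel: "(p \<oplus>\<^bsub>L\<^esub> u) \<ominus>\<^bsub>L\<^esub> p \<ominus>\<^bsub>L\<^esub> u = \<zero>\<^bsub>L\<^esub>" if "p \<in> carrier L" "u \<in> carrier L" for p u
      using L.M.r_neg[of "p \<oplus>\<^bsub>L\<^esub> u"] that by (simp add: a_minus_def L.M.minus_add L.M.add.m_assoc)
    consider (1) a b v where "x = frag_of (a \<oplus> b, v) - frag_of (a, v) - frag_of (b, v)"
        "a \<in> carrier R" "b \<in> carrier R" "v \<in> carrier V"
      | (2) a v w where "x = frag_of (a, v \<oplus>\<^bsub>V\<^esub> w) - frag_of (a, v) - frag_of (a, w)"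
        "a \<in> carrier R" "v \<in> carrier V" "w \<in> carrier V"
      | (3) a b v where "x = frag_of (a \<otimes> b, v) - frag_of (a, b \<odot>\<^bsub>V\<^esub> v)"
        "a \<in> carrier R" "b \<in> B" "v \<in> carrier V"
      using \<open>x \<in> _\<close> unfolding tensor_relations_def by blast
    then show ?thesis
    proof cases
      case 1
      have "h x = h (frag_of (a \<oplus> b, v) - frag_of (a, v)) \<ominus>\<^bsub>L\<^esub> h (frag_of (b, v))"
        unfolding 1(1) by (rule h_diff)
          (use 1 keys_diff[of "frag_of (a \<oplus> b, v)" "frag_of (a, v)"] in auto)
      also have "h (frag_of (a \<oplus> b, v) - frag_of (a, v)) = (a \<oplus> b) \<odot>\<^bsub>L\<^esub> g v \<ominus>\<^bsub>L\<^esub> a \<odot>\<^bsub>L\<^esub> g v"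
        using 1 by (subst h_diff) (auto simp: hs)
      finally show ?thesis
        using 1 g[of v] by (simp add: hs L.smult_l_distr L.smult_closed cancel)
    next
      case 2
      have "h x = h (frag_of (a, v \<oplus>\<^bsub>V\<^esub> w) - frag_of (a, v)) \<ominus>\<^bsub>L\<^esub> h (frag_of (a, w))"
        unfolding 2(1) by (rule h_diff)
          (use 2 keys_diff[of "frag_of (a, v \<oplus>\<^bsub>V\<^esub> w)" "frag_of (a, v)"] in auto)
      also have "h (frag_of (a, v \<oplus>\<^bsub>V\<^esub> w) - frag_of (a, v)) = a \<odot>\<^bsub>L\<^esub> (g v \<oplus>\<^bsub>L\<^esub> g w) \<ominus>\<^bsub>L\<^esub> a \<odot>\<^bsub>L\<^esub> g v"
        using 2 by (subst h_diff) (auto simp: hs g_add)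
      finally show ?thesis
        using 2 g[of v] g[of w]
        by (simp add: hs L.smult_r_distr L.smult_closed cancel)
    next
      case 3
      then have bv: "b \<odot>\<^bsub>V\<^esub> v \<in> carrier V" "b \<in> carrier R" using V.smult_closed B_subset by auto
      have "h x = (a \<otimes> b) \<odot>\<^bsub>L\<^esub> g v \<ominus>\<^bsub>L\<^esub> a \<odot>\<^bsub>L\<^esub> (b \<odot>\<^bsub>L\<^esub> g v)"
        unfolding 3(1) using 3 bv by (subst h_diff) (auto simp: hs g_smult)
      then show ?thesis
        using 3 bv g[of v] by (simp add: L.smult_assoc a_minus_def L.M.r_neg L.smult_closed)
    qed
  qed
  have "h x = \<zero>\<^bsub>L\<^esub>" if "x \<in> rel" for x
    using that
  proof (induction rule: generate.induct)
    case (inv y)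
    then have "y \<in> carrier (free_Abelian_group S)" using relations_carrier by blast
    then show ?case using h.hom_inv[of y] h_rel[OF inv] L.M.add.inv_one by (simp add: a_inv_def)
  next
    case (eng x y)
    then have "x \<in> carrier (free_Abelian_group S)" "y \<in> carrier (free_Abelian_group S)"
      using group.generate_in_carrier[OF group_free_Abelian_group relations_carrier] by blast+
    then show ?case using h.hom_mult[of x y] eng by simp
  qed (use h.hom_one h_rel in auto)
  moreover have "frag_of (r, v) \<in> rel"
    using zero smult_symb[OF r _ v] r v Ind.cls_zero_iff[of "frag_of (r, v)"] by (simp add: symb_def)
  ultimately show ?thesis using hs[OF r v] by simp
qed

end

section \<open>Modules induced from a line\<close>

lemma hscal_simps:
  "hscal q (a + b) = hscal q a \<oplus>\<^bsub>hecke q\<^esub> hscal q b" "hscal q (a * b) = hscal q a \<otimes>\<^bsub>hecke q\<^esub> hscal q b"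
  "hscal q (- a) = \<ominus>\<^bsub>hecke q\<^esub> hscal q a" "hscal q 1 = \<one>\<^bsub>hecke q\<^esub>" "hscal q a \<in> carrier (hecke q)"
  by (simp_all add: hscal_def fscal_add fscal_mult fscal_uminus hclass_add hclass_mult hclass_uminus
      flip: hclass_1)

lemma hscal_central:
  "r \<in> carrier (hecke q) \<Longrightarrow> r \<otimes>\<^bsub>hecke q\<^esub> hscal q a = hscal q a \<otimes>\<^bsub>hecke q\<^esub> r"
  by (auto simp: carrier_hecke hscal_def fscal_commute simp flip: hclass_mult)

lemma parabolic_subset: "parabolic q i \<subseteq> carrier (hecke q)"
  unfolding parabolic_def
  by (rule ring.generate_ring_incl[OF ring_hecke]) (auto simp: hscal_def hX_def hT_def)

lemma parabolic_gens: "hscal q a \<in> parabolic q i" "hX q \<nu> \<in> parabolic q i" "hT q i \<in> parabolic q i"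
  unfolding parabolic_def by (auto intro: generate_ring.incl)

text \<open>
  The scalar multiples of one vector \<open>n\<close> in a module over a subalgebra \<open>B\<close> that contains the scalars.
  It is used for the given one-dimensional module and for the line through a vector of a module over
  the whole algebra.
\<close>

locale hecke_line = left_module "(hecke q)\<lparr>carrier := B\<rparr>" N
  for q :: complex and B :: "free_alg set set" and N :: "(free_alg set, 'a) module" (structure) +
  fixes n :: 'a
  assumes n: "n \<in> carrier N" and B: "B \<subseteq> carrier (hecke q)" and scalars: "hscal q a \<in> B"
begin

lemma closed: "b \<in> B \<Longrightarrow> b \<odot> n \<in> carrier N"
  using smult_closed[of b n] n by simp

lemma scalar_1: "hscal q 1 \<odot> n = n"
  using smult_one[OF n] by (simp add: hscal_simps)

lemma scalar_add: "hscal q (a + b) \<odot> n = hscal q a \<odot> n \<oplus> hscal q b \<odot> n"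
  using smult_l_distr[of "hscal q a" "hscal q b" n] scalars n by (simp add: hscal_simps)

lemma scalar_mult: "hscal q (a * b) \<odot> n = hscal q a \<odot> (hscal q b \<odot> n)"
  using smult_assoc[of "hscal q a" "hscal q b" n] scalars n by (simp add: hscal_simps)

lemma eigen_scalar:
  assumes b: "b \<in> B" "b \<odot> n = hscal q e \<odot> n"
  shows "b \<odot> (hscal q a \<odot> n) = hscal q (a * e) \<odot> n"
proof -
  have "b \<in> carrier (hecke q)" using b B by blast
  then show ?thesis
    using smult_assoc[of b "hscal q a" n] smult_assoc[of "hscal q a" b n] hscal_central[of b q a]
      b scalars n by (simp add: scalar_mult)
qed

lemma eigen_add:
  assumes "g \<in> B" "h \<in> B" "g \<odot> n = hscal q d \<odot> n" "h \<odot> n = hscal q e \<odot> n"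
  shows "(g \<oplus>\<^bsub>hecke q\<^esub> h) \<odot> n = hscal q (d + e) \<odot> n"
  using smult_l_distr[of g h n] n assms by (simp add: scalar_add)

lemma eigen_mult:
  assumes "g \<in> B" "h \<in> B" "g \<odot> n = hscal q d \<odot> n" "h \<odot> n = hscal q e \<odot> n"
  shows "(g \<otimes>\<^bsub>hecke q\<^esub> h) \<odot> n = hscal q (e * d) \<odot> n"
  using smult_assoc[of g h n] n assms eigen_scalar[OF assms(1,3)] by simp

lemma eigen_uminus:
  assumes "h \<in> B" "h \<odot> n = hscal q e \<odot> n"
  shows "(\<ominus>\<^bsub>hecke q\<^esub> h) \<odot> n = hscal q (- e) \<odot> n"
proof -
  interpret A: ring "hecke q" by (rule ring_hecke)
  have "h \<in> carrier (hecke q)" using assms B by blast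
  then have "\<ominus>\<^bsub>hecke q\<^esub> h = hscal q (- 1) \<otimes>\<^bsub>hecke q\<^esub> h"
    by (simp add: hscal_simps A.l_minus)
  then show ?thesis
    using eigen_mult[OF scalars assms(1) refl assms(2), of "-1"] by simp
qed

lemma scalar_eq_iff:
  assumes "n \<noteq> \<zero>"
  shows "hscal q a \<odot> n = hscal q b \<odot> n \<longleftrightarrow> a = b"
proof
  assume eq: "hscal q a \<odot> n = hscal q b \<odot> n"
  show "a = b"
  proof (rule ccontr)
    assume ne: "a \<noteq> b"
    have "hscal q (a - b) \<odot> n \<oplus> hscal q b \<odot> n = hscal q b \<odot> n"
      using scalar_add[of "a - b" b] eq by simp
    then have "hscal q (a - b) \<odot> n = \<zero>"
      using closed[OF scalars] M.add.r_cancel_one' by metis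
    then have "n = hscal q (1 / (a - b)) \<odot> \<zero>"
      using scalar_mult[of "1 / (a - b)" "a - b"] scalar_1 ne by simp
    then show False using smult_r_null[of "hscal q (1 / (a - b))"] scalars assms by simp
  qed
qed simp

end

text \<open>
  The element \<open>1 \<otimes> v\<close>.
\<close>

definition induced_generator ::
  "('r, 'n) ring_scheme \<Rightarrow> 'r set \<Rightarrow> ('r, 'a) module \<Rightarrow> 'a \<Rightarrow> ('r \<times> 'a \<Rightarrow>\<^sub>0 int) set" where
  "induced_generator R B V v =
    generate (free_Abelian_group (carrier R \<times> carrier V)) (tensor_relations R B V)
      +>\<^bsub>tensor_symbols R V\<^esub> frag_of (\<one>\<^bsub>R\<^esub>, v)"

text \<open>
  A one-dimensional module of the subalgebra determines the induced module by the character with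
  which the generators act. The last statement is Frobenius reciprocity in terms of annihilators: a
  vector of any module with the same character is the image of the generator.
\<close>

theorem induced_from_line:
  fixes V :: "(free_alg set, 'a) module" and v :: 'a
  assumes V: "one_dim_module q i V v c t"
  defines "M \<equiv> induced_module (hecke q) (parabolic q i) V"
    and "x \<equiv> induced_generator (hecke q) (parabolic q i) V v"
  shows "left_module (hecke q) M" "x \<in> carrier M"
    and "\<And>y. y \<in> carrier M \<Longrightarrow> \<exists>r\<in>carrier (hecke q). y = r \<odot>\<^bsub>M\<^esub> x"
    and "hT q i \<odot>\<^bsub>M\<^esub> x = hscal q c \<odot>\<^bsub>M\<^esub> x" "\<And>\<nu>. hX q \<nu> \<odot>\<^bsub>M\<^esub> x = hscal q (t \<nu>) \<odot>\<^bsub>M\<^esub> x"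
    and "\<And>(L :: (free_alg set, 'b) module) m r. left_module (hecke q) L \<Longrightarrow> m \<in> carrier L \<Longrightarrow>
      hT q i \<odot>\<^bsub>L\<^esub> m = hscal q c \<odot>\<^bsub>L\<^esub> m \<Longrightarrow> (\<And>\<nu>. hX q \<nu> \<odot>\<^bsub>L\<^esub> m = hscal q (t \<nu>) \<odot>\<^bsub>L\<^esub> m) \<Longrightarrow>
      r \<in> carrier (hecke q) \<Longrightarrow> r \<odot>\<^bsub>M\<^esub> x = \<zero>\<^bsub>M\<^esub> \<Longrightarrow> r \<odot>\<^bsub>L\<^esub> m = \<zero>\<^bsub>L\<^esub>"
proof -
  let ?B = "parabolic q i" and ?R = "hecke q"
  let ?R' = "?R\<lparr>carrier := ?B\<rparr>"
  note V' = V[unfolded one_dim_module_def]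
  interpret A: ring ?R by (rule ring_hecke)
  interpret V: left_module ?R' V using V' by blast
  interpret E: scalar_extension ?R ?B V
    by (intro scalar_extension.intro scalar_extension_axioms.intro ring_hecke V.left_module_axioms parabolic_subset)
  have v: "v \<in> carrier V" "v \<noteq> \<zero>\<^bsub>V\<^esub>" "carrier V = {hscal q a \<odot>\<^bsub>V\<^esub> v | a. True}"
    "hT q i \<odot>\<^bsub>V\<^esub> v = hscal q c \<odot>\<^bsub>V\<^esub> v" "\<And>\<nu>. hX q \<nu> \<odot>\<^bsub>V\<^esub> v = hscal q (t \<nu>) \<odot>\<^bsub>V\<^esub> v"
    using V' by blast+
  interpret line: hecke_line q ?B V v
    by (intro hecke_line.intro hecke_line_axioms.intro V.left_module_axioms v(1) parabolic_subset parabolic_gens)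
  have M: "M = E.Ind.Q" unfolding M_def by (rule E.induced_module_eq)
  interpret M: left_module ?R M unfolding M by (rule E.induced_left_module)
  have x_def: "x = E.symb \<one>\<^bsub>?R\<^esub> v" by (simp add: assms(3) induced_generator_def E.symb_def)
  have x: "x \<in> carrier M" unfolding x_def M by (rule E.symb_carrier) (use v in auto)
  have sub: "b \<in> carrier ?R" if "b \<in> ?B" for b using that parabolic_subset by blast
  have gen: "\<exists>r\<in>carrier ?R. y = r \<odot>\<^bsub>M\<^esub> x" if "y \<in> carrier M" for y
    unfolding x_def M
  proof (rule E.induced_cyclic[OF v(1)])
    show "\<exists>b\<in>?B. w = b \<odot>\<^bsub>V\<^esub> v" if "w \<in> carrier V" for w
      using that parabolic_gens(1) unfolding v(3) by blast
  qed (use that M in simp)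
  have transfer: "b \<odot>\<^bsub>M\<^esub> x = hscal q e \<odot>\<^bsub>M\<^esub> x"
    if b: "b \<in> ?B" and e: "b \<odot>\<^bsub>V\<^esub> v = hscal q e \<odot>\<^bsub>V\<^esub> v" for b e
    using E.symb_balanced[OF A.one_closed b v(1)] E.symb_balanced[OF A.one_closed parabolic_gens(1)[of q e i] v(1)]
      E.smult_symb[OF sub[OF b] A.one_closed v(1)] E.smult_symb[OF hscal_simps(5)[of q e] A.one_closed v(1)]
      sub[OF b] hscal_simps(5)[of q e] e
    unfolding x_def M by simp
  have univ: "r \<odot>\<^bsub>L\<^esub> m = \<zero>\<^bsub>L\<^esub>"
    if L: "left_module ?R L" and m: "m \<in> carrier L" and Tm: "hT q i \<odot>\<^bsub>L\<^esub> m = hscal q c \<odot>\<^bsub>L\<^esub> m"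
      and Xm: "\<And>\<nu>. hX q \<nu> \<odot>\<^bsub>L\<^esub> m = hscal q (t \<nu>) \<odot>\<^bsub>L\<^esub> m"
      and r: "r \<in> carrier ?R" and rx: "r \<odot>\<^bsub>M\<^esub> x = \<zero>\<^bsub>M\<^esub>"
    for L :: "(free_alg set, 'b) module" and m r
  proof -
    interpret L: hecke_line q "carrier ?R" L m
      using L m by (intro hecke_line.intro hecke_line_axioms.intro) (simp_all add: hscal_simps)
    \<comment> \<open>The subalgebra acts on both lines through the same character.\<close>
    have char: "\<exists>e. b \<odot>\<^bsub>V\<^esub> v = hscal q e \<odot>\<^bsub>V\<^esub> v \<and> b \<odot>\<^bsub>L\<^esub> m = hscal q e \<odot>\<^bsub>L\<^esub> m" if "b \<in> ?B" for b
      using that unfolding parabolic_def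
    proof (induction rule: generate_ring.induct)
      case one
      then show ?case by (intro exI[of _ 1]) (simp add: hscal_simps)
    next
      case (incl h)
      then show ?case using v(4,5) Tm Xm by blast
    next
      case (a_inv h)
      then have "h \<in> ?B" unfolding parabolic_def by blast
      then show ?case using a_inv.IH line.eigen_uminus L.eigen_uminus sub by blast
    next
      case (eng_add g h)
      then have "g \<in> ?B" "h \<in> ?B" unfolding parabolic_def by blast+
      then show ?case using eng_add.IH line.eigen_add L.eigen_add sub by meson
    next
      case (eng_mult g h)
      then have "g \<in> ?B" "h \<in> ?B" unfolding parabolic_def by blast+
      then show ?case using eng_mult.IH line.eigen_mult L.eigen_mult sub by meson
    qed
    define g where "g w = hscal q (THE a. w = hscal q a \<odot>\<^bsub>V\<^esub> v) \<odot>\<^bsub>L\<^esub> m" for w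
    have g: "g (hscal q a \<odot>\<^bsub>V\<^esub> v) = hscal q a \<odot>\<^bsub>L\<^esub> m" for a
      by (simp add: g_def line.scalar_eq_iff[OF v(2)])
    have gv: "g v = m"
      using g[of 1] by (simp only: line.scalar_1 L.scalar_1)
    have "r \<odot>\<^bsub>L\<^esub> g v = \<zero>\<^bsub>L\<^esub>"
    proof (rule E.induced_universal[OF L _ _ _ r v(1)])
      show "g w \<in> carrier L" for w
        unfolding g_def by (rule L.closed[OF hscal_simps(5)])
      show "g (u \<oplus>\<^bsub>V\<^esub> w) = g u \<oplus>\<^bsub>L\<^esub> g w" if uw: "u \<in> carrier V" "w \<in> carrier V" for u w
      proof -
        obtain a b where "u = hscal q a \<odot>\<^bsub>V\<^esub> v" "w = hscal q b \<odot>\<^bsub>V\<^esub> v"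
          using uw unfolding v(3) by blast
        then show ?thesis by (simp only: line.scalar_add[symmetric] g L.scalar_add)
      qed
      show "g (b \<odot>\<^bsub>V\<^esub> w) = b \<odot>\<^bsub>L\<^esub> g w" if b: "b \<in> ?B" and w: "w \<in> carrier V" for b w
      proof -
        obtain a where a: "w = hscal q a \<odot>\<^bsub>V\<^esub> v" using w unfolding v(3) by blast
        obtain e where e: "b \<odot>\<^bsub>V\<^esub> v = hscal q e \<odot>\<^bsub>V\<^esub> v" "b \<odot>\<^bsub>L\<^esub> m = hscal q e \<odot>\<^bsub>L\<^esub> m"
          using char[OF b] by blast
        show ?thesis
          unfolding a line.eigen_scalar[OF b e(1)] g L.eigen_scalar[OF sub[OF b] e(2)] ..
      qed
      show "r \<odot>\<^bsub>E.Ind.Q\<^esub> E.symb \<one>\<^bsub>?R\<^esub> v = \<zero>\<^bsub>E.Ind.Q\<^esub>"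
        using rx unfolding x_def M .
    qed
    then show ?thesis unfolding gv .
  qed
  show "left_module (hecke q) M" by (rule M.left_module_axioms)
  show "x \<in> carrier M" by (rule x)
  show "\<And>y. y \<in> carrier M \<Longrightarrow> \<exists>r\<in>carrier (hecke q). y = r \<odot>\<^bsub>M\<^esub> x" by (rule gen)
  show "hT q i \<odot>\<^bsub>M\<^esub> x = hscal q c \<odot>\<^bsub>M\<^esub> x" by (rule transfer[OF parabolic_gens(3) v(4)])
  show "hX q \<nu> \<odot>\<^bsub>M\<^esub> x = hscal q (t \<nu>) \<odot>\<^bsub>M\<^esub> x" for \<nu> by (rule transfer[OF parabolic_gens(2) v(5)])
  show "r \<odot>\<^bsub>L\<^esub> m = \<zero>\<^bsub>L\<^esub>"
    if "left_module (hecke q) L" "m \<in> carrier L" "hT q i \<odot>\<^bsub>L\<^esub> m = hscal q c \<odot>\<^bsub>L\<^esub> m"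
      "\<And>\<nu>. hX q \<nu> \<odot>\<^bsub>L\<^esub> m = hscal q (t \<nu>) \<odot>\<^bsub>L\<^esub> m" "r \<in> carrier (hecke q)" "r \<odot>\<^bsub>M\<^esub> x = \<zero>\<^bsub>M\<^esub>"
    for L :: "(free_alg set, 'b) module" and m r
    by (rule univ[OF that])
qed


section \<open>Representations by operators\<close>

text \<open>
  Linear operators for the generators extend to the free algebra. If they satisfy the defining
  relations, the annihilated elements form an ideal that contains these relations, and a module over
  the quotient results.
\<close>

locale gen_operators = vector_space scale
  for scale :: "complex \<Rightarrow> 'v :: ab_group_add \<Rightarrow> 'v" +
  fixes G :: "gen \<Rightarrow> 'v \<Rightarrow> 'v"
  assumes G_add: "G g (x + y) = G g x + G g y" and G_scale: "G g (scale c x) = scale c (G g x)"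
begin

lemma word_add: "foldr G gs (x + y) = foldr G gs x + foldr G gs y"
  by (induction gs) (simp_all add: G_add)

lemma word_scale: "foldr G gs (scale c x) = scale c (foldr G gs x)"
  by (induction gs) (simp_all add: G_scale)

definition rho :: "free_alg \<Rightarrow> 'v \<Rightarrow> 'v" where
  "rho f x = (\<Sum>w\<in>Poly_Mapping.keys f. scale (Poly_Mapping.lookup f w) (foldr G (letters w) x))"

lemma rho_single: "rho (Poly_Mapping.single w c) x = scale c (foldr G (letters w) x)"
  by (cases "c = 0") (simp_all add: rho_def)

lemma rho_plus: "rho (f + g) x = rho f x + rho g x"
  unfolding rho_def by (rule setsum_keys_plus_distrib) (simp_all add: scale_left_distrib)

lemma rho_diff: "rho (f - g) x = rho f x - rho g x"
  using rho_plus[of "f - g" g x] by simp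

lemma rho_add: "rho f (x + y) = rho f x + rho f y"
  by (simp add: rho_def word_add scale_right_distrib sum.distrib)

lemma rho_zero: "rho f 0 = 0"
  using rho_add[of f 0 0] by simp

lemma rho_0: "rho 0 x = 0"
  by (simp add: rho_def)

lemma rho_fscal: "rho (fscal c) x = scale c x"
  by (simp add: fscal_def rho_single zero_free_mon_def)

lemma rho_fgen: "rho (fgen g) x = G g x"
  by (simp add: fgen_def rho_single)

lemma rho_1: "rho 1 x = x"
  using rho_fscal[of 1 x] by simp

lemma rho_mult: "rho (f * h) x = rho f (rho h x)"
proof (induction f rule: poly_mapping_single_induct)
  case (1 k c)
  show ?case
  proof (induction h rule: poly_mapping_single_induct)
    case (1 l d)
    then show ?case
      by (simp add: mult_single rho_single plus_free_mon_def word_scale)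
  next
    case (2 f g)
    then show ?case by (simp add: distrib_left rho_plus rho_add)
  qed
next
  case (2 f g)
  then show ?case by (simp add: distrib_right rho_plus)
qed

definition op_module :: "(free_alg set, 'v) module" where
  "op_module = \<lparr>carrier = UNIV, monoid.mult = undefined, one = undefined, ring.zero = 0, ring.add = (+),
    module.smult = (\<lambda>C x. rho (SOME f. f \<in> C) x)\<rparr>"

lemma op_module_simps [simp]:
  "carrier op_module = UNIV" "\<zero>\<^bsub>op_module\<^esub> = 0" "x \<oplus>\<^bsub>op_module\<^esub> y = x + y"
  by (simp_all add: op_module_def)

end

lemma free_alg_a_inv: "\<ominus>\<^bsub>free_alg_ring\<^esub> f = - f"
  using abelian_group.minus_equality[OF ring.is_abelian_group[OF ring_free_alg], of "- f" f] by simp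

locale hecke_operators = gen_operators scale G
  for scale :: "complex \<Rightarrow> 'v :: ab_group_add \<Rightarrow> 'v" and G :: "gen \<Rightarrow> 'v \<Rightarrow> 'v" +
  fixes q :: complex
  assumes rho_relation: "f \<in> hecke_relations q \<Longrightarrow> rho f x = 0"
begin

lemma rho_ideal:
  assumes "f \<in> hecke_ideal q"
  shows "rho f x = 0"
proof -
  let ?I = "{f. \<forall>x. rho f x = 0}"
  have "ideal ?I free_alg_ring"
  proof (rule idealI[OF ring_free_alg])
    show "subgroup ?I (add_monoid free_alg_ring)"
    proof (rule subgroup.intro)
      fix f assume "f \<in> ?I"
      then have "rho (- f) x = 0" for x using rho_diff[of 0 f x] by (simp add: rho_0)
      moreover have "inv\<^bsub>add_monoid free_alg_ring\<^esub> f = - f"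
        using free_alg_a_inv[of f] unfolding a_inv_def .
      ultimately show "inv\<^bsub>add_monoid free_alg_ring\<^esub> f \<in> ?I" by simp
    qed (auto simp: rho_plus rho_0)
  qed (auto simp: rho_mult rho_zero)
  then have "hecke_ideal q \<subseteq> ?I"
    unfolding hecke_ideal_def using ring.genideal_minimal[OF ring_free_alg] rho_relation by blast
  then show ?thesis using assms by blast
qed

lemma op_module_hclass: "hclass q f \<odot>\<^bsub>op_module\<^esub> x = rho f x"
proof -
  have mem: "f' \<in> hclass q f \<longleftrightarrow> f' - f \<in> hecke_ideal q" for f'
    unfolding hclass_def a_r_coset_def' by (auto intro: bexI[of _ "f' - f"])
  have "f \<in> hclass q f" unfolding mem
    using additive_subgroup.zero_closed[OF ideal.axioms(1)[OF ideal_hecke, of q]] by simp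
  then have "(SOME f'. f' \<in> hclass q f) \<in> hclass q f" by (rule someI)
  then have "rho ((SOME f'. f' \<in> hclass q f) - f) x = 0" unfolding mem by (rule rho_ideal)
  then show ?thesis by (simp add: op_module_def rho_diff)
qed

lemma op_module_left_module: "left_module (hecke q) op_module"
proof (intro left_module.intro left_module_axioms.intro ring_hecke abelian_groupI)
  show "\<exists>y\<in>carrier op_module. y \<oplus>\<^bsub>op_module\<^esub> x = \<zero>\<^bsub>op_module\<^esub>" for x
    by (rule bexI[of _ "- x"]) simp_all
qed (auto simp: carrier_hecke op_module_hclass rho_plus rho_add rho_mult rho_1 algebra_simps
    simp flip: hclass_add hclass_mult hclass_1)

lemma op_module_hecke_module: "hecke_module q op_module"
  by (rule hecke_module.intro[OF op_module_left_module])

lemma op_module_act: "hecke_module.act q op_module f x = rho f x"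
  by (simp add: hecke_module.act_def[OF op_module_hecke_module] op_module_hclass)

end

section \<open>A six-dimensional module\<close>

text \<open>
  An explicit copy of the module induced from \<open>wt0\<close>. It serves as a lower bound: the flag shows only
  that the induced module has dimension at most six, and a homomorphism onto this module shows that
  elements of the algebra do not act by zero on the generator. The coordinates belong to the
  generator \<open>e\<^sub>0\<close>, to \<open>T\<^sub>1 e\<^sub>0\<close>, and to vectors of weights \<open>wt1\<close> to \<open>wt4\<close> of which each is the image of
  the one before under an intertwiner. The parameters \<open>r\<close> and \<open>p\<close> stand for \<open>q\<^sup>-\<^sup>1\<close> and \<open>q\<^sup>3 / (q\<^sup>2 + 1)\<close>.
\<close>

type_synonym vec6 = "complex \<times> complex \<times> complex \<times> complex \<times> complex \<times> complex"

fun mT :: "complex \<Rightarrow> complex \<Rightarrow> complex \<Rightarrow> node \<Rightarrow> vec6 \<Rightarrow> vec6" where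
  "mT q r p N1 (u, v, w, x, y, z) = (v, u + (q - r) * v, q * w, w - r * x, q * y, y - r * z)"
| "mT q r p N2 (u, v, w, x, y, z) = (q * u + 3 * v - 3 * (q + r) * w, q * v, v - r * w,
     p * x + (1 + p * (q - r - p)) * y, x + (q - r - p) * y, q * z)"

lemma mT_braid:
  assumes qr: "q * r = 1" and p: "p * (q + r) = q * q"
  shows "mT q r p N1 (mT q r p N2 (mT q r p N1 (mT q r p N2 (mT q r p N1 (mT q r p N2 f)))))
    = mT q r p N2 (mT q r p N1 (mT q r p N2 (mT q r p N1 (mT q r p N2 (mT q r p N1 f)))))"
proof (cases f)
  case (fields u v w x y z)
  have qr': "q * (r * t) = t" for t
    using qr by (metis mult.assoc mult.left_neutral)
  \<comment> \<open>The rules are complete because of the names of the variables: ordered rewriting sorts the factors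
      of a product, so that \<open>p\<close>, \<open>q\<close>, \<open>r\<close> come first and adjacent to each other.\<close>
  have p1: "p * r = q * q - p * q" using p by (simp add: algebra_simps)
  have p2: "p * (r * t) = q * (q * t) - p * (q * t)" for t
    using p1 by (metis mult.assoc left_diff_distrib)
  have "p * (q * q) + p = q * (q * q)"
    using arg_cong[OF p, of "(*) q"] qr by (simp add: algebra_simps qr')
  then have p3: "p * (q * q) = q * (q * q) - p" by (simp add: algebra_simps)
  have p4: "p * (q * (q * t)) = q * (q * (q * t)) - p * t" for t
    using p3 by (metis mult.assoc left_diff_distrib)
  show ?thesis
    unfolding fields mT.simps prod.inject
    apply (intro conjI)
    subgoal by (simp add: algebra_simps qr qr')
    subgoal by (simp add: algebra_simps qr qr')
    subgoal by (simp add: algebra_simps qr qr')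
    subgoal by (simp add: algebra_simps qr qr' p1 p2 p3 p4)
    subgoal by (simp add: algebra_simps qr qr' p1 p2 p3 p4)
    subgoal by (simp add: algebra_simps qr qr' p1 p2 p3 p4)
    done
qed


text \<open>
  The generalized weight space of \<open>wt0\<close> has dimension two and is not spanned by eigenvectors, because
  \<open>s\<^sub>1\<close> fixes \<open>wt0\<close>; the additional term is the derivative of the weight along the coroot of \<open>\<alpha>\<^sub>1\<close>.
\<close>

fun mX :: "complex \<Rightarrow> complex \<Rightarrow> wt \<Rightarrow> vec6 \<Rightarrow> vec6" where
  "mX q r \<nu> (u, v, w, x, y, z) =
    (wt0 (q ^ 2) \<nu> * (u + (q - r) * of_int (pairing \<nu> N1) * v), wt0 (q ^ 2) \<nu> * v, wt1 (q ^ 2) \<nu> * w,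
     wt2 (q ^ 2) \<nu> * x, wt3 (q ^ 2) \<nu> * y, wt4 (q ^ 2) \<nu> * z)"

fun mscale :: "complex \<Rightarrow> vec6 \<Rightarrow> vec6" where
  "mscale k (u, v, w, x, y, z) = (k * u, k * v, k * w, k * x, k * y, k * z)"

fun mG :: "complex \<Rightarrow> gen \<Rightarrow> vec6 \<Rightarrow> vec6" where
  "mG q (GT i) = mT q (inverse q) (q ^ 3 / (q ^ 2 + 1)) i"
| "mG q (GX \<nu>) = mX q (inverse q) \<nu>"

lemma vector_space_mscale: "vector_space mscale"
  by unfold_locales (auto simp: algebra_simps)

lemma mT_linear:
  "mT q r p i (f + h) = mT q r p i f + mT q r p i h" "mT q r p i (mscale k f) = mscale k (mT q r p i f)"
  by (cases i; cases f; cases h; simp add: algebra_simps)+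

lemma mT_square:
  assumes qr: "q * r = 1"
  shows "mT q r p i (mT q r p i f) = mscale (q - r) (mT q r p i f) + f"
proof (cases f)
  case (fields u v w x y z)
  have qr': "q * (r * t) = t" for t
    using qr by (metis mult.assoc mult.left_neutral)
  show ?thesis
  proof (cases i)
    case N1
    show ?thesis
      unfolding fields N1 mT.simps mscale.simps plus_prod_def fst_conv snd_conv prod.inject
      by (intro conjI; simp add: algebra_simps qr qr')
  next
    case N2
    show ?thesis
      unfolding fields N2 mT.simps mscale.simps plus_prod_def fst_conv snd_conv prod.inject
      by (intro conjI; simp add: algebra_simps qr qr')
  qed
qed

lemma gen_operators_mG: "gen_operators mscale (mG q)"
proof (intro gen_operators.intro vector_space_mscale gen_operators_axioms.intro)
  show "mG q g (f + h) = mG q g f + mG q g h" for g f h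
  proof (cases g)
    case (GT i) then show ?thesis by (simp add: mT_linear)
  next
    case (GX \<nu>) then show ?thesis by (cases f; cases h) (simp add: algebra_simps)
  qed
  show "mG q g (mscale c f) = mscale c (mG q g f)" for g c f
  proof (cases g)
    case (GT i) then show ?thesis by (simp add: mT_linear)
  next
    case (GX \<nu>) then show ?thesis by (cases f) (simp add: algebra_simps)
  qed
qed

interpretation model: gen_operators mscale "mG q" for q
  by (rule gen_operators_mG)

lemma rho_flift:
  "model.rho q (flift d) (u, v, w, x, y, z) =
    (pair_sum (wt0 (q ^ 2)) d * u
       + (q - inverse q) * pair_sum (\<lambda>\<mu>. wt0 (q ^ 2) \<mu> * of_int (pairing \<mu> N1)) d * v,
     pair_sum (wt0 (q ^ 2)) d * v, pair_sum (wt1 (q ^ 2)) d * w, pair_sum (wt2 (q ^ 2)) d * x,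
     pair_sum (wt3 (q ^ 2)) d * y, pair_sum (wt4 (q ^ 2)) d * z)"
proof (induction d rule: poly_mapping_single_induct)
  case (1 \<mu> c)
  then show ?case
    by (simp add: flift_single model.rho_mult model.rho_fscal model.rho_fgen algebra_simps)
next
  case (2 f g)
  then show ?case by (simp add: flift_add model.rho_plus algebra_simps)
qed

text \<open>
  On a vector of weight \<open>t\<close> the quotient \<open>d\<close> acts by its value at \<open>t\<close>, and on the nilpotent part of
  the first block by its derivative \<open>e\<close> at \<open>wt0\<close>. All of these come from \<open>pair_sum_difference\<close>, for
  suitable functions \<open>g\<close>.
\<close>

lemma model_bernstein:
  assumes q: "q \<noteq> 0" "q\<^sup>2 \<noteq> 1" "q\<^sup>2 \<noteq> -1"
    and d: "d * (1 - gX (- alpha i)) = gX \<nu> - gX (srefl i \<nu>)"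
  shows "mG q (GX \<nu>) (mG q (GT i) f) = mG q (GT i) (mG q (GX (srefl i \<nu>)) f)
    + mscale (q - inverse q) (model.rho q (flift d) f)"
proof -
  let ?p = "q\<^sup>2"
  define r where "r = inverse q"
  define a where "a = q ^ 3 / (?p + 1)"
  have qr: "q * r = 1" using q by (simp add: r_def)
  have qr': "q * (r * t) = t" for t
    using qr by (metis mult.assoc mult.left_neutral)
  have p0: "?p \<noteq> 0" using q by simp
  have q1: "?p + 1 \<noteq> 0" using q(3) by (metis add_eq_0_iff2)
  have a: "a * (q * q + 1) = q * q * q" using q1 by (simp add: a_def power2_eq_square power3_eq_cube)
  have aq: "a * (q * q) = q * (q * q) - a" using a by (simp add: algebra_simps)
  have aq': "a * (q * (q * t)) = q * (q * (q * t)) - a * t" for t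
    using aq by (metis mult.assoc left_diff_distrib)
  have ar: "a * (r * r) = q - a"
    using arg_cong[OF aq, of "\<lambda>u. u * (r * r)"] by (simp add: algebra_simps qr qr')
  have ar': "a * (r * (r * t)) = q * t - a * t" for t
    using ar by (metis mult.assoc left_diff_distrib)
  note norm = algebra_simps qr qr' aq aq' ar ar'
  have ip: "inverse ?p = r * r" by (simp add: r_def power2_eq_square)
  have iip: "inverse (inverse ?p) = q * q" by (simp add: power2_eq_square)
  define t0 t1 t2 t3 t4 where "t0 = wt0 ?p" and "t1 = wt1 ?p" and "t2 = wt2 ?p" and "t3 = wt3 ?p"
    and "t4 = wt4 ?p"
  note t_defs = t0_def t1_def t2_def t3_def t4_def
  have tor: "t0 \<in> torus" "t1 \<in> torus" "t2 \<in> torus" "t3 \<in> torus" "t4 \<in> torus"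
    unfolding t_defs by (rule wt_torus[OF p0]; simp add: wt_orbit_def)+
  define n where "n \<mu> = (of_int (pairing \<mu> N1) :: complex)" for \<mu>
  define e where "e = pair_sum (\<lambda>\<mu>. t0 \<mu> * n \<mu>) d"
  obtain x0 y0 x1 x2 x3 x4 where f: "f = (x0, y0, x1, x2, x3, x4)" by (cases f)
  note D = pair_sum_torus[OF _ d]
  have n_alpha: "n (\<mu> + - alpha i) = n \<mu> - of_int (cartan i N1)" for \<mu>
    by (cases i; cases \<mu>) (simp_all add: n_def pairing_def algebra_simps)
  show ?thesis
  proof (cases i)
    case N1
    have ts: "t0 (srefl N1 \<nu>) = t0 \<nu>" "t1 (srefl N1 \<nu>) = t2 \<nu>" "t2 (srefl N1 \<nu>) = t1 \<nu>"
      "t3 (srefl N1 \<nu>) = t4 \<nu>" "t4 (srefl N1 \<nu>) = t3 \<nu>"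
      unfolding t_defs using wt_srefl[OF p0, THEN fun_cong, of \<nu>] by (simp_all only: o_apply)
    have ns: "n (srefl N1 \<nu>) = - n \<nu>" by (cases \<nu>) (simp add: n_def pairing_def)
    have n_shift: "n (\<mu> + - alpha N1) = n \<mu> - 2" for \<mu>
      using n_alpha[unfolded N1] by simp
    have t0_shift: "t0 (\<mu> + - alpha N1) = t0 \<mu>" for \<mu>
      by (cases \<mu>) (simp add: t_defs wt0_def torus_pt_def)
    have "pair_sum (\<lambda>\<mu>. t0 \<mu> * n \<mu> - t0 (\<mu> + - alpha N1) * n (\<mu> + - alpha N1)) d
      = 2 * pair_sum t0 d"
      unfolding t0_shift n_shift by (simp add: pair_sum_def sum_distrib_left algebra_simps)
    then have e0: "pair_sum t0 d = t0 \<nu> * n \<nu>"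
      using pair_sum_difference[OF d[unfolded N1], of "\<lambda>\<mu>. t0 \<mu> * n \<mu>"] unfolding ts ns by simp
    \<comment> \<open>Since \<open>wt0\<close> is one on \<open>\<alpha>\<^sub>1\<close>, the difference operator lowers the degree in \<open>n\<close>, and a quadratic
      function is needed to reach the derivative: this one has the difference \<open>n\<close>.\<close>
    have "pair_sum (\<lambda>\<mu>. t0 \<mu> * (n \<mu> ^ 2 / 4 + n \<mu> / 2)
        - t0 (\<mu> + - alpha N1) * (n (\<mu> + - alpha N1) ^ 2 / 4 + n (\<mu> + - alpha N1) / 2)) d = e"
    proof -
      have "t0 \<mu> * (n \<mu> ^ 2 / 4 + n \<mu> / 2) - t0 \<mu> * ((n \<mu> - 2) ^ 2 / 4 + (n \<mu> - 2) / 2) = t0 \<mu> * n \<mu>" for \<mu>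
        by (simp add: field_simps power2_eq_square)
      then show ?thesis unfolding t0_shift n_shift e_def by simp
    qed
    then have e1: "e = t0 \<nu> * n \<nu>"
      using pair_sum_difference[OF d[unfolded N1], of "\<lambda>\<mu>. t0 \<mu> * (n \<mu> ^ 2 / 4 + n \<mu> / 2)"]
      unfolding ts ns by (simp add: algebra_simps)
    have d1: "pair_sum t1 d * (1 - r * r) = t1 \<nu> - t2 \<nu>"
      using D[OF tor(2)] unfolding N1 o_apply ts by (simp only: t_defs wt_alpha ip)
    have d2: "pair_sum t2 d * (1 - q * q) = t2 \<nu> - t1 \<nu>"
      using D[OF tor(3)] unfolding N1 o_apply ts by (simp only: t_defs wt_alpha iip)
    have d3: "pair_sum t3 d * (1 - r * r) = t3 \<nu> - t4 \<nu>"
      using D[OF tor(4)] unfolding N1 o_apply ts by (simp only: t_defs wt_alpha ip)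
    have "t4 (alpha N1) = inverse ?p" by (simp add: t_defs wt4_def torus_pt_def)
    then have d4: "pair_sum t4 d * (1 - q * q) = t4 \<nu> - t3 \<nu>"
      using D[OF tor(5)] unfolding N1 o_apply ts by (simp only: iip)
    have solve: "t1 \<nu> = t2 \<nu> + pair_sum t1 d * (1 - r * r)" "t2 \<nu> = t1 \<nu> + pair_sum t2 d * (1 - q * q)"
      "t3 \<nu> = t4 \<nu> + pair_sum t3 d * (1 - r * r)" "t4 \<nu> = t3 \<nu> + pair_sum t4 d * (1 - q * q)"
      unfolding d1 d2 d3 d4 by simp_all
    show ?thesis
      unfolding f N1 mG.simps mX.simps mT.simps rho_flift mscale.simps plus_prod_def fst_conv snd_conv
        t_defs[symmetric] n_def[symmetric] r_def[symmetric] e_def[symmetric] ts ns e0 e1 prod.inject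
      apply (intro conjI)
      subgoal by (simp add: norm)
      subgoal by (simp add: norm)
      subgoal by (subst solve(1)) (simp add: norm)
      subgoal by (subst (1 2) solve(2)) (simp add: norm)
      subgoal by (subst solve(3)) (simp add: norm)
      subgoal by (subst (1 2) solve(4)) (simp add: norm)
      done
  next
    case N2
    have ts: "t0 (srefl N2 \<nu>) = t1 \<nu>" "t1 (srefl N2 \<nu>) = t0 \<nu>" "t2 (srefl N2 \<nu>) = t3 \<nu>"
      "t3 (srefl N2 \<nu>) = t2 \<nu>" "t4 (srefl N2 \<nu>) = wt5 ?p \<nu>"
      unfolding t_defs using wt_srefl[OF p0, THEN fun_cong, of \<nu>] by (simp_all only: o_apply)
    have t0_shift: "t0 (\<mu> + - alpha N2) = t0 \<mu> * (r * r)" for \<mu>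
      using torusD(2)[OF tor(1), of \<mu> "- alpha N2"] torusD(4)[OF tor(1), of "alpha N2"]
      by (simp only: t_defs wt_alpha ip)
    have n_shift: "n (\<mu> + - alpha N2) = n \<mu> + 3" for \<mu>
      using n_alpha[unfolded N2] by simp
    have d0: "pair_sum t0 d * (1 - r * r) = t0 \<nu> - t1 \<nu>"
      using D[OF tor(1)] unfolding N2 o_apply ts by (simp only: t_defs wt_alpha ip)
    have "pair_sum (\<lambda>\<mu>. t0 \<mu> * n \<mu> - t0 (\<mu> + - alpha N2) * n (\<mu> + - alpha N2)) d
      = e * (1 - r * r) - 3 * (r * r) * pair_sum t0 d"
      unfolding t0_shift n_shift e_def
      by (simp add: pair_sum_def sum_distrib_left sum_distrib_right sum_subtractf[symmetric] algebra_simps)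
    then have e: "e * (1 - r * r) - 3 * (r * r) * pair_sum t0 d = t0 \<nu> * n \<nu> - t1 \<nu> * n (srefl N2 \<nu>)"
      using pair_sum_difference[OF d[unfolded N2], of "\<lambda>\<mu>. t0 \<mu> * n \<mu>"] unfolding ts by simp
    have d1: "pair_sum t1 d * (1 - q * q) = t1 \<nu> - t0 \<nu>"
      using D[OF tor(2)] unfolding N2 o_apply ts by (simp only: t_defs wt_alpha iip)
    have "inverse (?p ^ 2) = r * r * (r * r)" by (simp add: r_def power2_eq_square)
    then have d2: "pair_sum t2 d * (1 - r * r * (r * r)) = t2 \<nu> - t3 \<nu>"
      using D[OF tor(3)] unfolding N2 o_apply ts by (simp only: t_defs wt_alpha)
    have "inverse (t3 (alpha N2)) = q * q * (q * q)"
      by (simp add: t_defs wt3_def torus_pt_def power2_eq_square)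
    then have d3: "pair_sum t3 d * (1 - q * q * (q * q)) = t3 \<nu> - t2 \<nu>"
      using D[OF tor(4)] unfolding N2 o_apply ts by (simp only:)
    have d4: "pair_sum t4 d * (1 - r * r) = t4 \<nu> - wt5 ?p \<nu>"
      using D[OF tor(5)] unfolding N2 o_apply ts by (simp only: t_defs wt_alpha ip)
    have solve: "t0 \<nu> = t1 \<nu> + pair_sum t0 d * (1 - r * r)" "t1 \<nu> = t0 \<nu> + pair_sum t1 d * (1 - q * q)"
      "t2 \<nu> = t3 \<nu> + pair_sum t2 d * (1 - r * r * (r * r))"
      "t3 \<nu> = t2 \<nu> + pair_sum t3 d * (1 - q * q * (q * q))"
      "t4 \<nu> = wt5 ?p \<nu> + pair_sum t4 d * (1 - r * r)"
      "t0 \<nu> * n \<nu> = t1 \<nu> * n (srefl N2 \<nu>) + (e * (1 - r * r) - 3 * (r * r) * pair_sum t0 d)"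
      unfolding d0 d1 d2 d3 d4 e by simp_all
    show ?thesis
      unfolding f N2 mG.simps mX.simps mT.simps rho_flift mscale.simps plus_prod_def fst_conv snd_conv
        t_defs[symmetric] n_def[symmetric] r_def[symmetric] e_def[symmetric] a_def[symmetric] ts prod.inject
      apply (intro conjI)
      subgoal
      proof -
        have "t0 \<nu> * (q * x0 + 3 * y0 - 3 * (q + r) * x1 + (q - r) * n \<nu> * (q * y0))
          = t0 \<nu> * (q * x0 + 3 * y0) - t0 \<nu> * (3 * (q + r) * x1) + (q - r) * (t0 \<nu> * n \<nu>) * (q * y0)"
          by (simp add: algebra_simps)
        also have "\<dots> = (t1 \<nu> + pair_sum t0 d * (1 - r * r)) * (q * x0 + 3 * y0) - t0 \<nu> * (3 * (q + r) * x1)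
          + (q - r) * (t1 \<nu> * n (srefl N2 \<nu>) + (e * (1 - r * r) - 3 * (r * r) * pair_sum t0 d)) * (q * y0)"
          by (simp only: solve(6) flip: solve(1))
        finally show ?thesis by (simp add: norm)
      qed
      subgoal by (subst solve(1)) (simp add: norm)
      subgoal by (subst (1 2) solve(2)) (simp add: norm)
      subgoal by (subst (1 2) solve(3)) (simp add: norm)
      subgoal by (subst (1 2) solve(4)) (simp add: norm)
      subgoal by (subst solve(5)) (simp add: norm)
      done
  qed
qed

lemma hecke_operators_model:
  assumes q: "q \<noteq> 0" "q\<^sup>2 \<noteq> 1" "q\<^sup>2 \<noteq> -1"
  shows "hecke_operators mscale (mG q) q"
proof (intro hecke_operators.intro gen_operators_mG hecke_operators_axioms.intro)
  fix f x assume f: "f \<in> hecke_relations q"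
  have p0: "q\<^sup>2 \<noteq> 0" using q by simp
  have q1: "q\<^sup>2 + 1 \<noteq> 0" using q(3) by (metis add_eq_0_iff2)
  have tor: "t \<in> torus" if "t \<in> wt_orbit (q\<^sup>2)" for t using wt_torus[OF p0 that] .
  note rho = model.rho_diff model.rho_plus model.rho_mult model.rho_fgen model.rho_fscal model.rho_1
  have X0: "mG q (GX 0) v = v" for v
    using tor[THEN torusD(3)] by (cases v) (simp add: wt_orbit_def pairing_def)
  have XX: "mG q (GX \<nu>) (mG q (GX \<mu>) v) = mG q (GX (\<nu> + \<mu>)) v" for \<nu> \<mu> v
  proof -
    have add: "t (\<nu> + \<mu>) = t \<nu> * t \<mu>" if "t \<in> wt_orbit (q\<^sup>2)" for t
      using torusD(2)[OF tor[OF that]] .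
    have "pairing (\<nu> + \<mu>) N1 = pairing \<nu> N1 + pairing \<mu> N1" by (simp add: pairing_def algebra_simps)
    then show ?thesis
      using add by (cases v) (simp add: wt_orbit_def algebra_simps)
  qed
  have TT: "mG q (GT i) (mG q (GT i) v) = mscale (q - inverse q) (mG q (GT i) v) + v" for i v
    using mT_square[of q "inverse q" _ i v] q(1) by simp
  have braid: "q ^ 3 / (q\<^sup>2 + 1) * (q + inverse q) = q * q"
  proof -
    have "q + inverse q = (q\<^sup>2 + 1) / q"
      using q(1) by (simp add: divide_inverse distrib_right power2_eq_square)
    then show ?thesis using q1 q(1) by (simp add: power3_eq_cube)
  qed
  from f show "model.rho q f x = 0"
    unfolding hecke_relations_def
  proof (elim UnE)
    assume "f \<in> {fX 0 - 1}"
    then show ?thesis by (simp add: rho X0 del: mG.simps)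
  next
    assume "f \<in> {fX \<nu> * fX \<mu> - fX (\<nu> + \<mu>) | \<nu> \<mu>. True}"
    then show ?thesis by (auto simp: rho XX simp del: mG.simps)
  next
    assume "f \<in> {fT i * fT i - (fscal (q - inverse q) * fT i + 1) | i. True}"
    then show ?thesis by (auto simp: rho TT simp del: mG.simps)
  next
    assume "f \<in> {fT N1 * fT N2 * fT N1 * fT N2 * fT N1 * fT N2 - fT N2 * fT N1 * fT N2 * fT N1 * fT N2 * fT N1}"
    then show ?thesis using mT_braid[OF _ braid, of x] q(1) by (simp add: rho)
  next
    assume "f \<in> {fX \<nu> * fT i - (fT i * fX (srefl i \<nu>) + fscal (q - inverse q) * flift d) | \<nu> i d.
       d * (1 - gX (- alpha i)) = gX \<nu> - gX (srefl i \<nu>)}"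
    then obtain \<nu> i d where d: "d * (1 - gX (- alpha i)) = gX \<nu> - gX (srefl i \<nu>)"
      and f: "f = fX \<nu> * fT i - (fT i * fX (srefl i \<nu>) + fscal (q - inverse q) * flift d)" by blast
    show ?thesis unfolding f using model_bernstein[OF q d, of x] by (simp only: rho) simp
  qed
qed


section \<open>Composition factors\<close>

abbreviation six_module :: "complex \<Rightarrow> (free_alg set, vec6) module" where
  "six_module q \<equiv> model.op_module q"

text \<open>
  The intertwiners, written as elements of the free algebra, lead from the generator to the basis
  vectors of weights \<open>wt2\<close> and \<open>wt4\<close>. On the two-dimensional block the first of them has the form
  \<open>T\<^sub>2 - q\<close> corrected by a nilpotent term, which accounts for the number three.
\<close>

lemma six_generators:
  "model.rho q ((fT N1 - fscal q) * (fT N2 * fT N1 - fscal q * fT N1 - fscal 3)) (1, 0, 0, 0, 0, 0)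
    = (0, 0, 0, 1, 0, 0)"
  "model.rho q ((fT N1 - fscal q) * (fT N2 - fscal (q ^ 3 / (q ^ 2 + 1)))) (0, 0, 0, 1, 0, 0)
    = (0, 0, 0, 0, 0, 1)"
  by (simp_all add: model.rho_mult model.rho_diff model.rho_fgen model.rho_fscal zero_prod_def)

context
  fixes q :: complex
  assumes q: "q \<noteq> 0" "q\<^sup>2 \<noteq> 1" "q\<^sup>2 \<noteq> -1"
begin

interpretation six: hecke_operators mscale "mG q" q
  by (rule hecke_operators_model[OF q])

lemma mixed_line_annihilator:
  assumes L: "hecke_module q L" and m: "hecke_module.mixed_line q L q m"
    and r: "r \<in> carrier (hecke q)" "r \<odot>\<^bsub>six_module q\<^esub> (0, 0, 0, 0, 0, 1) = 0"
  shows "r \<odot>\<^bsub>L\<^esub> m = \<zero>\<^bsub>L\<^esub>"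
proof -
  interpret L: hecke_module q L by (rule L)
  have m: "m \<in> L.eig (wt4 (q\<^sup>2))" "L.opT N1 m = L.sc (- inverse q) m" "L.opT N2 m = L.sc q m"
    using m unfolding L.mixed_line_def by blast+
  have mc: "m \<in> carrier L" using L.eigD(1)[OF m(1)] .
  define P where "P x y \<longleftrightarrow> (\<exists>c. x = (0, 0, 0, 0, 0, c) \<and> y = L.sc c m)" for x :: vec6 and y
  have PI: "P (0, 0, 0, 0, 0, c) (L.sc c m)" for c by (auto simp: P_def)
  have "P (r \<odot>\<^bsub>six_module q\<^esub> (0, 0, 0, 0, 0, 1)) (r \<odot>\<^bsub>L\<^esub> m)"
  proof (rule hecke_rel_induct[where P = P, OF six.op_module_hecke_module L _ _ _ _ r(1)])
    fix x y assume "P x y"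
    then obtain c where xy: "x = (0, 0, 0, 0, 0, c)" "y = L.sc c m" by (auto simp: P_def)
    show "x \<in> carrier (six_module q) \<and> y \<in> carrier L"
      using xy mc by simp
    show "P (hecke_module.act q (six_module q) (fscal k) x) (L.sc k y)" for k
      using PI[of "k * c"] xy mc by (simp add: six.op_module_act model.rho_fscal)
    show "P (hecke_module.act q (six_module q) (fgen g) x) (L.act (fgen g) y)" for g
    proof (cases g)
      case (GT i)
      then show ?thesis
        using PI[of "- inverse q * c"] PI[of "q * c"] xy mc m
        by (cases i) (simp_all add: six.op_module_act model.rho_fgen mult.commute)
    next
      case (GX \<nu>)
      then show ?thesis
        using PI[of "wt4 (q\<^sup>2) \<nu> * c"] xy mc L.eigD(2)[OF m(1), of \<nu>]
        by (simp add: six.op_module_act model.rho_fgen mult.commute)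
    qed
    fix x' y' assume "P x' y'"
    then obtain c' where xy': "x' = (0, 0, 0, 0, 0, c')" "y' = L.sc c' m" by (auto simp: P_def)
    show "P (x \<oplus>\<^bsub>six_module q\<^esub> x') (y \<oplus>\<^bsub>L\<^esub> y')"
      using PI[of "c + c'"] xy xy' mc by (simp add: L.sc_add)
  qed (use PI[of 1] mc in simp)
  then show ?thesis
    using r(2) mc by (auto simp: P_def zero_prod_def)
qed

lemma middle_vector_annihilator:
  assumes L: "hecke_module q L" and m: "hecke_module.middle_vector q L q m"
    and r: "r \<in> carrier (hecke q)" "r \<odot>\<^bsub>six_module q\<^esub> (0, 0, 0, 1, 0, 0) = 0"
  shows "r \<odot>\<^bsub>L\<^esub> m = \<zero>\<^bsub>L\<^esub>"
proof -
  interpret L: hecke_module q L by (rule L)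
  let ?a = "q ^ 3 / (q\<^sup>2 + 1)"
  define n where "n = L.tau N2 ?a m"
  have m: "m \<in> L.eig (wt2 (q\<^sup>2))" "L.opT N1 m = L.sc (- inverse q) m"
    and n: "n \<in> L.eig (wt3 (q\<^sup>2))" "L.opT N1 n = L.sc q n"
    using m unfolding L.middle_vector_def L.middle_const_def n_def by blast+
  have mc: "m \<in> carrier L" and nc: "n \<in> carrier L" using L.eigD(1) m(1) n(1) by blast+
  have T2: "L.opT N2 m = L.sc ?a m \<oplus>\<^bsub>L\<^esub> n"
    "L.opT N2 n = L.sc (q - inverse q - ?a) n \<oplus>\<^bsub>L\<^esub> L.sc (1 + ?a * (q - inverse q - ?a)) m"
    using L.T_eq_tau[OF mc] L.T_tau[OF mc] by (simp_all add: n_def)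
  define P where "P x y \<longleftrightarrow> (\<exists>b c d. x = (0, 0, 0, b, c, d) \<and> y = L.sc b m \<oplus>\<^bsub>L\<^esub> L.sc c n)"
    for x :: vec6 and y
  have PI: "P (0, 0, 0, b, c, d) (L.sc b m \<oplus>\<^bsub>L\<^esub> L.sc c n)" for b c d by (auto simp: P_def)
  have "P (r \<odot>\<^bsub>six_module q\<^esub> (0, 0, 0, 1, 0, 0)) (r \<odot>\<^bsub>L\<^esub> m)"
  proof (rule hecke_rel_induct[where P = P, OF six.op_module_hecke_module L _ _ _ _ r(1)])
    fix x y assume "P x y"
    then obtain b c d where xy: "x = (0, 0, 0, b, c, d)" "y = L.sc b m \<oplus>\<^bsub>L\<^esub> L.sc c n"
      by (auto simp: P_def)
    show "x \<in> carrier (six_module q) \<and> y \<in> carrier L"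
      using xy mc nc by simp
    show "P (hecke_module.act q (six_module q) (fscal k) x) (L.sc k y)" for k
      using PI[of "k * b" "k * c" "k * d"] xy mc nc by (simp add: six.op_module_act model.rho_fscal)
    show "P (hecke_module.act q (six_module q) (fgen g) x) (L.act (fgen g) y)" for g
    proof (cases g)
      case (GT i)
      show ?thesis
      proof (cases i)
        case N1
        then show ?thesis
          using PI[of "- inverse q * b" "q * c" "c - inverse q * d"] xy mc nc m n GT
          by (simp add: six.op_module_act model.rho_fgen mult.commute)
      next
        case N2
        let ?e = "q - inverse q - ?a"
        have "L.opT N2 y = L.sc b (L.sc ?a m \<oplus>\<^bsub>L\<^esub> n) \<oplus>\<^bsub>L\<^esub> L.sc c (L.sc ?e n \<oplus>\<^bsub>L\<^esub> L.sc (1 + ?a * ?e) m)"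
          unfolding xy using mc nc by (simp add: T2)
        also have "\<dots> = L.sc (b * ?a + c * (1 + ?a * ?e)) m \<oplus>\<^bsub>L\<^esub> L.sc (b + c * ?e) n"
        proof -
          have "L.sc b (L.sc a m \<oplus>\<^bsub>L\<^esub> n) \<oplus>\<^bsub>L\<^esub> L.sc c (L.sc e n \<oplus>\<^bsub>L\<^esub> L.sc k m)
            = L.sc (b * a + c * k) m \<oplus>\<^bsub>L\<^esub> L.sc (b + c * e) n" for a e k
            using mc nc by (simp add: L.sc_add L.M.add.m_ac)
          then show ?thesis .
        qed
        finally show ?thesis
          using PI[of "b * ?a + c * (1 + ?a * ?e)" "b + c * ?e" "q * d"] xy GT N2
          by (simp add: six.op_module_act model.rho_fgen mult.commute)
      qed
    next
      case (GX \<nu>)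
      then show ?thesis
        using PI[of "wt2 (q\<^sup>2) \<nu> * b" "wt3 (q\<^sup>2) \<nu> * c" "wt4 (q\<^sup>2) \<nu> * d"] xy mc nc
          L.eigD(2)[OF m(1), of \<nu>] L.eigD(2)[OF n(1), of \<nu>]
        by (simp add: six.op_module_act model.rho_fgen mult.commute)
    qed
    fix x' y' assume "P x' y'"
    then obtain b' c' d' where xy': "x' = (0, 0, 0, b', c', d')" "y' = L.sc b' m \<oplus>\<^bsub>L\<^esub> L.sc c' n"
      by (auto simp: P_def)
    show "P (x \<oplus>\<^bsub>six_module q\<^esub> x') (y \<oplus>\<^bsub>L\<^esub> y')"
      using PI[of "b + b'" "c + c'" "d + d'"] xy xy' mc nc by (simp add: L.sc_add L.M.add.m_ac)
  qed (use PI[of 1 0 0] mc nc in simp)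
  then show ?thesis
    using r(2) mc nc by (auto simp: P_def zero_prod_def)
qed

lemma induced_generator_flag:
  fixes V :: "(free_alg set, 'a) module" and v :: 'a
  assumes V: "one_dim_module q N2 V v q (torus_pt 1 (q\<^sup>2))"
  defines "M \<equiv> induced_module (hecke q) (parabolic q N2) V"
    and "x \<equiv> induced_generator (hecke q) (parabolic q N2) V v"
  shows "hecke_module q M" "x \<in> hecke_module.eig q M (wt0 (q\<^sup>2))"
    "hecke_module.act q M (fT N2) x = hecke_module.act q M (fscal q) x"
    "\<And>y. y \<in> carrier M \<Longrightarrow> \<exists>r\<in>carrier (hecke q). y = r \<odot>\<^bsub>M\<^esub> x"
proof -
  note ind = induced_from_line[OF V, folded M_def x_def]
  show M: "hecke_module q M" unfolding hecke_module_def by (rule ind(1))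
  show "x \<in> hecke_module.eig q M (wt0 (q\<^sup>2))"
    unfolding hecke_module.eig_def[OF M] hecke_module.act_def[OF M] wt0_def
      hX_def[symmetric] hscal_def[symmetric] using ind(2,5) by blast
  show "hecke_module.act q M (fT N2) x = hecke_module.act q M (fscal q) x"
    unfolding hecke_module.act_def[OF M] hT_def[symmetric] hscal_def[symmetric] by (rule ind(4))
  show "\<And>y. y \<in> carrier M \<Longrightarrow> \<exists>r\<in>carrier (hecke q). y = r \<odot>\<^bsub>M\<^esub> x"
    by (rule ind(3))
qed

lemma cyclic_flag:
  assumes M: "hecke_module q M" and x: "x \<in> hecke_module.eig q M (wt0 (q\<^sup>2))"
    and Tx: "hecke_module.act q M (fT N2) x = hecke_module.act q M (fscal q) x"
    and gen: "\<And>y. y \<in> carrier M \<Longrightarrow> \<exists>r\<in>carrier (hecke q). y = r \<odot>\<^bsub>M\<^esub> x"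
  shows "\<exists>S\<subseteq>wt_orbit (q\<^sup>2). hecke_module.flag q M (carrier M) S"
proof -
  interpret M: hecke_module q M by (rule M)
  have p0: "q\<^sup>2 \<noteq> 0" using q by simp
  show ?thesis
    using M.induced_flag[OF x Tx gen] unfolding wt_srefl[OF p0] wt_orbit_def
    by (intro exI[of _ "{wt0 (q\<^sup>2), wt0 (q\<^sup>2), wt1 (q\<^sup>2), wt2 (q\<^sup>2), wt3 (q\<^sup>2), wt4 (q\<^sup>2)}"]) simp
qed

text \<open>
  In each of the three cases a vector \<open>m\<close> of \<open>L\<close> is compared with a vector of the induced module: with
  the generator for the weight \<open>wt0\<close>, and otherwise with a preimage of the fourth or the last basis
  vector of the six-dimensional module. An element that kills the preimage also kills the basis
  vector, hence \<open>m\<close>.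
\<close>

theorem irreducible_is_factor:
  fixes V :: "(free_alg set, 'a) module" and v :: 'a and L :: "(free_alg set, 'c) module"
  assumes V: "one_dim_module q N2 V v q (torus_pt 1 (q\<^sup>2))"
    and irr: "irreducible_module (hecke q) L"
    and m: "(\<exists>m\<in>hecke_module.eig q L (wt0 (q\<^sup>2)). m \<noteq> \<zero>\<^bsub>L\<^esub>) \<or>
      (\<exists>m. hecke_module.mixed_line q L q m) \<or> (\<exists>m. hecke_module.middle_vector q L q m)"
  shows "is_composition_factor (hecke q) (induced_module (hecke q) (parabolic q N2) V) L"
proof -
  define M where "M = induced_module (hecke q) (parabolic q N2) V"
  define x where "x = induced_generator (hecke q) (parabolic q N2) V v"
  note gen = induced_generator_flag[OF V, folded M_def x_def]
  interpret M: hecke_module q M by (rule gen(1))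
  interpret L: hecke_module q L using irreducible_moduleD[OF irr] by (simp add: hecke_module_def)
  have xc: "x \<in> carrier M" using M.eigD(1)[OF gen(2)] .
  obtain S where S: "M.flag (carrier M) S" using cyclic_flag[OF gen] by blast
  obtain len :: "_ \<Rightarrow> nat" where len: "\<forall>K J. M.subsp K \<longrightarrow> M.subsp J \<longrightarrow> K \<subseteq> J \<longrightarrow>
    len K \<le> len J \<and> (len K = len J \<longrightarrow> J \<inter> carrier M \<subseteq> K)"
    using M.flag_length_function[OF S] ..
  have "\<exists>Ks. composition_series (hecke q) M Ks"
  proof (rule composition_series_exists[OF M.left_module_axioms, of len])
    fix K J assume K: "submodule K (hecke q) M" and J: "submodule J (hecke q) M" and KJ: "K \<subset> J"
    have "M.subsp K" "M.subsp J" using M.stableD(1) M.submodule_stable K J by blast+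
    with len KJ have "len K \<le> len J \<and> (len K = len J \<longrightarrow> J \<inter> carrier M \<subseteq> K)" by blast
    moreover have "J \<subseteq> carrier M" using M.submoduleD(1)[OF J] .
    ultimately show "len K < len J" using KJ by fastforce
  qed
  then obtain Ks where Ks: "composition_series (hecke q) M Ks" ..
  note factor = composition_factorI[OF M.left_module_axioms Ks irr]
  have e0: "hT q N2 \<odot>\<^bsub>six_module q\<^esub> (1, 0, 0, 0, 0, 0) = hscal q q \<odot>\<^bsub>six_module q\<^esub> (1, 0, 0, 0, 0, 0)"
    "hX q \<nu> \<odot>\<^bsub>six_module q\<^esub> (1, 0, 0, 0, 0, 0) = hscal q (torus_pt 1 (q\<^sup>2) \<nu>) \<odot>\<^bsub>six_module q\<^esub> (1, 0, 0, 0, 0, 0)"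
    for \<nu>
    by (simp_all add: hT_def hX_def hscal_def six.op_module_hclass model.rho_fgen model.rho_fscal wt0_def)
  have to_six: "r \<odot>\<^bsub>six_module q\<^esub> (1, 0, 0, 0, 0, 0) = 0"
    if "r \<in> carrier (hecke q)" "r \<odot>\<^bsub>M\<^esub> x = \<zero>\<^bsub>M\<^esub>" for r
    using induced_from_line(6)[OF V six.op_module_left_module _ e0, folded M_def x_def] that by simp
  have lift: "r \<odot>\<^bsub>six_module q\<^esub> model.rho q f (1, 0, 0, 0, 0, 0) = 0"
    if r: "r \<in> carrier (hecke q)" "r \<odot>\<^bsub>M\<^esub> (hclass q f \<odot>\<^bsub>M\<^esub> x) = \<zero>\<^bsub>M\<^esub>" for r f
  proof -
    obtain h where h: "r = hclass q h" using r(1) by (auto simp: carrier_hecke)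
    have "hclass q (h * f) \<odot>\<^bsub>M\<^esub> x = \<zero>\<^bsub>M\<^esub>"
      using r(2) xc unfolding h hclass_mult by (simp add: M.smult_assoc)
    then have "hclass q (h * f) \<odot>\<^bsub>six_module q\<^esub> (1, 0, 0, 0, 0, 0) = 0"
      using to_six by simp
    then show ?thesis
      unfolding h six.op_module_hclass model.rho_mult .
  qed
  from m consider (0) m where "m \<in> L.eig (wt0 (q\<^sup>2))" "m \<noteq> \<zero>\<^bsub>L\<^esub>"
    | (1) m where "L.mixed_line q m" | (2) m where "L.middle_vector q m" by blast
  then have "is_composition_factor (hecke q) M L"
  proof cases
    case 0
    have mc: "m \<in> carrier L" using L.eigD(1)[OF 0(1)] .
    have "L.opT N2 m = L.sc q m"
      by (rule L.wt0_eig_T2[OF q irr 0])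
    then have Tm: "hT q N2 \<odot>\<^bsub>L\<^esub> m = hscal q q \<odot>\<^bsub>L\<^esub> m"
      by (simp add: L.act_def hT_def hscal_def)
    have Xm: "hX q \<nu> \<odot>\<^bsub>L\<^esub> m = hscal q (torus_pt 1 (q\<^sup>2) \<nu>) \<odot>\<^bsub>L\<^esub> m" for \<nu>
      using L.eigD(2)[OF 0(1), of \<nu>] by (simp add: L.act_def hX_def hscal_def wt0_def)
    show ?thesis
    proof (rule factor[OF xc mc 0(2)])
      show "r \<odot>\<^bsub>L\<^esub> m = \<zero>\<^bsub>L\<^esub>" if "r \<in> carrier (hecke q)" "r \<odot>\<^bsub>M\<^esub> x = \<zero>\<^bsub>M\<^esub>" for r
        by (rule induced_from_line(6)[OF V L.left_module_axioms mc Tm Xm, folded M_def x_def, OF that])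
    qed
  next
    case 1
    let ?f = "(fT N1 - fscal q) * (fT N2 - fscal (q ^ 3 / (q ^ 2 + 1)))
      * ((fT N1 - fscal q) * (fT N2 * fT N1 - fscal q * fT N1 - fscal 3))"
    have m: "m \<noteq> \<zero>\<^bsub>L\<^esub>" "m \<in> carrier L"
      using 1 L.eigD(1) unfolding L.mixed_line_def by blast+
    have f: "model.rho q ?f (1, 0, 0, 0, 0, 0) = (0, 0, 0, 0, 0, 1)"
      unfolding model.rho_mult[of q _ "_ * _ * _"] by (simp only: model.rho_mult[of q "_ * _" "_ * _"] six_generators)
    show ?thesis
    proof (rule factor[OF _ m(2,1)])
      show "hclass q ?f \<odot>\<^bsub>M\<^esub> x \<in> carrier M" using xc by (simp add: M.smult_closed)
      show "r \<odot>\<^bsub>L\<^esub> m = \<zero>\<^bsub>L\<^esub>"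
        if "r \<in> carrier (hecke q)" "r \<odot>\<^bsub>M\<^esub> (hclass q ?f \<odot>\<^bsub>M\<^esub> x) = \<zero>\<^bsub>M\<^esub>" for r
        using mixed_line_annihilator[OF L.hecke_module_axioms 1 that(1)] lift[OF that] unfolding f by blast
    qed
  next
    case 2
    let ?f = "(fT N1 - fscal q) * (fT N2 * fT N1 - fscal q * fT N1 - fscal 3)"
    have m: "m \<noteq> \<zero>\<^bsub>L\<^esub>" "m \<in> carrier L"
      using 2 unfolding L.middle_vector_def by blast+
    show ?thesis
    proof (rule factor[OF _ m(2,1)])
      show "hclass q ?f \<odot>\<^bsub>M\<^esub> x \<in> carrier M" using xc by (simp add: M.smult_closed)
      show "r \<odot>\<^bsub>L\<^esub> m = \<zero>\<^bsub>L\<^esub>"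
        if "r \<in> carrier (hecke q)" "r \<odot>\<^bsub>M\<^esub> (hclass q ?f \<odot>\<^bsub>M\<^esub> x) = \<zero>\<^bsub>M\<^esub>" for r
        using middle_vector_annihilator[OF L.hecke_module_axioms 2 that(1)] lift[OF that]
        unfolding six_generators by blast
    qed
  qed
  then show ?thesis unfolding M_def .
qed

text \<open>
  A composition factor is a submodule of a quotient of the induced module. The quotient is again
  generated by an eigenvector of weight \<open>wt0\<close> on which \<open>T\<^sub>2\<close> acts by \<open>q\<close>, and its flag bounds the
  weights and provides an eigenvector.
\<close>

theorem factor_weights:
  fixes V :: "(free_alg set, 'a) module" and v :: 'a and L :: "(free_alg set, 'c) module"
  assumes V: "one_dim_module q N2 V v q (torus_pt 1 (q\<^sup>2))"
    and L: "left_module (hecke q) L"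
    and factor: "is_composition_factor (hecke q) (induced_module (hecke q) (parabolic q N2) V) L"
  shows "irreducible_module (hecke q) L" "weights q L \<noteq> {}" "weights q L \<subseteq> wt_orbit (q\<^sup>2)"
proof -
  define M where "M = induced_module (hecke q) (parabolic q N2) V"
  define x where "x = induced_generator (hecke q) (parabolic q N2) V v"
  note gen = induced_generator_flag[OF V, folded M_def x_def]
  interpret M: hecke_module q M by (rule gen(1))
  interpret L: hecke_module q L using L by (simp add: hecke_module_def)
  from factor obtain Ks i where Ks: "composition_series (hecke q) M Ks" "Suc i < length Ks"
    and iso: "module_isomorphic (hecke q) (quot_module (M\<lparr>carrier := Ks ! Suc i\<rparr>) (Ks ! i)) L"
    unfolding is_composition_factor_def M_def by blast
  define J where "J = Ks ! Suc i"
  define K where "K = Ks ! i"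
  have "J \<in> set Ks" "K \<in> set Ks" using Ks(2) by (simp_all add: J_def K_def)
  with Ks have J: "submodule J (hecke q) M" and K: "submodule K (hecke q) M" and KJ: "K \<subseteq> J"
    and irrJ: "irreducible_module (hecke q) (quot_module (M\<lparr>carrier := J\<rparr>) K)"
    unfolding composition_series_def J_def K_def by simp_all
  show irr: "irreducible_module (hecke q) L"
    by (rule irreducible_module_isomorphic[OF iso[folded J_def K_def] irrJ L])
  have top: "submodule (carrier M) (hecke q) M"
    by (rule M.submoduleI) (auto simp: M.smult_closed)
  have KM: "K \<subseteq> carrier M" using M.submoduleD(1)[OF K] .
  have carM: "M\<lparr>carrier := carrier M\<rparr> = M" by simp
  interpret Q: stable_quotient "hecke q" M K
    using subquotient[OF M.left_module_axioms top K KM] unfolding carM .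
  interpret QM: hecke_module q Q.Q
    using subquotient_left_module[OF M.left_module_axioms top K KM] unfolding carM
    by (rule hecke_module.intro)
  define N where "N = quot_module (M\<lparr>carrier := J\<rparr>) K"
  interpret N: hecke_module q N
    using irreducible_moduleD[OF irrJ] by (simp add: hecke_module_def N_def)
  have ops: "r \<odot>\<^bsub>N\<^esub> y = r \<odot>\<^bsub>Q.Q\<^esub> y" "y \<oplus>\<^bsub>N\<^esub> z = y \<oplus>\<^bsub>Q.Q\<^esub> z" "\<zero>\<^bsub>N\<^esub> = \<zero>\<^bsub>Q.Q\<^esub>" for r y z
    by (simp_all add: N_def quot_module_def a_r_coset_def r_coset_def set_add_def set_mult_def)
  have "carrier N \<subseteq> carrier Q.Q"
    using M.submoduleD(1)[OF J] by (auto simp: N_def quot_module_def A_RCOSETS_def' a_r_coset_def r_coset_def)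
  have act: "N.act = QM.act" by (simp add: N.act_def[abs_def] QM.act_def[abs_def] ops)
  have xc: "x \<in> carrier M" using M.eigD(1)[OF gen(2)] .
  let ?x = "Q.cls x"
  have act_cls: "QM.act f (Q.cls y) = Q.cls (M.act f y)" if "y \<in> carrier M" for f y
    using Q.smult_Q[OF hclass_carrier that] by (simp add: QM.act_def M.act_def)
  have xe: "?x \<in> QM.eig (wt0 (q\<^sup>2))"
    unfolding QM.eig_def using act_cls[OF xc] M.eigD(2)[OF gen(2)] Q.cls_carrier[OF xc] by auto
  have Tx: "QM.opT N2 ?x = QM.sc q ?x"
    using act_cls[OF xc] gen(3) by simp
  have gx: "\<exists>r\<in>carrier (hecke q). y = r \<odot>\<^bsub>Q.Q\<^esub> ?x" if y: "y \<in> carrier Q.Q" for y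
  proof -
    obtain z where z: "z \<in> carrier M" "y = Q.cls z" using y Q.carrier_Q by auto
    then obtain r where "r \<in> carrier (hecke q)" "z = r \<odot>\<^bsub>M\<^esub> x" using gen(4) by blast
    then show ?thesis using z Q.smult_Q[of r x] xc by auto
  qed
  obtain S where S: "S \<subseteq> wt_orbit (q\<^sup>2)" "QM.flag (carrier Q.Q) S"
    using cyclic_flag[OF QM.hecke_module_axioms xe Tx gx] by blast
  obtain f where f: "bij_betw f (carrier N) (carrier L)"
    "\<And>r y. r \<in> carrier (hecke q) \<Longrightarrow> y \<in> carrier N \<Longrightarrow> f (r \<odot>\<^bsub>N\<^esub> y) = r \<odot>\<^bsub>L\<^esub> f y" "f \<zero>\<^bsub>N\<^esub> = \<zero>\<^bsub>L\<^esub>"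
    using module_isomorphicE[OF iso[folded J_def K_def, folded N_def] N.left_module_axioms L] by metis
  have f_act: "f (N.act h y) = L.act h (f y)" if "y \<in> carrier N" for h y
    using f(2)[OF hclass_carrier that] by (simp add: N.act_def L.act_def)
  have f_inj: "y = z" if "f y = f z" "y \<in> carrier N" "z \<in> carrier N" for y z
    using f(1) that by (meson bij_betw_def inj_onD)
  have p0: "q\<^sup>2 \<noteq> 0" using q by simp
  show "weights q L \<subseteq> wt_orbit (q\<^sup>2)"
  proof
    fix s assume "s \<in> weights q L"
    then obtain m where m: "m \<in> L.eig s" "m \<noteq> \<zero>\<^bsub>L\<^esub>" using L.weight_eig(2) by blast
    then have "m \<in> f ` carrier N"
      using bij_betw_imp_surj_on[OF f(1)] L.eigD(1) by simp
    then obtain y where y: "y \<in> carrier N" "m = f y" by blast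
    have "N.opX \<nu> y = N.sc (s \<nu>) y" for \<nu>
      by (rule f_inj) (use y L.eigD(2)[OF m(1), of \<nu>] in \<open>simp_all add: f_act\<close>)
    then have "y \<in> QM.eig s" using y \<open>carrier N \<subseteq> carrier Q.Q\<close> unfolding QM.eig_def act by auto
    moreover have "y \<noteq> \<zero>\<^bsub>Q.Q\<^esub>" using m y f(3) ops by auto
    ultimately show "s \<in> wt_orbit (q\<^sup>2)"
      using QM.flag_eigenweight[OF S(2) QM.eigD(1)] S(1) by blast
  qed
  have "QM.stable (range GX) (carrier N)"
    unfolding QM.stable_def QM.subsp_def using \<open>carrier N \<subseteq> carrier Q.Q\<close>
    by (auto simp flip: ops act)
  moreover obtain y where "y \<in> carrier N" "y \<noteq> \<zero>\<^bsub>N\<^esub>"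
    using irrJ N.M.zero_closed unfolding irreducible_module_def N_def[symmetric] by blast
  ultimately obtain y s where y: "y \<in> carrier N" "y \<noteq> \<zero>\<^bsub>N\<^esub>" "y \<in> QM.eig s"
    using QM.flag_eigenvector_exists[OF S(2), of "carrier N" y] \<open>carrier N \<subseteq> carrier Q.Q\<close> ops(3) by auto
  then have "s \<in> S" using QM.flag_eigenweight[OF S(2) QM.eigD(1)] ops(3) by metis
  then have s: "s \<in> torus" using S(1) wt_torus[OF p0] by blast
  have "L.opX \<nu> (f y) = L.sc (s \<nu>) (f y)" for \<nu>
    using f_act[OF y(1)] QM.eigD(2)[OF y(3), of \<nu>] act by metis
  then have "f y \<in> L.eig s"
    using bij_betwE[OF f(1)] y(1) unfolding L.eig_def by blast
  moreover have "f y \<noteq> \<zero>\<^bsub>L\<^esub>"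
    using f_inj[of y "\<zero>\<^bsub>N\<^esub>"] f(3) y by auto
  ultimately show "weights q L \<noteq> {}" using L.eig_weight[OF s] by blast
qed

end

theorem proposition25:
  fixes q :: complex
    and V :: "(free_alg set, 'a) module" and v :: 'a
    and V' :: "(free_alg set, 'b) module" and v' :: 'b
    and L :: "(free_alg set, 'c) module"
  assumes "q \<noteq> 0" and "q\<^sup>2 \<noteq> 1" and "q\<^sup>2 \<noteq> -1"
    and "one_dim_module q N2 V v q (torus_pt 1 (q\<^sup>2))"
    and "one_dim_module q N2 V' v' (- inverse q) (weyl_act w0 (torus_pt 1 (q\<^sup>2)))"
    and "left_module (hecke q) L"
  shows "irreducible_module (hecke q) L \<and> has_central_character q L (torus_pt 1 (q\<^sup>2)) \<longleftrightarrow>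
    is_composition_factor (hecke q) (induced_module (hecke q) (parabolic q N2) V) L \<or>
    is_composition_factor (hecke q) (induced_module (hecke q) (parabolic q N2) V') L"
proof -
  let ?q = "- inverse q"
  interpret L: hecke_module q L using assms(6) by (simp add: hecke_module_def)
  note q = assms(1-3)
  have p0: "q\<^sup>2 \<noteq> 0" using q by simp
  have sq: "?q\<^sup>2 = inverse (q\<^sup>2)" by (simp add: power_inverse)
  have q': "?q \<noteq> 0" "?q\<^sup>2 \<noteq> 1" "?q\<^sup>2 \<noteq> -1"
    by (rule parameter_conditions[OF q])+
  have V': "one_dim_module ?q N2 V' v' ?q (torus_pt 1 (?q\<^sup>2))"
    using assms(5) unfolding one_dim_module_def hecke_parameter weyl_act_longest sq .
  have orb: "has_central_character q L (torus_pt 1 (q\<^sup>2)) \<longleftrightarrow> weights q L \<noteq> {} \<and> weights q L \<subseteq> wt_orbit (q\<^sup>2)"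
    unfolding has_central_character_def weyl_orbit[OF p0] ..
  have weights: "weights ?q L = weights q L"
    by (simp add: weights_def gen_weight_space_def hecke_parameter)
  show ?thesis
  proof
    assume "irreducible_module (hecke q) L \<and> has_central_character q L (torus_pt 1 (q\<^sup>2))"
    then have irr: "irreducible_module (hecke q) L" and w: "weights q L \<noteq> {}" "weights q L \<subseteq> wt_orbit (q\<^sup>2)"
      unfolding orb by blast+
    obtain s where s: "s \<in> weights q L" using w(1) by blast
    then obtain m where m: "m \<in> L.eig s" "m \<noteq> \<zero>\<^bsub>L\<^esub>" using L.weight_eig(2) by blast
    have "s \<in> wt_orbit (q\<^sup>2)" using s w(2) by blast
    from L.orbit_classification[OF q this m]
    consider (1) "(\<exists>m\<in>L.eig (wt0 (q\<^sup>2)). m \<noteq> \<zero>\<^bsub>L\<^esub>) \<or> (\<exists>m. L.mixed_line q m) \<or> (\<exists>m. L.middle_vector q m)"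
      | (2) "(\<exists>m\<in>L.eig (wt0 (?q\<^sup>2)). m \<noteq> \<zero>\<^bsub>L\<^esub>) \<or> (\<exists>m. L.mixed_line ?q m) \<or> (\<exists>m. L.middle_vector ?q m)"
      by blast
    then show "is_composition_factor (hecke q) (induced_module (hecke q) (parabolic q N2) V) L \<or>
      is_composition_factor (hecke q) (induced_module (hecke q) (parabolic q N2) V') L"
    proof cases
      case 1
      then show ?thesis using irreducible_is_factor[OF q assms(4) irr] by blast
    next
      case 2
      have "is_composition_factor (hecke ?q) (induced_module (hecke ?q) (parabolic ?q N2) V') L"
        by (rule irreducible_is_factor[OF q' V'])
          (use irr 2 in \<open>simp_all only: hecke_parameter L.parameter_invariance\<close>)
      then show ?thesis unfolding hecke_parameter by blast
    qed
  next
    assume "is_composition_factor (hecke q) (induced_module (hecke q) (parabolic q N2) V) L \<or>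
      is_composition_factor (hecke q) (induced_module (hecke q) (parabolic q N2) V') L"
    then show "irreducible_module (hecke q) L \<and> has_central_character q L (torus_pt 1 (q\<^sup>2))"
    proof
      assume "is_composition_factor (hecke q) (induced_module (hecke q) (parabolic q N2) V) L"
      then show ?thesis unfolding orb using factor_weights[OF q assms(4,6)] by blast
    next
      assume "is_composition_factor (hecke q) (induced_module (hecke q) (parabolic q N2) V') L"
      then have "irreducible_module (hecke ?q) L \<and> weights ?q L \<noteq> {} \<and> weights ?q L \<subseteq> wt_orbit (?q\<^sup>2)"
        using factor_weights[OF q' V', of L] assms(6) unfolding hecke_parameter by blast
      then show ?thesis unfolding orb weights hecke_parameter sq wt_orbit_inverse .
    qed
  qed
qed

end
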